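(* Let $\mathbf s=\{s_j\}_{j\ge1}$ be a strictly increasing sequence with $s_1>0$ and $\lim_{j\to\infty}s_j=\infty$, and let $V_{j,k}=s_j\wedge s_k$, $j,k\in\mathbb N$. Let $f=Vh$, where $h\in\ell_1^+$, and for $\alpha>0$ let $\widetilde Y_\alpha=\{\widetilde Y_{\alpha,j}\}_{j\in\mathbb N}$ be an $\alpha$-permanental sequence with kernel $\widetilde V_{j,k}=V_{j,k}+f_k$, $j,k\in\mathbb N$. (i) If $\limsup_{j\to\infty}s_j/s_{j-1}<\infty$, then $$\limsup_{j\to\infty}\frac{\widetilde Y_{\alpha,j}}{s_j\log\log s_j}=1\quad\text{a.s.},\qquad\forall\,\alpha>0.$$ (ii) If $\liminf_{j\to\infty}s_j/s_{j-1}>1$, then $$\limsup_{j\to\infty}\frac{\widetilde Y_{\alpha,j}}{s_j\log j}=1\quad\text{a.s.},\qquad\forall\,\alpha>0.$$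
   Context: $\mathbb N=\{1,2,\dots\}$; $\ell_1^+$ is the set of non-negative summable sequences; $a\wedge b=\min(a,b)$; $(Vh)_j=\sum_{k}V_{j,k}h_k$. Permanental sequences: for $\alpha>0$ and a matrix $K=\{K_{j,k}\}_{j,k\in\mathbb N}$, an $\alpha$-permanental sequence with kernel $K$ is a sequence $\{Z_j\}_{j\in\mathbb N}$ of non-negative random variables such that for all $n$, all distinct $i_1,\dots,i_n\in\mathbb N$ and all $t_1,\dots,t_n>0$, $E\exp(-\sum_{m=1}^n t_mZ_{i_m})=\det(I+K'T)^{-\alpha}$, where $K'=\{K_{i_p,i_q}\}_{p,q=1}^n$ and $T=\mathrm{diag}(t_1,\dots,t_n)$. For every $\alpha>0$ an $\alpha$-permanental sequence with kernel $\widetilde V$ exists, because $V$ is the strictly positive potential density of a symmetric transient Markov chain on $\mathbb N$ and $f$ is a finite excessive function for it. *)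

theory Defs
  imports "HOL-Probability.Probability" "Jordan_Normal_Form.Determinant"
begin

(* Sequences indexed by {1, 2, ...} are functions on nat of which only the values at
   arguments >= 1 are used; the value at 0 is irrelevant. *)

definition ell1_plus :: "(nat \<Rightarrow> real) set" where
  "ell1_plus = {h. (\<forall>k\<ge>1. 0 \<le> h k) \<and> h summable_on {1..}}"

definition kernel_apply :: "(nat \<Rightarrow> nat \<Rightarrow> real) \<Rightarrow> (nat \<Rightarrow> real) \<Rightarrow> nat \<Rightarrow> real" where
  "kernel_apply V h j = (\<Sum>\<^sub>\<infinity>k\<in>{1..}. V j k * h k)"

definition min_kernel :: "(nat \<Rightarrow> real) \<Rightarrow> nat \<Rightarrow> nat \<Rightarrow> real" where
  "min_kernel s j k = min (s j) (s k)"

(* No positivity of the determinant has to be required separately: the left-hand side is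
   positive while 0 powr a = 0, so the determinant never vanishes for t > 0; it is continuous
   in t and tends to 1 as t tends to 0, hence it is positive and powr is the usual power. *)

definition permanental_sequence ::
  "'a measure \<Rightarrow> real \<Rightarrow> (nat \<Rightarrow> nat \<Rightarrow> real) \<Rightarrow> (nat \<Rightarrow> 'a \<Rightarrow> real) \<Rightarrow> bool" where
  "permanental_sequence M \<alpha> K Z \<longleftrightarrow>
     (\<forall>j\<ge>1. Z j \<in> borel_measurable M \<and> (\<forall>\<omega>\<in>space M. 0 \<le> Z j \<omega>)) \<and>
     (\<forall>(n::nat) (i::nat \<Rightarrow> nat) (t::nat \<Rightarrow> real).
        inj_on i {..<n} \<and> (\<forall>m<n. 1 \<le> i m) \<and> (\<forall>m<n. 0 < t m) \<longrightarrow>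
        (\<integral>\<omega>. exp (- (\<Sum>m<n. t m * Z (i m) \<omega>)) \<partial>M) =
          Determinant.det (1\<^sub>m n + Matrix.mat n n (\<lambda>(p, q). K (i p) (i q)) * mat_diag n t)
            powr (- \<alpha>))"

end

(* Listing points in decreasing order of s, Gaussian elimination writes the determinant of I + KT
   through pivots v_k in (0, 1], and, f being concave in s, det(I + KT)^(-alpha) becomes a power
   series with non-negative coefficients in 1/(d_k + t_k), times prod (d_k + t_k)^(-alpha), where
   d_k = 1/(s_k - s_{k-1}) + 1/(s_{k+1} - s_k).  By uniqueness of Laplace transforms the finite
   dimensional laws are mixtures of products of gamma laws with shapes alpha + integer and rates
   d_k, so P(Y_k <= a_k for all k) is at most the product of the P(Gamma_alpha <= d_k a_k).  Along a
   geometrically growing subsequence d_k is close to 1/s_k and the product vanishes: this is the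
   lower bound.  The upper bounds come from the gamma marginals and Borel-Cantelli; when s grows
   slowly, blocks theta^n <= s_j < theta^(n+1) are controlled by chaining the exponential moments
   of the increments. *)

theory Submission
  imports Defs "HOL-Real_Asymp.Real_Asymp"
begin

text \<open>The kernel is in general not symmetric and \<alpha> is arbitrary, so squares of Gaussian
  variables are no help, and the variables along a subsequence are dependent, so the second
  Borel-Cantelli lemma does not apply. The product bound takes over the role of independence. It
  passes from the components to the mixture because the weights sum to one, and it holds in each
  component because raising a gamma shape by an integer reweights by a power of y and only makes
  small values less likely.

  After elimination the numerator of the determinant still contains t with positive powers, which is
  no series in 1/(d_k + t_k). Summation by parts replaces these terms by the increments of the
  slopes of f; concavity is exactly what gives the increments the right sign.

  Both constants are 1 for two reasons: along a subsequence with ratio Q the rate d_k is at most (Q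
  + 1)/(Q - 1)/s_k, and this factor tends to 1 as Q grows; and f_j/s_j tends to 0, so the gamma
  marginals have scale s_j (1 + o(1)).\<close>

section \<open>Determinants of the kernels\<close>

text \<open>With p = t and q = t * g this is I + K T for the kernel min (x i) (x j) + g j. Keeping p
  and q independent makes the class closed under elimination, which changes the two by different
  amounts.\<close>

definition perturbed_min_mat :: "nat \<Rightarrow> (nat \<Rightarrow> real) \<Rightarrow> (nat \<Rightarrow> real) \<Rightarrow> (nat \<Rightarrow> real) \<Rightarrow> real mat" where
  "perturbed_min_mat n x p q =
     Matrix.mat n n (\<lambda>(i, j). (if i = j then 1 else 0) + p j * min (x i) (x j) + q j)"

text \<open>Rows 0 and 1 agree up to the identity part outside column 0, because x j \<le> x 1 gives
  min (x 0) (x j) = min (x 1) (x j) for j \<ge> 1. Subtracting row 1 leaves the pivot and an entry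
  -1 in column 1; adding c times column 0 to column 1 clears that entry. In the minor the min terms
  of column 0 are all x i = min (x i) (x 1), so the column operation only changes p 1 and q
  1.\<close>

lemma det_perturbed_min_mat_Suc:
  fixes x p q :: "nat \<Rightarrow> real"
  assumes dec: "\<And>i. i < Suc n \<Longrightarrow> x (Suc i) < x i"
    and nz: "1 + (x 0 - x 1) * p 0 \<noteq> 0"
  defines "c \<equiv> 1 / (1 + (x 0 - x 1) * p 0)"
  shows "Determinant.det (perturbed_min_mat (Suc (Suc n)) x p q) =
    (1 + (x 0 - x 1) * p 0) * Determinant.det (perturbed_min_mat (Suc n) (x \<circ> Suc)
       ((p \<circ> Suc)(0 := p 1 + p 0 * c)) ((q \<circ> Suc)(0 := q 1 + q 0 * c)))"
proof -
  let ?N = "Suc (Suc n)"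
  let ?A = "perturbed_min_mat ?N x p q"
  define B where "B = addrow (-1) 0 1 ?A"
  define C where "C = addcol c 1 0 B"
  have A: "?A \<in> carrier_mat ?N ?N" by (simp add: perturbed_min_mat_def)
  have Bc: "B \<in> carrier_mat ?N ?N" using A by (simp add: B_def)
  have Cc: "C \<in> carrier_mat ?N ?N" using Bc by (auto simp: C_def mat_addcol_def)
  have dets: "Determinant.det C = Determinant.det ?A"
    using det_addrow[OF _ _ A, of 1 0 "-1"] det_addcol[OF _ _ Bc, of 0 1 c]
    by (simp add: B_def C_def)
  have le1: "x i \<le> x 1" if "1 \<le> i" "i < ?N" for i
    using that
  proof (induction i rule: dec_induct)
    case (step k)
    then show ?case using dec[of k] by auto
  qed simp
  have le0: "x i \<le> x 0" if "i < ?N" for i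
    using le1[of i] dec[of 0] that by (cases i) auto
  have C0: "C $$ (0, j) = (if j = 0 then 1 + (x 0 - x 1) * p 0 else 0)" if "j < ?N" for j
    using that le1[of j] dec[of 0] nz
    by (auto simp: C_def B_def perturbed_min_mat_def c_def min_def field_simps)
  have "Determinant.det C = (\<Sum>j<?N. C $$ (0, j) * cofactor C 0 j)"
    by (rule laplace_expansion_row[OF Cc]) simp
  also have "\<dots> = (\<Sum>j\<in>{0}. C $$ (0, j) * cofactor C 0 j)"
    by (rule sum.mono_neutral_right) (auto simp: C0)
  also have "\<dots> = (1 + (x 0 - x 1) * p 0) * Determinant.det (mat_delete C 0 0)"
    by (simp add: C0 cofactor_def)
  also have "mat_delete C 0 0 = perturbed_min_mat (Suc n) (x \<circ> Suc)
       ((p \<circ> Suc)(0 := p 1 + p 0 * c)) ((q \<circ> Suc)(0 := q 1 + q 0 * c))"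
  proof (rule eq_matI)
    fix i j
    assume "i < dim_row (perturbed_min_mat (Suc n) (x \<circ> Suc) ((p \<circ> Suc)(0 := p 1 + p 0 * c)) ((q \<circ> Suc)(0 := q 1 + q 0 * c)))"
      and "j < dim_col (perturbed_min_mat (Suc n) (x \<circ> Suc) ((p \<circ> Suc)(0 := p 1 + p 0 * c)) ((q \<circ> Suc)(0 := q 1 + q 0 * c)))"
    then have ij: "i < Suc n" "j < Suc n" by (auto simp: perturbed_min_mat_def)
    show "mat_delete C 0 0 $$ (i, j) = perturbed_min_mat (Suc n) (x \<circ> Suc)
       ((p \<circ> Suc)(0 := p 1 + p 0 * c)) ((q \<circ> Suc)(0 := q 1 + q 0 * c)) $$ (i, j)"
      using ij le1[of "Suc i"] le0[of "Suc i"]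
      by (auto simp: mat_delete_def C_def B_def perturbed_min_mat_def algebra_simps min_absorb1)
  qed (use Cc in \<open>auto simp: mat_delete_def perturbed_min_mat_def\<close>)
  finally show ?thesis using dets by simp
qed

primrec pivot :: "(nat \<Rightarrow> real) \<Rightarrow> (nat \<Rightarrow> real) \<Rightarrow> nat \<Rightarrow> real" where
  "pivot d t 0 = 1 / (1 + d 0 * t 0)"
| "pivot d t (Suc k) = 1 / (1 + d (Suc k) * (t (Suc k) + (1 - pivot d t k) / d k))"

primrec carry :: "(nat \<Rightarrow> real) \<Rightarrow> (nat \<Rightarrow> real) \<Rightarrow> nat \<Rightarrow> real" where
  "carry v q 0 = q 0"
| "carry v q (Suc k) = q (Suc k) + carry v q k * v k"

text \<open>Unrolled, this is m 0 * v 0 * ... * v k plus the sum over i of (m i - m (i - 1)) * v i *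
  ... * v k: a polynomial in the pivots whose coefficients are non-negative when m is non-negative
  and increasing.\<close>

primrec deficit :: "(nat \<Rightarrow> real) \<Rightarrow> (nat \<Rightarrow> real) \<Rightarrow> nat \<Rightarrow> real" where
  "deficit v m 0 = v 0 * m 0"
| "deficit v m (Suc k) = v (Suc k) * (deficit v m k + (m (Suc k) - m k))"

lemma pivot_bounds:
  assumes "\<And>i. i \<le> k \<Longrightarrow> 0 < d i" "\<And>i. i \<le> k \<Longrightarrow> 0 \<le> t i"
  shows "0 < pivot d t k \<and> pivot d t k \<le> 1"
  using assms
proof (induction k)
  case 0
  then show ?case by (simp add: add_pos_nonneg)
next
  case (Suc k)
  then have v: "0 < pivot d t k" "pivot d t k \<le> 1" by auto
  have "0 \<le> d (Suc k) * (t (Suc k) + (1 - pivot d t k) / d k)"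
    using Suc.prems(1)[of k] Suc.prems(1)[of "Suc k"] Suc.prems(2)[of "Suc k"] v by simp
  then show ?case by simp
qed

lemma one_minus_recip:
  fixes a b :: real
  assumes "a \<noteq> 0" "1 + a * b \<noteq> 0"
  shows "(1 - 1 / (1 + a * b)) / a = b * (1 / (1 + a * b))"
proof -
  have "1 - 1 / (1 + a * b) = a * b / (1 + a * b)"
    using assms(2) by (simp add: diff_divide_eq_iff)
  then show ?thesis using assms(1) by simp
qed

lemma pivot_shift:
  assumes "d 0 \<noteq> 0" "1 + d 0 * t 0 \<noteq> 0"
  shows "pivot (d \<circ> Suc) ((t \<circ> Suc)(0 := t 1 + t 0 * pivot d t 0)) k = pivot d t (Suc k)"
proof (induction k)
  case 0
  have "(1 - pivot d t 0) / d 0 = t 0 * pivot d t 0"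
    using one_minus_recip[OF assms] by simp
  then have "pivot d t (Suc 0) = 1 / (1 + d (Suc 0) * (t 1 + t 0 * pivot d t 0))"
    by (simp only: pivot.simps(2) One_nat_def)
  then show ?case by (simp only: pivot.simps(1)) simp
qed simp

lemma carry_shift:
  "carry (v \<circ> Suc) ((q \<circ> Suc)(0 := q 1 + q 0 * v 0)) k = carry v q (Suc k)"
  by (induction k) auto

lemma det_perturbed_min_mat:
  fixes x p q :: "nat \<Rightarrow> real"
  assumes "\<And>i. i \<le> n \<Longrightarrow> x (Suc i) < x i" "x (Suc n) = 0" "\<And>i. i \<le> n \<Longrightarrow> 0 \<le> p i"
  defines "v \<equiv> pivot (\<lambda>k. x k - x (Suc k)) p"
  shows "Determinant.det (perturbed_min_mat (Suc n) x p q) * (\<Prod>k\<le>n. v k) = 1 + carry v q n * v n"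
  using assms(1-3) unfolding v_def
proof (induction n arbitrary: x p q)
  case 0
  then have "1 + x 0 * p 0 > 0" by (intro add_pos_nonneg mult_nonneg_nonneg) (auto intro: less_imp_le)
  then show ?case using 0
    by (simp add: perturbed_min_mat_def det_single field_simps)
next
  case (Suc n)
  let ?d = "\<lambda>k. x k - x (Suc k)"
  let ?v = "pivot ?d p"
  let ?p = "(p \<circ> Suc)(0 := p 1 + p 0 * ?v 0)"
  let ?q = "(q \<circ> Suc)(0 := q 1 + q 0 * ?v 0)"
  have d0: "x 0 - x 1 > 0" using Suc.prems(1)[of 0] by simp
  have pos: "1 + (x 0 - x 1) * p 0 > 0"
    using d0 Suc.prems(3)[of 0] by (intro add_pos_nonneg) auto
  have v0: "0 < ?v 0" using pivot_bounds[of 0 ?d p] Suc.prems(3)[of 0] d0 by auto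
  have dcomp: "(\<lambda>k. (x \<circ> Suc) k - (x \<circ> Suc) (Suc k)) = ?d \<circ> Suc" by auto
  have vs: "pivot (\<lambda>k. (x \<circ> Suc) k - (x \<circ> Suc) (Suc k)) ?p = ?v \<circ> Suc"
    unfolding dcomp using pivot_shift[of ?d p] d0 pos by (auto simp: fun_eq_iff)
  have IH: "Determinant.det (perturbed_min_mat (Suc n) (x \<circ> Suc) ?p ?q) * (\<Prod>k\<le>n. (?v \<circ> Suc) k)
      = 1 + carry (?v \<circ> Suc) ?q n * (?v \<circ> Suc) n"
    unfolding vs[symmetric]
  proof (rule Suc.IH)
    show "0 \<le> ?p i" if "i \<le> n" for i
      using Suc.prems(3)[of "Suc i"] Suc.prems(3)[of 0] v0 that by auto
  qed (use Suc.prems in auto)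
  have "Determinant.det (perturbed_min_mat (Suc (Suc n)) x p q) = (1 + (x 0 - x 1) * p 0) *
      Determinant.det (perturbed_min_mat (Suc n) (x \<circ> Suc) ?p ?q)"
    using det_perturbed_min_mat_Suc[of n x p q] Suc.prems(1) pos by simp
  moreover have "(\<Prod>k\<le>Suc n. ?v k) = ?v 0 * (\<Prod>k\<le>n. ?v (Suc k))"
    by (rule prod.atMost_Suc_shift)
  moreover have "(1 + (x 0 - x 1) * p 0) * ?v 0 = 1" using pos by simp
  ultimately have "Determinant.det (perturbed_min_mat (Suc (Suc n)) x p q) * (\<Prod>k\<le>Suc n. ?v k)
      = 1 * (Determinant.det (perturbed_min_mat (Suc n) (x \<circ> Suc) ?p ?q) * (\<Prod>k\<le>n. (?v \<circ> Suc) k))"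
    by (simp add: mult_ac del: pivot.simps) 
  then show ?case using IH carry_shift[of ?v q n] by simp
qed

text \<open>Summation by parts along the elimination: each g k is written as g (Suc k) + m k * d k,
  and the factors of t are absorbed by (1 - v) / d. What remains outside the slopes is a boundary
  term with g (Suc k), which disappears at the end of the list, where g is 0.\<close>

lemma carry_eq_deficit:
  fixes x g t :: "nat \<Rightarrow> real"
  assumes "\<And>i. i \<le> k \<Longrightarrow> x (Suc i) < x i" "\<And>i. i \<le> k \<Longrightarrow> 0 \<le> t i"
  defines "d \<equiv> \<lambda>k. x k - x (Suc k)"
  defines "v \<equiv> pivot d t" and "m \<equiv> \<lambda>k. (g k - g (Suc k)) / d k"
  shows "carry v (\<lambda>k. t k * g k) k * v k + deficit v m k = m k + g (Suc k) * (1 - v k) / d k"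
  using assms(1,2)
proof (induction k)
  case 0
  then have d0: "d 0 > 0" by (simp add: d_def)
  then have "1 + d 0 * t 0 > 0" using 0 by (intro add_pos_nonneg) auto
  then have *: "t 0 * v 0 = (1 - v 0) / d 0" using one_minus_recip[of "d 0" "t 0"] d0 by (simp add: v_def)
  have g: "g 0 = g 1 + m 0 * d 0" using d0 by (simp add: m_def)
  have "carry v (\<lambda>k. t k * g k) 0 * v 0 = g 0 * (t 0 * v 0)" by simp
  also have "\<dots> = (g 1 + m 0 * d 0) * ((1 - v 0) / d 0)" by (simp only: * g)
  also have "\<dots> = g 1 * (1 - v 0) / d 0 + m 0 * (1 - v 0)" using d0 by (simp add: field_simps)
  finally show ?case by (simp add: algebra_simps)
next
  case (Suc k)
  have dk: "d k > 0" "d (Suc k) > 0" using Suc.prems(1)[of k] Suc.prems(1)[of "Suc k"] by (auto simp: d_def)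
  define R where "R = t (Suc k) + (1 - v k) / d k"
  have "v k \<le> 1" unfolding v_def using pivot_bounds[of k d t] Suc.prems by (auto simp: d_def)
  then have "R \<ge> 0" unfolding R_def using dk Suc.prems(2)[of "Suc k"] by simp
  then have pos: "1 + d (Suc k) * R > 0" using dk by (intro add_pos_nonneg) auto
  have vS: "v (Suc k) = 1 / (1 + d (Suc k) * R)" by (simp add: v_def R_def)
  have *: "(1 - v (Suc k)) / d (Suc k) = R * v (Suc k)"
    unfolding vS using one_minus_recip[of "d (Suc k)" R] pos dk by simp
  have g: "g (Suc k) = g (Suc (Suc k)) + m (Suc k) * d (Suc k)" using dk by (simp add: m_def)
  have IH: "carry v (\<lambda>k. t k * g k) k * v k = m k + g (Suc k) * (1 - v k) / d k - deficit v m k"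
    using Suc by simp
  have "carry v (\<lambda>k. t k * g k) (Suc k) * v (Suc k) =
      v (Suc k) * (g (Suc k) * R + m k - deficit v m k)"
  proof -
    have "carry v (\<lambda>k. t k * g k) (Suc k) = t (Suc k) * g (Suc k) + (m k + g (Suc k) * (1 - v k) / d k - deficit v m k)"
      using IH by simp
    also have "\<dots> = g (Suc k) * R + m k - deficit v m k"
      by (simp add: R_def algebra_simps)
    finally show ?thesis by (simp add: mult.commute)
  qed
  then have "carry v (\<lambda>k. t k * g k) (Suc k) * v (Suc k) + deficit v m (Suc k)
     = g (Suc k) * (R * v (Suc k)) + v (Suc k) * m (Suc k)"
    by (simp add: algebra_simps)
  also have "g (Suc k) * (R * v (Suc k)) = g (Suc (Suc k)) * (R * v (Suc k)) + m (Suc k) * (d (Suc k) * R * v (Suc k))"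
    by (subst g) (simp add: algebra_simps)
  also have "d (Suc k) * R * v (Suc k) = 1 - v (Suc k)" using * dk by (simp add: field_simps)
  finally have "carry v (\<lambda>k. t k * g k) (Suc k) * v (Suc k) + deficit v m (Suc k) =
      m (Suc k) + g (Suc (Suc k)) * (R * v (Suc k))" by (simp add: algebra_simps)
  then show ?case by (simp only: *[symmetric] times_divide_eq_right)
qed

text \<open>Points are listed in decreasing order, so concavity makes the slopes m increase with the
  index. The upper bound keeps the numerator 1 + m n - deficit at least 1.\<close>

lemma deficit_bounds:
  assumes "\<And>i. i \<le> k \<Longrightarrow> 0 \<le> v i \<and> v i \<le> 1" "0 \<le> m 0" "\<And>i. i < k \<Longrightarrow> m i \<le> m (Suc i)"
  shows "0 \<le> deficit v m k \<and> deficit v m k \<le> m k"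
  using assms
proof (induction k)
  case 0
  then show ?case by (auto simp: mult_left_le_one_le)
next
  case (Suc k)
  then have IH: "0 \<le> deficit v m k" "deficit v m k \<le> m k" by auto
  have "0 \<le> v (Suc k)" "v (Suc k) \<le> 1" "m k \<le> m (Suc k)" using Suc.prems by auto
  moreover from this have "v (Suc k) * (deficit v m k + (m (Suc k) - m k)) \<le> 1 * (deficit v m k + (m (Suc k) - m k))"
    using IH by (intro mult_right_mono) auto
  ultimately show ?case using IH by auto
qed

text \<open>Expressing the determinant through the slopes of \<open>g\<close> removes the positive powers of \<open>t\<close>.\<close>

lemma det_excessive_kernel:
  fixes x g t :: "nat \<Rightarrow> real"
  assumes "\<And>i. i \<le> n \<Longrightarrow> x (Suc i) < x i" "x (Suc n) = 0" "g (Suc n) = 0" "\<And>i. i \<le> n \<Longrightarrow> 0 \<le> t i"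
  defines "d \<equiv> \<lambda>k. x k - x (Suc k)"
  defines "v \<equiv> pivot d t" and "m \<equiv> \<lambda>k. (g k - g (Suc k)) / d k"
  shows "Determinant.det (perturbed_min_mat (Suc n) x t (\<lambda>k. t k * g k)) * (\<Prod>k\<le>n. v k) =
    1 + m n - deficit v m n"
  using det_perturbed_min_mat[of n x t "\<lambda>k. t k * g k"] carry_eq_deficit[of n x t g] assms
  by simp

section \<open>Power series with non-negative coefficients\<close>

text \<open>The monomials are listed in a single sequence, possibly with repetitions, and the
  coefficients are in \<open>ennreal\<close>. Products and countable sums of such series are then
  mere reindexings, with no question of convergence.\<close>

definition pos_series :: "nat \<Rightarrow> (nat \<Rightarrow> 't \<Rightarrow> ennreal) \<Rightarrow> 't set \<Rightarrow> ('t \<Rightarrow> ennreal) \<Rightarrow> bool" where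
  "pos_series n Z T F \<longleftrightarrow>
     (\<exists>p k. \<forall>t\<in>T. F t = (\<Sum>j. p j * (\<Prod>i<n. Z i t ^ k j i)))"

lemma pos_series_cong:
  "pos_series n Z T F \<Longrightarrow> (\<And>t. t \<in> T \<Longrightarrow> G t = F t) \<Longrightarrow> pos_series n Z T G"
  by (simp add: pos_series_def)

lemma pos_series_monomial: "pos_series n Z T (\<lambda>t. c * (\<Prod>i<n. Z i t ^ k i))"
proof -
  have "c * (\<Prod>i<n. Z i t ^ k i) = (\<Sum>j. (if j = 0 then c else 0) * (\<Prod>i<n. Z i t ^ k i))" for t
    by (subst suminf_finite[of "{0::nat}"]) auto
  then show ?thesis
    unfolding pos_series_def by (intro exI[of _ "\<lambda>j. if j = 0 then c else 0"] exI[of _ "\<lambda>_. k"]) auto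
qed

lemma pos_series_const: "pos_series n Z T (\<lambda>t. c)"
  using pos_series_monomial[of n Z T c "\<lambda>_. 0"] by simp

lemma pos_series_var:
  assumes "i < n"
  shows "pos_series n Z T (\<lambda>t. Z i t)"
proof -
  have "(\<Prod>l<n. Z l t ^ (if l = i then 1 else 0)) = Z i t" for t
  proof -
    have "(\<Prod>l<n. Z l t ^ (if l = i then 1 else 0)) = (\<Prod>l<n. if l = i then Z l t else 1)"
      by (intro prod.cong) auto
    then show ?thesis using assms by simp
  qed
  then show ?thesis using pos_series_monomial[of n Z T 1 "\<lambda>l. if l = i then 1 else 0"] by simp
qed

lemma pos_series_suminf:
  fixes F :: "nat \<Rightarrow> 't \<Rightarrow> ennreal"
  assumes "\<And>m. pos_series n Z T (F m)"
  shows "pos_series n Z T (\<lambda>t. \<Sum>m. F m t)"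
proof -
  obtain p k where pk: "\<And>m t. t \<in> T \<Longrightarrow> F m t = (\<Sum>j. p m j * (\<Prod>i<n. Z i t ^ k m j i))"
    using assms unfolding pos_series_def by metis
  define P where "P a = p (fst (prod_decode a)) (snd (prod_decode a))" for a
  define K where "K a = k (fst (prod_decode a)) (snd (prod_decode a))" for a
  have "(\<Sum>m. F m t) = (\<Sum>a. P a * (\<Prod>i<n. Z i t ^ K a i))" if "t \<in> T" for t
  proof -
    have "(\<Sum>a. (\<lambda>(m, j). p m j * (\<Prod>i<n. Z i t ^ k m j i)) (prod_decode a)) = (\<Sum>m. F m t)"
      by (rule suminf_ennreal_2dimen) (simp add: pk that)
    then show ?thesis by (simp add: P_def K_def case_prod_beta)
  qed
  then show ?thesis unfolding pos_series_def by (intro exI[of _ P] exI[of _ K]) auto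
qed

lemma pos_series_mult:
  assumes "pos_series n Z T F" "pos_series n Z T G"
  shows "pos_series n Z T (\<lambda>t. F t * G t)"
proof -
  obtain p k where F: "\<And>t. t \<in> T \<Longrightarrow> F t = (\<Sum>j. p j * (\<Prod>i<n. Z i t ^ k j i))"
    using assms(1) unfolding pos_series_def by metis
  obtain q l where G: "\<And>t. t \<in> T \<Longrightarrow> G t = (\<Sum>j. q j * (\<Prod>i<n. Z i t ^ l j i))"
    using assms(2) unfolding pos_series_def by metis
  have "pos_series n Z T (\<lambda>t. (p m * (\<Prod>i<n. Z i t ^ k m i)) * G t)" for m
  proof -
    have "(p m * (\<Prod>i<n. Z i t ^ k m i)) * G t =
        (\<Sum>j. (p m * q j) * (\<Prod>i<n. Z i t ^ (k m i + l j i)))" if "t \<in> T" for t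
      unfolding G[OF that] ennreal_suminf_cmult[symmetric]
      by (simp add: power_add prod.distrib mult_ac)
    then show ?thesis unfolding pos_series_def
      by (intro exI[of _ "\<lambda>j. p m * q j"] exI[of _ "\<lambda>j i. k m i + l j i"]) auto
  qed
  then have "pos_series n Z T (\<lambda>t. \<Sum>m. (p m * (\<Prod>i<n. Z i t ^ k m i)) * G t)"
    by (rule pos_series_suminf)
  then show ?thesis
    by (rule pos_series_cong) (simp add: F ennreal_suminf_multc)
qed

lemma pos_series_power:
  "pos_series n Z T F \<Longrightarrow> pos_series n Z T (\<lambda>t. F t ^ j)"
  by (induction j) (auto intro: pos_series_const pos_series_mult)

lemma pos_series_prod:
  "(\<And>i. i \<in> I \<Longrightarrow> pos_series n Z T (F i)) \<Longrightarrow> pos_series n Z T (\<lambda>t. \<Prod>i\<in>I. F i t)"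
  by (induction I rule: infinite_finite_induct) (auto intro: pos_series_const pos_series_mult)

lemma pos_series_add:
  assumes "pos_series n Z T F" "pos_series n Z T G"
  shows "pos_series n Z T (\<lambda>t. F t + G t)"
proof -
  define H where "H m = (if m = 0 then F else if m = 1 then G else (\<lambda>_. 0))" for m :: nat
  have "pos_series n Z T (H m)" for m
    using assms by (auto simp: H_def intro: pos_series_const)
  then have "pos_series n Z T (\<lambda>t. \<Sum>m. H m t)" by (rule pos_series_suminf)
  moreover have "(\<Sum>m. H m t) = F t + G t" for t
    by (subst suminf_finite[of "{0, 1}"]) (auto simp: H_def)
  ultimately show ?thesis by simp
qed

text \<open>Composition with \<open>(1 - y) powr -a = \<Sum>j. (a + j - 1 gchoose j) y\<^sup>j\<close>.\<close>

lemma pos_series_one_minus_powr: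
  fixes y :: "'t \<Rightarrow> real"
  assumes "0 \<le> a" "pos_series n Z T (\<lambda>t. ennreal (y t))" "\<And>t. t \<in> T \<Longrightarrow> 0 \<le> y t \<and> y t < 1"
  shows "pos_series n Z T (\<lambda>t. ennreal ((1 - y t) powr (- a)))"
proof -
  define c where "c j = ((- a) gchoose j) * (-1) ^ j" for j
  have "c j = (a + real j - 1) gchoose j" for j
    by (simp add: c_def gbinomial_minus flip: power_mult_distrib mult.assoc)
  moreover have "0 \<le> (a + real j - 1) gchoose j" for j
    unfolding gbinomial_prod_rev using assms(1)
    by (intro divide_nonneg_nonneg prod_nonneg) (auto simp: of_nat_diff)
  ultimately have c0: "0 \<le> c j" for j by simp
  have "pos_series n Z T (\<lambda>t. \<Sum>j. ennreal (c j) * ennreal (y t) ^ j)"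
    by (intro pos_series_suminf pos_series_mult pos_series_const pos_series_power assms(2))
  then show ?thesis
  proof (rule pos_series_cong)
    fix t assume t: "t \<in> T"
    then have y: "0 \<le> y t" "y t < 1" using assms(3) by auto
    have "(\<lambda>j. ((- a) gchoose j) * (- y t) ^ j) sums (1 + (- y t)) powr (- a)"
      using y by (intro Generalised_Binomial_Theorem.gen_binomial_real) auto
    moreover have "((- a) gchoose j) * (- y t) ^ j = c j * y t ^ j" for j
      unfolding power_minus[of "y t"] by (simp add: c_def)
    ultimately have "(\<lambda>j. c j * y t ^ j) sums ((1 - y t) powr (- a))" by simp
    then have "(\<Sum>j. ennreal (c j * y t ^ j)) = ennreal ((1 - y t) powr (- a))"
      using y c0 by (intro sums_unique[symmetric] sums_ennreal[THEN iffD2]) auto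
    then show "ennreal ((1 - y t) powr (- a)) = (\<Sum>j. ennreal (c j) * ennreal (y t) ^ j)"
      using c0 y by (simp add: ennreal_mult ennreal_power)
  qed
qed

section \<open>Uniqueness of Laplace transforms\<close>

text \<open>On [0, 1] all moments are at most 1, so the exponential series can be integrated term by
  term. The characteristic function is thereby determined by the moments, which reduces
  \<open>moments_unique\<close> to the uniqueness theorem of Levy.\<close>

lemma char_bounded_eq_moment_series:
  assumes M: "real_distribution M" and AE01: "AE x in M. 0 \<le> x \<and> x \<le> (1::real)"
  shows "char M t = (\<Sum>i. (\<i> * of_real t) ^ i /\<^sub>R fact i * of_real (\<integral>x. x ^ i \<partial>M))"
proof -
  interpret real_distribution M by fact
  let ?f = "\<lambda>i x. (\<i> * of_real t) ^ i /\<^sub>R fact i * complex_of_real (x ^ i)"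
  have ip: "integrable M (\<lambda>x. x ^ i)" for i
    by (rule integrable_const_bound[where B = 1]) (use AE01 in \<open>auto simp: power_le_one\<close>)
  have int: "integrable M (?f i)" for i
    using ip[of i] by (intro integrable_mult_right integrable_of_real)
  have ser: "(\<Sum>i. ?f i x) = iexp (t * x)" for x
    unfolding exp_def by (intro suminf_cong) (simp add: power_mult_distrib scaleR_conv_of_real)
  have nrm: "norm (?f i x) = (\<bar>t\<bar> * \<bar>x\<bar>) ^ i /\<^sub>R fact i" for i x
    by (simp add: norm_mult norm_power power_mult_distrib power_abs)
  have "(\<integral>x. (\<Sum>i. ?f i x) \<partial>M) = (\<Sum>i. integral\<^sup>L M (?f i))"
  proof (rule integral_suminf[OF int])
    show "AE x in M. summable (\<lambda>i. norm (?f i x))"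
      unfolding nrm by (intro AE_I2 summable_exp_generic)
    have "norm (integral\<^sup>L M (\<lambda>x. norm (?f i x))) \<le> \<bar>t\<bar> ^ i /\<^sub>R fact i" for i
    proof -
      have "integral\<^sup>L M (\<lambda>x. norm (?f i x)) \<le> integral\<^sup>L M (\<lambda>x. \<bar>t\<bar> ^ i /\<^sub>R fact i)"
      proof (rule integral_mono_AE)
        show "AE x in M. norm (?f i x) \<le> \<bar>t\<bar> ^ i /\<^sub>R fact i"
          using AE01 unfolding nrm
          by eventually_elim (simp add: power_mult_distrib mult_left_le power_le_one)
      qed (use integrable_norm[OF int] in \<open>auto simp del: norm_scaleR norm_mult\<close>)
      then show ?thesis by (simp add: integral_nonneg_AE prob_space[unfolded space_eq_univ])
    qed
    then show "summable (\<lambda>i. integral\<^sup>L M (\<lambda>x. norm (?f i x)))"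
      by (intro summable_comparison_test'[OF summable_exp_generic[of "\<bar>t\<bar>"], of 0]) auto
  qed
  then show ?thesis unfolding ser char_def
    by (simp add: integral_of_real[symmetric] del: of_real_power)
qed

lemma moments_unique:
  assumes "real_distribution M" "AE x in M. 0 \<le> x \<and> x \<le> (1::real)"
    and "real_distribution N" "AE x in N. 0 \<le> x \<and> x \<le> (1::real)"
    and "\<And>k. (\<integral>x. x ^ k \<partial>M) = (\<integral>x. x ^ k \<partial>N)"
  shows "M = N"
proof (rule Levy_uniqueness)
  show "char M = char N"
    by (rule ext) (simp only: char_bounded_eq_moment_series[OF assms(1,2)]
        char_bounded_eq_moment_series[OF assms(3,4)] assms(5))
qed fact+

text \<open>The weight \<open>exp (-y)\<close> makes \<open>\<mu>\<close> finite, and \<open>x = exp (-y)\<close> turns Laplace transforms at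
  integers into moments of a distribution on \<open>[0, 1]\<close>.\<close>

lemma laplace_unique:
  fixes \<mu> \<nu> :: "real measure"
  assumes sets: "sets \<mu> = sets borel" "sets \<nu> = sets borel"
    and nonneg: "AE y in \<mu>. 0 \<le> y" "AE y in \<nu>. 0 \<le> y"
    and eq: "\<And>t. t > 0 \<Longrightarrow> (\<integral>\<^sup>+y. ennreal (exp (- t * y)) \<partial>\<mu>) = (\<integral>\<^sup>+y. ennreal (exp (- t * y)) \<partial>\<nu>)"
    and fin: "(\<integral>\<^sup>+y. ennreal (exp (- y)) \<partial>\<mu>) < \<infinity>"
  shows "\<mu> = \<nu>"
proof -
  note [measurable_cong] = sets
  define c where "c = enn2real (\<integral>\<^sup>+y. ennreal (exp (- y)) \<partial>\<mu>)"
  have c: "(\<integral>\<^sup>+y. ennreal (exp (- y)) \<partial>\<mu>) = ennreal c" "(\<integral>\<^sup>+y. ennreal (exp (- y)) \<partial>\<nu>) = ennreal c"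
    using fin eq[of 1] by (auto simp: c_def)
  have c0: "c \<ge> 0" by (simp add: c_def)
  show ?thesis
  \<comment> \<open>Normalising to a probability needs c > 0. If c = 0, a strictly positive function
    has integral 0, so both measures vanish.\<close>
  proof (cases "c = 0")
    case True
    have null: "emeasure \<rho> A = 0" if "sets \<rho> = sets borel" "(\<integral>\<^sup>+y. ennreal (exp (- y)) \<partial>\<rho>) = 0"
      for \<rho> :: "real measure" and A
    proof -
      note [measurable_cong] = that(1)
      have "AE y in \<rho>. ennreal (exp (- y)) = 0"
        using that(2) by (subst (asm) nn_integral_0_iff_AE) auto
      then have "AE y in \<rho>. False" by eventually_elim simp
      then have "emeasure \<rho> (space \<rho>) = 0" by (simp add: AE_iff_measurable[OF _ refl])
      then show ?thesis
        by (metis emeasure_notin_sets emeasure_space le_zero_eq)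
    qed
    show ?thesis
      using null[OF sets(1)] null[OF sets(2)] c True sets by (intro measure_eqI) auto
  next
    case False
    then have cpos: "c > 0" using c0 by simp
    define D where "D \<rho> = distr (density \<rho> (\<lambda>y. ennreal (exp (- y) / c))) borel (\<lambda>y. exp (- y))"
      for \<rho> :: "real measure"
    have nnD: "(\<integral>\<^sup>+x. f x \<partial>D \<rho>) = (\<integral>\<^sup>+y. ennreal (exp (- y) / c) * f (exp (- y)) \<partial>\<rho>)"
      if [measurable_cong]: "sets \<rho> = sets borel" and [measurable]: "f \<in> borel_measurable borel" for \<rho> f
      unfolding D_def by (subst nn_integral_distr) (auto simp: nn_integral_density)
    have D: "real_distribution (D \<rho>) \<and> (AE x in D \<rho>. 0 \<le> x \<and> x \<le> 1) \<and>
        (\<forall>k. (\<integral>x. x ^ k \<partial>D \<rho>) = enn2real ((\<integral>\<^sup>+y. ennreal (exp (- real (Suc k) * y)) \<partial>\<rho>) / ennreal c))"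
      if s[measurable_cong]: "sets \<rho> = sets borel" and n: "AE y in \<rho>. 0 \<le> y"
        and cc: "(\<integral>\<^sup>+y. ennreal (exp (- y)) \<partial>\<rho>) = ennreal c" for \<rho>
    proof (intro conjI allI)
      have "emeasure (D \<rho>) (space (D \<rho>)) = (\<integral>\<^sup>+x. 1 \<partial>D \<rho>)" by simp
      also have "\<dots> = (\<integral>\<^sup>+y. ennreal (exp (- y)) / ennreal c \<partial>\<rho>)"
        using cpos by (subst nnD[OF s]) (auto simp: divide_ennreal)
      also have "\<dots> = 1" using cpos by (simp add: nn_integral_divide cc ennreal_divide_self)
      finally show "real_distribution (D \<rho>)"
        by (intro real_distribution.intro real_distribution_axioms.intro prob_spaceI) (auto simp: D_def)
      show AEx: "AE x in D \<rho>. 0 \<le> x \<and> x \<le> 1"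
        unfolding D_def using n by (subst AE_distr_iff) (auto simp: AE_density)
      show "(\<integral>x. x ^ k \<partial>D \<rho>) = enn2real ((\<integral>\<^sup>+y. ennreal (exp (- real (Suc k) * y)) \<partial>\<rho>) / ennreal c)" for k
      proof -
        have "(\<integral>x. x ^ k \<partial>D \<rho>) = enn2real (\<integral>\<^sup>+x. ennreal (x ^ k) \<partial>D \<rho>)"
          using AEx by (intro integral_eq_nn_integral) (auto simp: D_def)
        also have "(\<integral>\<^sup>+x. ennreal (x ^ k) \<partial>D \<rho>) = (\<integral>\<^sup>+y. ennreal (exp (- real (Suc k) * y)) / ennreal c \<partial>\<rho>)"
        proof (subst nnD[OF s], simp, rule nn_integral_cong)
          fix y
          have "exp (- y) * exp (- y) ^ k = exp (- real (Suc k) * y)"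
            by (simp add: exp_of_nat_mult[symmetric] exp_add[symmetric] algebra_simps)
          then show "ennreal (exp (- y) / c) * ennreal (exp (- y) ^ k) = ennreal (exp (- real (Suc k) * y)) / ennreal c"
            using cpos by (simp add: divide_ennreal ennreal_mult'[symmetric])
        qed
        finally show ?thesis by (simp add: nn_integral_divide)
      qed
    qed
    have "D \<mu> = D \<nu>"
    proof (rule moments_unique)
      show "(\<integral>x. x ^ k \<partial>D \<mu>) = (\<integral>x. x ^ k \<partial>D \<nu>)" for k
        using D[OF sets(1) nonneg(1) c(1)] D[OF sets(2) nonneg(2) c(2)] eq[of "real (Suc k)"]
        by (simp del: of_nat_Suc)
    qed (use D[OF sets(1) nonneg(1) c(1)] D[OF sets(2) nonneg(2) c(2)] in auto)
    \<comment> \<open>Inverse of the passage to \<open>D\<close>: the map is undone by - ln x, and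
      the density exp (- y) / c = x / c by the factor c / x.\<close>
    have recover: "emeasure \<rho> A = (\<integral>\<^sup>+x. indicator A (- ln x) * ennreal (c / x) \<partial>D \<rho>)"
      if s[measurable_cong]: "sets \<rho> = sets borel" and A[measurable]: "A \<in> sets borel" for \<rho> A
    proof -
      have "(\<integral>\<^sup>+x. indicator A (- ln x) * ennreal (c / x) \<partial>D \<rho>) =
          (\<integral>\<^sup>+y. ennreal (exp (- y) / c) * (indicator A (- ln (exp (- y))) * ennreal (c / exp (- y))) \<partial>\<rho>)"
        by (rule nnD[OF s]) measurable
      also have "\<dots> = (\<integral>\<^sup>+y. indicator A y \<partial>\<rho>)"
        using cpos by (intro nn_integral_cong) (auto simp: indicator_def ennreal_mult'[symmetric])
      finally show ?thesis using A s by simp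
    qed
    show ?thesis
    proof (rule measure_eqI)
      show "emeasure \<mu> A = emeasure \<nu> A" if "A \<in> sets \<mu>" for A
        using recover[OF sets(1), of A] recover[OF sets(2), of A] \<open>D \<mu> = D \<nu>\<close> that sets by simp
    qed (simp add: sets)
  qed
qed

section \<open>Gamma distributions\<close>

text \<open>Deliberately not normalised: the total mass is d powr (- a), a probability only for d =
  1. The Laplace transform is then exactly (d + t) powr (- a), as in the terms of the series, and
  tilting by exp (- t * y) just replaces d by d + t.\<close>

definition gamma_measure :: "real \<Rightarrow> real \<Rightarrow> real measure" where
  "gamma_measure a d = density lborel
     (\<lambda>y. ennreal (indicator {0..} y * (y powr (a - 1) * exp (- d * y) / Gamma a)))"

lemma sets_gamma_measure [simp, measurable_cong]: "sets (gamma_measure a d) = sets borel"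
  by (simp add: gamma_measure_def)

lemma space_gamma_measure [simp]: "space (gamma_measure a d) = UNIV"
  by (simp add: gamma_measure_def)

lemma nn_integral_gamma_measure:
  assumes [measurable]: "f \<in> borel_measurable borel"
  shows "(\<integral>\<^sup>+y. f y \<partial>gamma_measure a d) =
    (\<integral>\<^sup>+y. ennreal (indicator {0..} y * (y powr (a - 1) * exp (- d * y) / Gamma a)) * f y \<partial>lborel)"
  unfolding gamma_measure_def by (rule nn_integral_density) auto

lemma AE_gamma_measure_nonneg: "AE y in gamma_measure a d. 0 \<le> y"
  unfolding gamma_measure_def by (subst AE_density) (auto simp: indicator_def)

lemma gamma_measure_exp:
  assumes a: "a > 0" and [measurable]: "f \<in> borel_measurable borel"
  shows "(\<integral>\<^sup>+y. ennreal (exp (- t * y)) * f y \<partial>gamma_measure a d) = (\<integral>\<^sup>+y. f y \<partial>gamma_measure a (d + t))"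
proof -
  have "exp (- (d + t) * y) = exp (- d * y) * exp (- t * y)" for y
    by (simp add: exp_add[symmetric] algebra_simps)
  then show ?thesis using Gamma_real_pos[OF a]
    by (auto simp: nn_integral_gamma_measure indicator_def ennreal_mult'[symmetric] mult.assoc[symmetric]
        intro!: nn_integral_cong)
qed

lemma gamma_measure_scale:
  assumes a: "a > 0" and d: "d > 0" and [measurable]: "f \<in> borel_measurable borel"
  shows "(\<integral>\<^sup>+y. f y \<partial>gamma_measure a d) = ennreal (d powr (- a)) * (\<integral>\<^sup>+y. f (y / d) \<partial>gamma_measure a 1)"
proof -
  have "(\<integral>\<^sup>+y. f y \<partial>gamma_measure a d) = ennreal \<bar>1 / d\<bar> * (\<integral>\<^sup>+y. ennreal (indicator {0..} (0 + 1 / d * y) *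
     ((0 + 1 / d * y) powr (a - 1) * exp (- d * (0 + 1 / d * y)) / Gamma a)) * f (0 + 1 / d * y) \<partial>lborel)"
    unfolding nn_integral_gamma_measure[OF assms(3)] using d by (intro nn_integral_real_affine) auto
  also have "\<dots> = (\<integral>\<^sup>+y. ennreal (1 / d) * (ennreal (indicator {0..} (0 + 1 / d * y) *
     ((0 + 1 / d * y) powr (a - 1) * exp (- d * (0 + 1 / d * y)) / Gamma a)) * f (0 + 1 / d * y)) \<partial>lborel)"
    using d by (subst nn_integral_cmult) auto
  also have "\<dots> = (\<integral>\<^sup>+y. ennreal (d powr (- a)) * (ennreal (indicator {0..} y * (y powr (a - 1) * exp (- 1 * y) / Gamma a)) * f (y / d)) \<partial>lborel)"
  proof (rule nn_integral_cong)
    fix y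
    have "1 / d * (indicator {0..} (y / d) * ((y / d) powr (a - 1) * exp (- y) / Gamma a)) =
        d powr (- a) * (indicator {0..} y * (y powr (a - 1) * exp (- y) / Gamma a))"
    proof (cases "y \<ge> 0")
      case True
      have "d powr (- a) = 1 / d * (1 / d powr (a - 1))"
        using d by (simp add: powr_minus_divide powr_diff)
      then show ?thesis using True d
        by (simp add: powr_divide divide_simps)
    qed (use d in \<open>auto simp: indicator_def zero_le_divide_iff\<close>)
    moreover have "0 \<le> (indicator {0..} y * (y powr (a - 1) * exp (- y) / Gamma a))"
       "0 \<le> (indicator {0..} (y/d) * ((y/d) powr (a - 1) * exp (- y) / Gamma a))"
      using Gamma_real_pos[OF a] by auto
    ultimately show "ennreal (1 / d) * (ennreal (indicator {0..} (0 + 1 / d * y) *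
     ((0 + 1 / d * y) powr (a - 1) * exp (- d * (0 + 1 / d * y)) / Gamma a)) * f (0 + 1 / d * y)) =
      ennreal (d powr (- a)) * (ennreal (indicator {0..} y * (y powr (a - 1) * exp (- 1 * y) / Gamma a)) * f (y / d))"
      using d by (simp add: mult.assoc[symmetric] ennreal_mult'[symmetric])
  qed
  also have "\<dots> = ennreal (d powr (- a)) * (\<integral>\<^sup>+y. f (y / d) \<partial>gamma_measure a 1)"
    by (subst nn_integral_cmult) (auto simp: nn_integral_gamma_measure)
  finally show ?thesis .
qed

lemma prob_space_gamma_measure: "a > 0 \<Longrightarrow> prob_space (gamma_measure a 1)"
proof (rule prob_spaceI)
  assume a: "a > 0"
  have "emeasure (gamma_measure a 1) (space (gamma_measure a 1)) = (\<integral>\<^sup>+y. 1 \<partial>gamma_measure a 1)" by simp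
  also have "\<dots> = (\<integral>\<^sup>+y. ennreal ((indicator {0..} y * y powr (a - 1) / exp y) / Gamma a) \<partial>lborel)"
    by (subst nn_integral_gamma_measure) (auto simp: exp_minus field_simps)
  also have "\<dots> = (\<integral>\<^sup>+y. ennreal (indicator {0..} y * y powr (a - 1) / exp y) / ennreal (Gamma a) \<partial>lborel)"
    using Gamma_real_pos[OF a] by (intro nn_integral_cong) (simp add: divide_ennreal)
  also have "\<dots> = 1"
    using Gamma_real_pos[OF a] by (subst nn_integral_divide)
     (auto simp: Gamma_conv_nn_integral_real[OF a, symmetric] ennreal_divide_self)
  finally show "emeasure (gamma_measure a 1) (space (gamma_measure a 1)) = 1" .
qed

lemma gamma_measure_laplace:
  assumes "a > 0" "d + t > 0"
  shows "(\<integral>\<^sup>+y. ennreal (exp (- t * y)) \<partial>gamma_measure a d) = ennreal ((d + t) powr (- a))"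
proof -
  interpret prob_space "gamma_measure a 1" by (rule prob_space_gamma_measure) fact
  have "(\<integral>\<^sup>+y. ennreal (exp (- t * y)) * 1 \<partial>gamma_measure a d) = (\<integral>\<^sup>+y. 1 \<partial>gamma_measure a (d + t))"
    using assms by (intro gamma_measure_exp) auto
  also have "\<dots> = ennreal ((d + t) powr (- a))"
    using assms emeasure_space_1 by (subst gamma_measure_scale) auto
  finally show ?thesis by simp
qed

lemma emeasure_gamma_measure_UNIV:
  "a > 0 \<Longrightarrow> d > 0 \<Longrightarrow> emeasure (gamma_measure a d) UNIV = ennreal (d powr (- a))"
  using gamma_measure_laplace[of a d 0] by simp

definition gamma_cdf :: "real \<Rightarrow> real \<Rightarrow> real" where
  "gamma_cdf a x = measure (gamma_measure a 1) {..x}"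

lemma gamma_measure_atMost:
  assumes "a > 0" "d > 0"
  shows "emeasure (gamma_measure a d) {..x} = ennreal (gamma_cdf a (d * x)) * emeasure (gamma_measure a d) UNIV"
proof -
  interpret prob_space "gamma_measure a 1" by (rule prob_space_gamma_measure) fact
  have "emeasure (gamma_measure a d) {..x} = (\<integral>\<^sup>+y. indicator {..x} y \<partial>gamma_measure a d)" by simp
  also have "\<dots> = ennreal (d powr (- a)) * (\<integral>\<^sup>+y. indicator {..x} (y / d) \<partial>gamma_measure a 1)"
    using assms by (intro gamma_measure_scale) auto
  also have "(\<integral>\<^sup>+y. indicator {..x} (y / d) \<partial>gamma_measure a 1) = (\<integral>\<^sup>+y. indicator {..d * x} y \<partial>gamma_measure a 1)"
    using assms by (intro nn_integral_cong) (auto simp: indicator_def field_simps)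
  also have "\<dots> = ennreal (gamma_cdf a (d * x))"
    by (simp add: gamma_cdf_def emeasure_eq_measure)
  finally show ?thesis using assms by (simp add: emeasure_gamma_measure_UNIV mult.commute)
qed

lemma gamma_measure_add_nat:
  assumes a: "a > 0" and [measurable]: "f \<in> borel_measurable borel"
  shows "(\<integral>\<^sup>+y. f y \<partial>gamma_measure (a + real k) d) =
    ennreal (Gamma a / Gamma (a + real k)) * (\<integral>\<^sup>+y. ennreal (y ^ k) * f y \<partial>gamma_measure a d)"
proof -
  have G: "Gamma a > 0" "Gamma (a + real k) > 0" using a by (auto intro: Gamma_real_pos)
  have nz: "ennreal (indicator {0..} y * (y powr (a + real k - 1) * exp (- d * y) / Gamma (a + real k))) * f y =
     ennreal (Gamma a / Gamma (a + real k)) * (ennreal (indicator {0..} y * (y powr (a - 1) * exp (- d * y) / Gamma a)) *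
       (ennreal (y ^ k) * f y))" if "y \<noteq> 0" for y
  proof (cases "y > 0")
    case True
    then have "y powr (a + real k - 1) = y powr (a - 1) * y ^ k"
      by (simp add: powr_realpow[symmetric] powr_add[symmetric] algebra_simps)
    then have eq: "indicator {0..} y * (y powr (a + real k - 1) * exp (- d * y) / Gamma (a + real k)) =
        Gamma a / Gamma (a + real k) * ((indicator {0..} y * (y powr (a - 1) * exp (- d * y) / Gamma a)) * y ^ k)"
      using True G by simp
    have "0 \<le> indicator {0..} y * (y powr (a - 1) * exp (- d * y) / Gamma a)" "0 \<le> y ^ k"
        "0 \<le> Gamma a / Gamma (a + real k)"
      using True G by auto
    then show ?thesis unfolding eq by (simp only: ennreal_mult mult_nonneg_nonneg) (simp only: mult.assoc)
  qed (use that in auto)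
  have *: "AE y in lborel. ennreal (indicator {0..} y * (y powr (a + real k - 1) * exp (- d * y) / Gamma (a + real k))) * f y =
     ennreal (Gamma a / Gamma (a + real k)) * (ennreal (indicator {0..} y * (y powr (a - 1) * exp (- d * y) / Gamma a)) *
       (ennreal (y ^ k) * f y))"
    using AE_lborel_singleton[of 0] by (rule AE_mp) (intro AE_I2 impI nz)
  show ?thesis
    by (subst nn_integral_gamma_measure, simp, subst nn_integral_cong_AE[OF *])
       (simp add: nn_integral_cmult nn_integral_gamma_measure)
qed

text \<open>Shifting the shape parameter by \<open>k\<close> reweights by \<open>y ^ k\<close>, which favours large values.\<close>

lemma gamma_measure_add_nat_atMost_le:
  assumes a: "a > 0" and d: "d > 0"
  shows "emeasure (gamma_measure (a + real k) d) {..x} \<le>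
    ennreal (gamma_cdf a (d * x)) * emeasure (gamma_measure (a + real k) d) UNIV"
proof -
  let ?\<mu> = "gamma_measure a d"
  define I where "I A = (\<integral>\<^sup>+y. ennreal (y ^ k) * indicator A y \<partial>?\<mu>)" for A :: "real set"
  let ?A = "{..x}" and ?B = "{x<..}"
  have UN: "UNIV = ?A \<union> ?B" by auto
  have em: "emeasure (gamma_measure (a + real k) d) A = ennreal (Gamma a / Gamma (a + real k)) * I A"
    if [measurable]: "A \<in> sets borel" for A
    using gamma_measure_add_nat[OF a, of "indicator A" k d] by (simp add: I_def)
  have IU: "I UNIV = I ?A + I ?B"
    unfolding I_def by (subst nn_integral_add[symmetric])
      (auto simp: indicator_def intro!: nn_integral_cong)
  have mU: "emeasure ?\<mu> UNIV = emeasure ?\<mu> ?A + emeasure ?\<mu> ?B"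
    unfolding UN by (rule plus_emeasure[symmetric]) auto
  \<comment> \<open>The weight y ^ k is at most x ^ k on the lower part and at least x ^ k on the
    upper part. For x < 0 the lower part is a null set.\<close>
  have le: "I ?A * emeasure ?\<mu> ?B \<le> emeasure ?\<mu> ?A * I ?B"
  proof -
    define X where "X = ennreal (\<bar>x\<bar> ^ k)"
    have AEn: "AE y in ?\<mu>. 0 \<le> y" by (rule AE_gamma_measure_nonneg)
    have 1: "I ?A \<le> X * emeasure ?\<mu> ?A"
    proof -
      have "I ?A \<le> (\<integral>\<^sup>+y. X * indicator ?A y \<partial>?\<mu>)"
        unfolding I_def using AEn
        by (intro nn_integral_mono_AE) (auto simp: X_def indicator_def intro!: ennreal_leI power_mono)
      then show ?thesis by (simp add: nn_integral_cmult)
    qed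
    show ?thesis
    proof (cases "x \<ge> 0")
      case True
      have 2: "X * emeasure ?\<mu> ?B \<le> I ?B"
      proof -
        have "(\<integral>\<^sup>+y. X * indicator ?B y \<partial>?\<mu>) \<le> I ?B"
          unfolding I_def using AEn True
          by (intro nn_integral_mono_AE) (auto simp: X_def indicator_def intro!: ennreal_leI power_mono)
        then show ?thesis by (simp add: nn_integral_cmult)
      qed
      have "I ?A * emeasure ?\<mu> ?B \<le> (X * emeasure ?\<mu> ?A) * emeasure ?\<mu> ?B"
        by (intro mult_right_mono 1) auto
      also have "\<dots> = emeasure ?\<mu> ?A * (X * emeasure ?\<mu> ?B)" by (simp add: mult_ac)
      also have "\<dots> \<le> emeasure ?\<mu> ?A * I ?B" by (intro mult_left_mono 2) auto
      finally show ?thesis .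
    next
      case False
      have "AE y in ?\<mu>. y \<notin> ?A" using AEn by eventually_elim (use False in auto)
      then have "emeasure ?\<mu> ?A = 0" by (subst (asm) AE_iff_measurable[of ?A]) auto
      then show ?thesis using 1 by simp
    qed
  qed
  have "I ?A * emeasure ?\<mu> UNIV \<le> emeasure ?\<mu> ?A * I UNIV"
    unfolding mU IU distrib_left using le by (simp add: add_left_mono mult.commute)
  also have "emeasure ?\<mu> ?A * I UNIV = (ennreal (gamma_cdf a (d * x)) * I UNIV) * emeasure ?\<mu> UNIV"
    by (subst gamma_measure_atMost[OF a d]) (simp add: mult_ac)
  finally have "I ?A * ennreal (d powr - a) \<le> (ennreal (gamma_cdf a (d * x)) * I UNIV) * ennreal (d powr - a)"
    by (simp add: emeasure_gamma_measure_UNIV a d)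
  then have "I ?A \<le> ennreal (gamma_cdf a (d * x)) * I UNIV"
    using d by (subst (asm) (1 2) mult.commute, subst (asm) ennreal_mult_le_mult_iff) auto
  from mult_left_mono[OF this, of "ennreal (Gamma a / Gamma (a + real k))"] show ?thesis
    by (simp add: em mult.left_commute[of "ennreal (gamma_cdf a (d * x))"])
qed

lemma gamma_cdf_bounds: "a > 0 \<Longrightarrow> 0 \<le> gamma_cdf a x \<and> gamma_cdf a x \<le> 1"
  unfolding gamma_cdf_def using prob_space.prob_le_1[OF prob_space_gamma_measure] by auto

text \<open>The mass of (x, x + 1] suffices. There the factor y powr (a - 1) is at least its smaller
  value at the two ends, whichever end that is depending on the sign of a - 1, and exp (- (c - 1) *
  x) is eventually below both.\<close>

lemma gamma_tail_lower:
  assumes a: "a > 0" and c: "c > 1"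
  shows "\<exists>b>0. eventually (\<lambda>x. b * exp (- c * x) \<le> 1 - gamma_cdf a x) at_top"
proof -
  interpret prob_space "gamma_measure a 1" by (rule prob_space_gamma_measure) fact
  have G: "Gamma a > 0" using a by (rule Gamma_real_pos)
  have "eventually (\<lambda>x::real. exp (- (c - 1) * x) \<le> min (x powr (a - 1)) ((x + 1) powr (a - 1))) at_top"
  proof -
    define e where "e = c - 1"
    have "e > 0" using c by (simp add: e_def)
    then have "eventually (\<lambda>x::real. exp (- e * x) \<le> x powr (a - 1)) at_top"
      "eventually (\<lambda>x::real. exp (- e * x) \<le> (x + 1) powr (a - 1)) at_top" by real_asymp+
    then show ?thesis by eventually_elim (simp add: e_def)
  qed
  moreover have "eventually (\<lambda>x::real. x > 0) at_top" by (rule eventually_gt_at_top)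
  ultimately have "eventually (\<lambda>x. (exp (-1) / Gamma a) * exp (- c * x) \<le> 1 - gamma_cdf a x) at_top"
  proof eventually_elim
    case (elim x)
    let ?k = "(exp (-1) / Gamma a) * exp (- c * x)"
    have "1 - gamma_cdf a x = prob (UNIV - {..x})"
      using prob_compl[of "{..x}"] by (simp add: gamma_cdf_def)
    also have "\<dots> = prob {x<..}" by (rule arg_cong[of _ _ prob]) auto
    finally have eq: "ennreal (1 - gamma_cdf a x) = emeasure (gamma_measure a 1) {x<..}"
      by (simp add: emeasure_eq_measure)
    have "ennreal ?k = (\<integral>\<^sup>+y. ennreal ?k * indicator {x<..x+1} y \<partial>lborel)"
      by (simp add: nn_integral_cmult)
    also have "\<dots> \<le> (\<integral>\<^sup>+y. ennreal (indicator {0..} y * (y powr (a - 1) * exp (- 1 * y) / Gamma a)) * indicator {x<..} y \<partial>lborel)"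
    proof (rule nn_integral_mono)
      fix y
      have "?k \<le> y powr (a - 1) * exp (- y) / Gamma a" if y: "x < y" "y \<le> x + 1"
      proof -
        have "min (x powr (a - 1)) ((x + 1) powr (a - 1)) \<le> y powr (a - 1)"
        proof (cases "a \<ge> 1")
          case True
          then have "x powr (a - 1) \<le> y powr (a - 1)" using y elim by (intro powr_mono2) auto
          then show ?thesis by simp
        next
          case False
          then have "(x + 1) powr (a - 1) \<le> y powr (a - 1)" using y elim by (intro powr_mono2') auto
          then show ?thesis by simp
        qed
        then have "exp (- (c - 1) * x) \<le> y powr (a - 1)" using elim(1) by (rule order.trans[rotated])
        moreover have "exp (- 1 - x) \<le> exp (- y)" using y by simp
        ultimately have "exp (- (c - 1) * x) * exp (- 1 - x) \<le> y powr (a - 1) * exp (- y)"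
          by (intro mult_mono) auto
        moreover have "exp (- (c - 1) * x) * exp (- 1 - x) = exp (- 1) * exp (- c * x)"
          by (simp add: exp_add[symmetric] algebra_simps)
        ultimately show ?thesis using G by (simp add: divide_right_mono)
      qed
      then show "ennreal ?k * indicator {x<..x+1} y \<le> ennreal (indicator {0..} y * (y powr (a - 1) * exp (- 1 * y) / Gamma a)) * indicator {x<..} y"
        using elim by (auto simp: indicator_def intro!: ennreal_leI)
    qed
    also have "\<dots> = ennreal (1 - gamma_cdf a x)"
      unfolding eq using nn_integral_gamma_measure[of "indicator {x<..}" a 1] by simp
    finally show ?case using gamma_cdf_bounds[OF a, of x] by (simp add: ennreal_le_iff)
  qed
  then show ?thesis using G by (intro exI[of _ "exp (-1) / Gamma a"]) auto
qed

section \<open>Mixtures of products of gamma laws\<close>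

text \<open>For a strictly decreasing list x 0, ..., x n followed by x (Suc n) = 0, these are the
  diagonal entries of the inverse of the matrix min (x i) (x j), which is tridiagonal.\<close>

definition gap_rate :: "(nat \<Rightarrow> real) \<Rightarrow> nat \<Rightarrow> real" where
  "gap_rate x k = 1 / (x k - x (Suc k)) + (if k = 0 then 0 else 1 / (x (k - 1) - x k))"

text \<open>Put z i = 1 / (gap_rate x i + t i) and y i = z i * v (i - 1) / d (i - 1), with y 0 = 0.
  The recursion for the pivots becomes v i = z i / (d i * (1 - y i)), so by induction every v i and
  y i is a series with non-negative coefficients in the z's; y i < 1 because v (i - 1) \<le> 1 and 1
  / d (i - 1) is less than gap_rate x i + t i. The deficit is such a series too, and so is S =
  deficit / (1 + m n), which is below 1. The determinant is (1 + m n) * (1 - S) divided by the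
  product of the pivots, and the power - \<alpha> turns 1 - S and the 1 - y i into binomial series
  and leaves the factors z i powr \<alpha>.\<close>

lemma det_powr_pos_series:
  fixes x g :: "nat \<Rightarrow> real"
  assumes dec: "\<And>i. i \<le> n \<Longrightarrow> x (Suc i) < x i" and x0: "x (Suc n) = 0" and g0: "g (Suc n) = 0"
  defines "d \<equiv> \<lambda>k. x k - x (Suc k)"
  defines "m \<equiv> \<lambda>k. (g k - g (Suc k)) / d k"
  assumes m0: "0 \<le> m 0" and m_mono: "\<And>i. i < n \<Longrightarrow> m i \<le> m (Suc i)" and \<alpha>: "0 < \<alpha>"
  shows "\<exists>p k. \<forall>t. (\<forall>i. 0 < t i) \<longrightarrow>
    ennreal (Determinant.det (perturbed_min_mat (Suc n) x t (\<lambda>k. t k * g k)) powr (- \<alpha>)) =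
    (\<Sum>j. p j * (\<Prod>i<Suc n. ennreal ((gap_rate x i + t i) powr (- (\<alpha> + real (k j i :: nat))))))"
proof -
  define T where "T = {t :: nat \<Rightarrow> real. \<forall>i. 0 < t i}"
  define z where "z i t = 1 / (gap_rate x i + t i)" for i and t :: "nat \<Rightarrow> real"
  define Z where "Z i t = ennreal (z i t)" for i t
  define y where "y i t = (if i = 0 then 0 else z i t * pivot d t (i - 1) / d (i - 1))" for i t
  have dpos: "d i > 0" if "i \<le> n" for i using dec[OF that] by (simp add: d_def)
  have v: "0 < pivot d t i" "pivot d t i \<le> 1" if "i \<le> n" "t \<in> T" for i t
    using pivot_bounds[of i d t] dpos that by (auto simp: T_def less_imp_le)
  have rate: "gap_rate x i = 1 / d i + (if i = 0 then 0 else 1 / d (i - 1))" for i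
    by (cases i) (auto simp: gap_rate_def d_def)
  have rate_pos: "gap_rate x i > 0" if "i \<le> n" for i
    using dpos[OF that] dpos[of "i - 1"] that unfolding rate by (auto intro: add_pos_nonneg simp: less_imp_le)
  have zpos: "z i t > 0" if "i \<le> n" "t \<in> T" for i t
    using rate_pos[OF that(1)] that(2) by (auto simp: z_def T_def intro: add_pos_pos)
  have y: "0 \<le> y i t \<and> y i t < 1" if "i \<le> n" "t \<in> T" for i t
  proof (cases i)
    case (Suc l)
    have l: "l \<le> n" using that Suc by simp
    have "pivot d t l / d l \<le> 1 / d l" using v[OF l that(2)] dpos[OF l] by (simp add: divide_right_mono)
    also have "\<dots> < gap_rate x i + t i"
      using dpos[OF that(1)] that(2) unfolding rate by (simp add: Suc T_def add_pos_pos)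
    finally have less: "pivot d t l / d l < gap_rate x i + t i" .
    have "gap_rate x i + t i > 0" using rate_pos[OF that(1)] that(2) by (auto simp: T_def intro: add_pos_pos)
    with less have "z i t * (pivot d t l / d l) < 1"
      by (simp only: z_def times_divide_eq_left mult_1 divide_less_eq_1_pos)
    then show ?thesis using v[OF l that(2)] dpos[OF l] zpos[OF that] by (simp add: y_def Suc)
  qed (simp add: y_def)
  have vy: "pivot d t i = 1 / d i * z i t * (1 - y i t) powr (- 1)" if "i \<le> n" "t \<in> T" for i t
  proof -
    have r: "gap_rate x i + t i > 0" using rate_pos[OF that(1)] that(2) by (auto simp: T_def intro: add_pos_pos)
    have nz: "d i * (gap_rate x i + t i) \<noteq> 0" using r dpos[OF that(1)] by simp
    have "d i * (gap_rate x i + t i) * (1 - y i t) = 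
       (if i = 0 then 1 + d i * t i else 1 + d i * (t i + (1 - pivot d t (i - 1)) / d (i - 1)))"
    proof (cases i)
      case 0
      then show ?thesis using dpos[of 0] by (simp add: y_def rate distrib_left)
    next
      case (Suc l)
      have e1: "d i * (gap_rate x i + t i) = 1 + d i * (1 / d l + t i)"
        using dpos[OF that(1)] by (simp add: rate Suc distrib_left)
      have e2: "d i * (gap_rate x i + t i) * y i t = d i * (pivot d t l / d l)"
        using r by (simp add: y_def Suc z_def)
      have "d i * (gap_rate x i + t i) * (1 - y i t) = d i * (gap_rate x i + t i) - d i * (gap_rate x i + t i) * y i t"
        by (simp only: right_diff_distrib mult_1_right)
      also have "\<dots> = 1 + d i * (1 / d l + t i) - d i * (pivot d t l / d l)"
        by (simp only: e2) (simp only: e1)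
      finally show ?thesis by (simp add: Suc diff_divide_distrib right_diff_distrib distrib_left)
    qed
    then have "pivot d t i = 1 / (d i * (gap_rate x i + t i) * (1 - y i t))"
      by (cases i) auto
    then show ?thesis using y[OF that] by (simp add: z_def powr_minus_divide)
  qed
  have psZ: "pos_series (Suc n) Z T (\<lambda>t. ennreal (z i t))" if "i \<le> n" for i
    using pos_series_var[of i "Suc n" Z T] that by (simp add: Z_def)
  have ps_cm: "pos_series (Suc n) Z T (\<lambda>t. ennreal (c * f t))"
    if "0 \<le> c" "pos_series (Suc n) Z T (\<lambda>t. ennreal (f t))" for c f
    using that by (simp add: ennreal_mult' pos_series_mult pos_series_const)
  have psv_y: "pos_series (Suc n) Z T (\<lambda>t. ennreal (pivot d t i)) \<and> pos_series (Suc n) Z T (\<lambda>t. ennreal (y i t))"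
    if "i \<le> n" for i
    using that
  proof (induction i)
    case 0
    have "pos_series (Suc n) Z T (\<lambda>t. ennreal (1 / d 0 * z 0 t))"
      using dpos[of 0] by (intro ps_cm psZ) auto
    then show ?case
      using vy[of 0] by (auto simp: y_def pos_series_const intro: pos_series_cong)
  next
    case (Suc i)
    then have "pos_series (Suc n) Z T (\<lambda>t. ennreal (1 / d i) * (ennreal (z (Suc i) t) * ennreal (pivot d t i)))"
      by (intro pos_series_mult pos_series_const psZ) auto
    then have py: "pos_series (Suc n) Z T (\<lambda>t. ennreal (y (Suc i) t))"
    proof (rule pos_series_cong)
      fix t assume "t \<in> T"
      then show "ennreal (y (Suc i) t) = ennreal (1 / d i) * (ennreal (z (Suc i) t) * ennreal (pivot d t i))"
        using zpos[of "Suc i" t] v[of i t] dpos[of i] Suc.prems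
        by (simp add: y_def ennreal_mult'[symmetric] ennreal_mult''[symmetric])
    qed
    have "pos_series (Suc n) Z T (\<lambda>t. ennreal (1 / d (Suc i)) * (ennreal (z (Suc i) t) * ennreal ((1 - y (Suc i) t) powr (- 1))))"
      using y[of "Suc i"] Suc.prems
      by (intro pos_series_mult pos_series_const psZ pos_series_one_minus_powr py) auto
    then have "pos_series (Suc n) Z T (\<lambda>t. ennreal (pivot d t (Suc i)))"
    proof (rule pos_series_cong)
      fix t assume "t \<in> T"
      then show "ennreal (pivot d t (Suc i)) = ennreal (1 / d (Suc i)) * (ennreal (z (Suc i) t) * ennreal ((1 - y (Suc i) t) powr (- 1)))"
        unfolding vy[OF Suc.prems \<open>t \<in> T\<close>]
      proof -
        have "0 \<le> 1 / d (Suc i)" "0 \<le> z (Suc i) t"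
          using zpos[of "Suc i" t] dpos[of "Suc i"] Suc.prems \<open>t \<in> T\<close> by auto
        then show "ennreal (1 / d (Suc i) * z (Suc i) t * (1 - y (Suc i) t) powr - 1) = ennreal (1 / d (Suc i)) * (ennreal (z (Suc i) t) * ennreal ((1 - y (Suc i) t) powr - 1))"
          by (simp only: ennreal_mult mult_nonneg_nonneg powr_ge_zero) (simp only: mult.assoc)
      qed
    qed
    with py show ?case by simp
  qed
  have mpos: "0 \<le> m i" if "i \<le> n" for i
    using that
  proof (induction i)
    case (Suc i)
    then show ?case using m_mono[of i] by simp
  qed (simp add: m0)
  have psS: "pos_series (Suc n) Z T (\<lambda>t. ennreal (deficit (pivot d t) m i))" if "i \<le> n" for i
    using that
  proof (induction i)
    case 0
    then show ?case using psv_y[of 0] ps_cm[of "m 0" "\<lambda>t. pivot d t 0"] m0 by (simp add: mult.commute del: pivot.simps)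
  next
    case (Suc i)
    then have "pos_series (Suc n) Z T (\<lambda>t. ennreal (pivot d t (Suc i)) * (ennreal (deficit (pivot d t) m i) + ennreal (m (Suc i) - m i)))"
      using psv_y[of "Suc i"] by (intro pos_series_mult pos_series_add pos_series_const) auto
    then show ?case
    proof (rule pos_series_cong)
      fix t assume t: "t \<in> T"
      have "0 \<le> deficit (pivot d t) m i"
        using deficit_bounds[of i "pivot d t" m] v t m0 m_mono Suc.prems by (auto simp: less_imp_le)
      then show "ennreal (deficit (pivot d t) m (Suc i)) = ennreal (pivot d t (Suc i)) * (ennreal (deficit (pivot d t) m i) + ennreal (m (Suc i) - m i))"
        using m_mono[of i] Suc.prems v[OF Suc.prems t]
        by (simp add: ennreal_mult' ennreal_plus[symmetric] del: pivot.simps ennreal_plus)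
    qed
  qed
  define S where "S t = 1 / (1 + m n) * deficit (pivot d t) m n" for t
  have psS': "pos_series (Suc n) Z T (\<lambda>t. ennreal (S t))"
    unfolding S_def using mpos[of n] by (intro ps_cm psS) auto
  have S: "0 \<le> S t \<and> S t < 1" if "t \<in> T" for t
    using deficit_bounds[of n "pivot d t" m] v that m0 m_mono mpos[of n]
    by (auto simp: S_def less_imp_le)
  define C where "C = (1 + m n) powr (- \<alpha>) * (\<Prod>i<Suc n. (1 / d i) powr \<alpha>)"
  define F where "F t = ennreal C * (ennreal ((1 - S t) powr (- \<alpha>)) * (\<Prod>i<Suc n. ennreal ((1 - y i t) powr (- \<alpha>))))" for t
  have "pos_series (Suc n) Z T F"
    unfolding F_def using S y psv_y \<alpha>
    by (intro pos_series_mult pos_series_const pos_series_prod pos_series_one_minus_powr psS') auto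
  then obtain p k where F: "\<And>t. t \<in> T \<Longrightarrow> F t = (\<Sum>j. p j * (\<Prod>i<Suc n. Z i t ^ k j i))"
    unfolding pos_series_def by metis
  have "ennreal (Determinant.det (perturbed_min_mat (Suc n) x t (\<lambda>k. t k * g k)) powr (- \<alpha>)) =
    (\<Sum>j. p j * (\<Prod>i<Suc n. ennreal ((gap_rate x i + t i) powr (- (\<alpha> + real (k j i))))))" if t: "\<forall>i. 0 < t i" for t
  proof -
    have tT: "t \<in> T" using t by (simp add: T_def)
    let ?v = "pivot d t"
    let ?D = "Determinant.det (perturbed_min_mat (Suc n) x t (\<lambda>k. t k * g k))"
    have vpos: "(\<Prod>i<Suc n. ?v i) > 0" using v[OF _ tT] by (intro prod_pos) auto
    have "?D * (\<Prod>i<Suc n. ?v i) = 1 + m n - deficit ?v m n"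
      using det_excessive_kernel[of n x g t] dec x0 g0 t
      unfolding d_def m_def lessThan_Suc_atMost by (simp add: less_imp_le)
    also have "\<dots> = (1 + m n) * (1 - S t)" using mpos[of n] by (simp add: S_def right_diff_distrib)
    finally have D: "?D = (1 + m n) * (1 - S t) * (1 / (\<Prod>i<Suc n. ?v i))"
      using vpos by (simp only: times_divide_eq_right mult_1_right)
        (metis less_irrefl nonzero_mult_div_cancel_right)
    have "?D powr (- \<alpha>) = ((1 + m n) powr (- \<alpha>) * (1 - S t) powr (- \<alpha>)) * (1 / (\<Prod>i<Suc n. ?v i)) powr (- \<alpha>)"
      unfolding D using vpos S[OF tT] mpos[of n] by (subst powr_mult; simp add: powr_mult)
    also have "(1 / (\<Prod>i<Suc n. ?v i)) powr (- \<alpha>) = (\<Prod>i<Suc n. ?v i powr \<alpha>)"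
    proof -
      have "(1 / (\<Prod>i<Suc n. ?v i)) powr (- \<alpha>) = (\<Prod>i<Suc n. ?v i) powr \<alpha>"
        using vpos by (simp add: powr_divide powr_minus_divide)
      also have "\<dots> = (\<Prod>i<Suc n. ?v i powr \<alpha>)"
        by (rule prod_powr_distrib)
      finally show ?thesis .
    qed
    also have "(\<Prod>i<Suc n. ?v i powr \<alpha>) = (\<Prod>i<Suc n. (1 / d i) powr \<alpha> * z i t powr \<alpha> * (1 - y i t) powr (- \<alpha>))"
    proof (rule prod.cong[OF refl])
      fix i assume "i \<in> {..<Suc n}"
      then have i: "i \<le> n" by auto
      have "?v i powr \<alpha> = ((1 / d i) * z i t) powr \<alpha> * ((1 - y i t) powr (- 1)) powr \<alpha>"
        unfolding vy[OF i tT] by (rule powr_mult)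
      also have "((1 - y i t) powr (- 1)) powr \<alpha> = (1 - y i t) powr (- \<alpha>)"
        by (simp only: powr_powr mult_minus1)
      also have "((1 / d i) * z i t) powr \<alpha> = (1 / d i) powr \<alpha> * z i t powr \<alpha>"
        by (rule powr_mult)
      finally show "?v i powr \<alpha> = (1 / d i) powr \<alpha> * z i t powr \<alpha> * (1 - y i t) powr (- \<alpha>)" .
    qed
    finally have eq: "?D powr (- \<alpha>) = C * ((1 - S t) powr (- \<alpha>) * (\<Prod>i<Suc n. (1 - y i t) powr (- \<alpha>))) * (\<Prod>i<Suc n. z i t powr \<alpha>)"
      unfolding C_def prod.distrib by (simp only: mult_ac)
    have "C \<ge> 0" by (auto simp: C_def intro!: mult_nonneg_nonneg prod_nonneg)
    then have "ennreal (?D powr (- \<alpha>)) = F t * (\<Prod>i<Suc n. ennreal (z i t powr \<alpha>))"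
      unfolding eq F_def by (simp add: ennreal_mult' prod_ennreal prod_nonneg mult_nonneg_nonneg del: prod.lessThan_Suc)
    also have "\<dots> = (\<Sum>j. p j * (\<Prod>i<Suc n. Z i t ^ k j i) * (\<Prod>i<Suc n. ennreal (z i t powr \<alpha>)))"
      unfolding F[OF tT] by (rule ennreal_suminf_multc[symmetric])
    also have "\<dots> = (\<Sum>j. p j * (\<Prod>i<Suc n. ennreal ((gap_rate x i + t i) powr (- (\<alpha> + real (k j i))))))"
    proof (intro suminf_cong)
      fix j
      have "(\<Prod>i<Suc n. Z i t ^ k j i * ennreal (z i t powr \<alpha>)) = (\<Prod>i<Suc n. ennreal ((gap_rate x i + t i) powr (- (\<alpha> + real (k j i)))))"
      proof (rule prod.cong[OF refl])
        fix i assume "i \<in> {..<Suc n}"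
        then have i: "i \<le> n" by auto
        have r: "gap_rate x i + t i > 0" using rate_pos[OF i] t by (auto intro: add_pos_pos)
        have "z i t ^ k j i * z i t powr \<alpha> = z i t powr (\<alpha> + real (k j i))"
          using zpos[OF i tT] by (simp add: powr_realpow[symmetric] powr_add)
        also have "\<dots> = (gap_rate x i + t i) powr (- (\<alpha> + real (k j i)))"
          by (simp only: z_def powr_divide powr_one_eq_one powr_minus_divide)
        finally show "Z i t ^ k j i * ennreal (z i t powr \<alpha>) = ennreal ((gap_rate x i + t i) powr (- (\<alpha> + real (k j i))))"
          using zpos[OF i tT] by (simp add: Z_def ennreal_power ennreal_mult''[symmetric])
      qed
      then show "p j * (\<Prod>i<Suc n. Z i t ^ k j i) * (\<Prod>i<Suc n. ennreal (z i t powr \<alpha>)) = p j * (\<Prod>i<Suc n. ennreal ((gap_rate x i + t i) powr (- (\<alpha> + real (k j i)))))"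
        unfolding mult.assoc prod.distrib[symmetric] by simp
    qed
    finally show ?thesis .
  qed
  then show ?thesis by blast
qed

text \<open>Replacing the exponentials by indicators one coordinate at a time.\<close>

lemma mixture_of_products:
  fixes X :: "nat \<Rightarrow> 'a \<Rightarrow> real" and \<gamma> :: "nat \<Rightarrow> nat \<Rightarrow> real \<Rightarrow> ennreal" and p :: "nat \<Rightarrow> ennreal"
  assumes "finite_measure M"
    and X[measurable]: "\<And>i. i < n \<Longrightarrow> X i \<in> borel_measurable M"
    and X0: "\<And>i \<omega>. i < n \<Longrightarrow> \<omega> \<in> space M \<Longrightarrow> 0 \<le> X i \<omega>"
    and \<gamma>[measurable]: "\<And>j i. \<gamma> j i \<in> borel_measurable borel"
    and \<gamma>0: "\<And>j i y. y < 0 \<Longrightarrow> \<gamma> j i y = 0"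
    and lap: "\<And>t. (\<And>i. 0 < t i) \<Longrightarrow> (\<integral>\<^sup>+\<omega>. (\<Prod>i<n. ennreal (exp (- t i * X i \<omega>))) \<partial>M) =
       (\<Sum>j. p j * (\<Prod>i<n. \<integral>\<^sup>+y. \<gamma> j i y * ennreal (exp (- t i * y)) \<partial>lborel))"
    and A[measurable]: "\<And>i. A i \<in> sets borel"
  shows "(\<integral>\<^sup>+\<omega>. (\<Prod>i<n. indicator (A i) (X i \<omega>)) \<partial>M) =
       (\<Sum>j. p j * (\<Prod>i<n. \<integral>\<^sup>+y. \<gamma> j i y * indicator (A i) y \<partial>lborel))"
proof -
  interpret finite_measure M by fact
  define \<phi> where "\<phi> m t i y = (if i < m then indicator (A i) y else ennreal (exp (- t i * y)))"
    for m i :: nat and t :: "nat \<Rightarrow> real" and y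
  have \<phi>m[measurable]: "\<phi> m t i \<in> borel_measurable borel" for m t i
    unfolding \<phi>_def by (cases "i < m") auto
  define J where "J j m t i = (\<integral>\<^sup>+y. \<gamma> j i y * \<phi> m t i y \<partial>lborel)" for j m i :: nat and t :: "nat \<Rightarrow> real"
  have "(\<integral>\<^sup>+\<omega>. (\<Prod>i<n. \<phi> m t i (X i \<omega>)) \<partial>M) = (\<Sum>j. p j * (\<Prod>i<n. J j m t i))"
    if "m \<le> n" "\<And>i. 0 < t i" for m t
    using that
  proof (induction m arbitrary: t)
    case 0
    then show ?case using lap[of t] by (simp add: \<phi>_def J_def)
  next
    case (Suc m)
    then have m: "m < n" by simp
    have insn: "{..<n} = insert m ({..<n} - {m})" using m by auto
    have same: "\<phi> (Suc m) t i = \<phi> m (t(m := u)) i" if "i \<noteq> m" for i u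
      using that by (auto simp: \<phi>_def fun_eq_iff)
    \<comment> \<open>All coordinates except m are frozen in W and c. The induction hypothesis, used
      with an arbitrary value u at coordinate m, then says that two measures on the line have the
      same Laplace transform in u. This is why t is generalised in the induction.\<close>
    define W where "W \<omega> = (\<Prod>i\<in>{..<n} - {m}. \<phi> (Suc m) t i (X i \<omega>))" for \<omega>
    define c where "c j = p j * (\<Prod>i\<in>{..<n} - {m}. J j (Suc m) t i)" for j
    have [measurable]: "W \<in> borel_measurable M"
      unfolding W_def by (intro borel_measurable_prod_ennreal measurable_compose[OF X \<phi>m]) auto
    note [measurable] = X[OF m]
    define \<mu> where "\<mu> = distr (density M W) borel (X m)"
    define \<nu> where "\<nu> = density lborel (\<lambda>y. \<Sum>j. c j * \<gamma> j m y)"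
    have \<mu>: "(\<integral>\<^sup>+y. f y \<partial>\<mu>) = (\<integral>\<^sup>+\<omega>. W \<omega> * f (X m \<omega>) \<partial>M)" if [measurable]: "f \<in> borel_measurable borel" for f
      unfolding \<mu>_def by (simp add: nn_integral_distr nn_integral_density)
    have \<nu>: "(\<integral>\<^sup>+y. f y \<partial>\<nu>) = (\<Sum>j. c j * (\<integral>\<^sup>+y. \<gamma> j m y * f y \<partial>lborel))" if [measurable]: "f \<in> borel_measurable borel" for f
    proof -
      have "(\<integral>\<^sup>+y. f y \<partial>\<nu>) = (\<integral>\<^sup>+y. (\<Sum>j. c j * (\<gamma> j m y * f y)) \<partial>lborel)"
        unfolding \<nu>_def by (simp add: nn_integral_density ennreal_suminf_multc[symmetric] mult.assoc)
      also have "\<dots> = (\<Sum>j. \<integral>\<^sup>+y. c j * (\<gamma> j m y * f y) \<partial>lborel)"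
        by (rule nn_integral_suminf) measurable
      finally show ?thesis by (simp add: nn_integral_cmult)
    qed
    have "\<mu> = \<nu>"
    proof (rule laplace_unique)
      show "sets \<mu> = sets borel" "sets \<nu> = sets borel" by (auto simp: \<mu>_def \<nu>_def)
      show "AE y in \<mu>. 0 \<le> y"
        unfolding \<mu>_def by (subst AE_distr_iff) (auto simp: AE_density X0[OF m])
      show "AE y in \<nu>. 0 \<le> y"
      proof -
        have "0 \<le> y" if "0 < (\<Sum>j. c j * \<gamma> j m y)" for y
          using \<gamma>0[of y] that by (cases "0 \<le> y") auto
        then show ?thesis unfolding \<nu>_def by (subst AE_density) (auto intro!: AE_I2)
      qed
      show "(\<integral>\<^sup>+y. ennreal (exp (- u * y)) \<partial>\<mu>) = (\<integral>\<^sup>+y. ennreal (exp (- u * y)) \<partial>\<nu>)" if "u > 0" for u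
      proof -
        have "(\<integral>\<^sup>+\<omega>. (\<Prod>i<n. \<phi> m (t(m := u)) i (X i \<omega>)) \<partial>M) = (\<Sum>j. p j * (\<Prod>i<n. J j m (t(m := u)) i))"
          using m Suc.prems(2) that by (intro Suc.IH) auto
        moreover have "(\<Prod>i<n. \<phi> m (t(m := u)) i (X i \<omega>)) = W \<omega> * ennreal (exp (- u * X m \<omega>))" for \<omega>
        proof -
          have "W \<omega> = (\<Prod>i\<in>{..<n} - {m}. \<phi> m (t(m := u)) i (X i \<omega>))"
            unfolding W_def by (intro prod.cong) (simp_all add: same[where u = u])
          moreover have "\<phi> m (t(m := u)) m (X m \<omega>) = ennreal (exp (- u * X m \<omega>))"
            by (simp add: \<phi>_def)
          ultimately show ?thesis
            by (subst insn, subst prod.insert) (simp_all add: mult.commute)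
        qed
        moreover have "p j * (\<Prod>i<n. J j m (t(m := u)) i) = c j * (\<integral>\<^sup>+y. \<gamma> j m y * ennreal (exp (- u * y)) \<partial>lborel)" for j
        proof -
          have "(\<Prod>i<n. J j m (t(m := u)) i) = J j m (t(m := u)) m * (\<Prod>i\<in>{..<n} - {m}. J j m (t(m := u)) i)"
            by (subst insn, subst prod.insert) auto
          also have "(\<Prod>i\<in>{..<n} - {m}. J j m (t(m := u)) i) = (\<Prod>i\<in>{..<n} - {m}. J j (Suc m) t i)"
            by (intro prod.cong) (auto simp: J_def same[where u = u])
          also have "J j m (t(m := u)) m = (\<integral>\<^sup>+y. \<gamma> j m y * ennreal (exp (- u * y)) \<partial>lborel)"
            by (simp add: J_def \<phi>_def)
          finally show ?thesis by (simp only: c_def mult_ac)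
        qed
        ultimately show ?thesis by (simp add: \<mu> \<nu>)
      qed
      have "W \<omega> * ennreal (exp (- X m \<omega>)) \<le> 1" if "\<omega> \<in> space M" for \<omega>
      proof -
        have "\<phi> (Suc m) t i (X i \<omega>) \<le> 1" if "i < n" for i
        proof -
          have "0 \<le> t i * X i \<omega>" using X0[OF that \<open>\<omega> \<in> space M\<close>] Suc.prems(2)[of i] by simp
          then show ?thesis by (auto simp: \<phi>_def indicator_def)
        qed
        then have "W \<omega> \<le> 1" unfolding W_def by (intro prod_le_1) auto
        moreover have "ennreal (exp (- X m \<omega>)) \<le> 1" using X0[OF m that] by simp
        ultimately show ?thesis using mult_mono[of "W \<omega>" 1 "ennreal (exp (- X m \<omega>))" 1] by simp
      qed
      then have "(\<integral>\<^sup>+\<omega>. W \<omega> * ennreal (exp (- X m \<omega>)) \<partial>M) \<le> (\<integral>\<^sup>+\<omega>. 1 \<partial>M)"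
        by (intro nn_integral_mono)
      also have "\<dots> < \<infinity>" using emeasure_finite[of "space M"] by (simp add: less_top[symmetric])
      finally show "(\<integral>\<^sup>+y. ennreal (exp (- y)) \<partial>\<mu>) < \<infinity>" by (simp add: \<mu>)
    qed
    then have "(\<integral>\<^sup>+y. indicator (A m) y \<partial>\<mu>) = (\<integral>\<^sup>+y. indicator (A m) y \<partial>\<nu>)" by simp
    then have "(\<integral>\<^sup>+\<omega>. W \<omega> * indicator (A m) (X m \<omega>) \<partial>M) = (\<Sum>j. c j * (\<integral>\<^sup>+y. \<gamma> j m y * indicator (A m) y \<partial>lborel))"
      by (simp add: \<mu> \<nu> del: nn_integral_indicator)
    moreover have "(\<Prod>i<n. \<phi> (Suc m) t i (X i \<omega>)) = W \<omega> * indicator (A m) (X m \<omega>)" for \<omega>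
      by (subst insn, subst prod.insert) (auto simp: W_def \<phi>_def mult.commute)
    moreover have "p j * (\<Prod>i<n. J j (Suc m) t i) = c j * (\<integral>\<^sup>+y. \<gamma> j m y * indicator (A m) y \<partial>lborel)" for j
    proof -
      have "(\<Prod>i<n. J j (Suc m) t i) = J j (Suc m) t m * (\<Prod>i\<in>{..<n} - {m}. J j (Suc m) t i)"
        by (subst insn, subst prod.insert) auto
      then show ?thesis by (simp add: c_def J_def \<phi>_def mult_ac)
    qed
    ultimately show ?case by simp
  qed
  from this[of n "\<lambda>_. 1"] show ?thesis by (simp add: \<phi>_def J_def)
qed

section \<open>Finite dimensional laws\<close>

text \<open>Laplace transforms are given only for t > 0. Uniqueness identifies the law of X under
  the weight W as C times a gamma measure of rate d, and the formula then extends to every positive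
  exponent l < d.\<close>

lemma weighted_exp_moment:
  fixes X :: "'a \<Rightarrow> real" and W :: "'a \<Rightarrow> ennreal"
  assumes [measurable]: "X \<in> borel_measurable M" "W \<in> borel_measurable M"
    and X0: "\<And>\<omega>. \<omega> \<in> space M \<Longrightarrow> 0 \<le> X \<omega>"
    and lap: "\<And>t. 0 < t \<Longrightarrow> (\<integral>\<^sup>+\<omega>. W \<omega> * ennreal (exp (- t * X \<omega>)) \<partial>M) = ennreal (C * (d + t) powr (- a))"
    and pos: "0 \<le> C" "0 < d" "0 < a" and l: "l < d"
  shows "(\<integral>\<^sup>+\<omega>. W \<omega> * ennreal (exp (l * X \<omega>)) \<partial>M) = ennreal (C * (d - l) powr (- a))"
proof -
  define \<mu> where "\<mu> = distr (density M W) borel X"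
  define \<nu> where "\<nu> = density (gamma_measure a d) (\<lambda>_. ennreal C)"
  have \<mu>: "(\<integral>\<^sup>+y. f y \<partial>\<mu>) = (\<integral>\<^sup>+\<omega>. W \<omega> * f (X \<omega>) \<partial>M)" if [measurable]: "f \<in> borel_measurable borel" for f
    unfolding \<mu>_def by (simp add: nn_integral_distr nn_integral_density)
  have \<nu>: "(\<integral>\<^sup>+y. ennreal (exp (- t * y)) \<partial>\<nu>) = ennreal (C * (d + t) powr (- a))" if "d + t > 0" for t
    unfolding \<nu>_def using pos gamma_measure_laplace[OF pos(3) that]
    by (simp add: nn_integral_density nn_integral_cmult ennreal_mult')
  have "\<mu> = \<nu>"
  proof (rule laplace_unique)
    show "sets \<mu> = sets borel" "sets \<nu> = sets borel" by (auto simp: \<mu>_def \<nu>_def)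
    show "AE y in \<mu>. 0 \<le> y"
      unfolding \<mu>_def by (subst AE_distr_iff) (auto simp: AE_density X0)
    show "AE y in \<nu>. 0 \<le> y"
      unfolding \<nu>_def using AE_gamma_measure_nonneg[of a d] by (subst AE_density) auto
    show "(\<integral>\<^sup>+y. ennreal (exp (- t * y)) \<partial>\<mu>) = (\<integral>\<^sup>+y. ennreal (exp (- t * y)) \<partial>\<nu>)" if "t > 0" for t
      using lap[OF that] \<nu>[of t] that pos by (simp add: \<mu>)
    show "(\<integral>\<^sup>+y. ennreal (exp (- y)) \<partial>\<mu>) < \<infinity>"
      using lap[of 1] by (simp add: \<mu>)
  qed
  then show ?thesis using \<mu>[of "\<lambda>y. ennreal (exp (l * y))"] \<nu>[of "- l"] l by simp
qed

text \<open>The part of f = Vh that the finite dimensional laws need: f is a non-negative,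
  non-decreasing, concave function of s. \<open>f_concave_0\<close> is concavity with the origin as
  an additional point, where f has the value 0.\<close>

locale excessive_permanental = prob_space M for M :: "'a measure" +
  fixes s f :: "nat \<Rightarrow> real" and \<alpha> :: real and Y :: "nat \<Rightarrow> 'a \<Rightarrow> real"
  assumes s_mono: "\<And>i j. 1 \<le> i \<Longrightarrow> i < j \<Longrightarrow> s i < s j"
    and s_pos: "\<And>i. 1 \<le> i \<Longrightarrow> 0 < s i"
    and f_mono: "\<And>i j. 1 \<le> i \<Longrightarrow> i \<le> j \<Longrightarrow> f i \<le> f j"
    and f_nonneg: "\<And>i. 1 \<le> i \<Longrightarrow> 0 \<le> f i"
    and f_concave: "\<And>i j k. 1 \<le> i \<Longrightarrow> i < j \<Longrightarrow> j < k \<Longrightarrow>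
      (f k - f j) / (s k - s j) \<le> (f j - f i) / (s j - s i)"
    and f_concave_0: "\<And>i j. 1 \<le> i \<Longrightarrow> i < j \<Longrightarrow> (f j - f i) / (s j - s i) \<le> f i / s i"
    and alpha_pos: "0 < \<alpha>"
    and permanental: "permanental_sequence M \<alpha> (\<lambda>j k. min_kernel s j k + f k) Y"
begin

lemma Y_measurable [measurable]: "1 \<le> j \<Longrightarrow> Y j \<in> borel_measurable M"
  and Y_nonneg: "1 \<le> j \<Longrightarrow> \<omega> \<in> space M \<Longrightarrow> 0 \<le> Y j \<omega>"
  using permanental unfolding permanental_sequence_def by auto

text \<open>The functions x and g are prescribed only below n, so that they can be given the value 0
  at index n, as the determinant formulas require.\<close>

lemma joint_laplace:
  assumes i: "inj_on i {..<n}" "\<And>m. m < n \<Longrightarrow> 1 \<le> i m" and t: "\<And>m. m < n \<Longrightarrow> 0 < t m"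
    and x: "\<And>m. m < n \<Longrightarrow> x m = s (i m)" and g: "\<And>m. m < n \<Longrightarrow> g m = f (i m)"
  shows "(\<integral>\<^sup>+\<omega>. (\<Prod>m<n. ennreal (exp (- t m * Y (i m) \<omega>))) \<partial>M) =
    ennreal (Determinant.det (perturbed_min_mat n x t (\<lambda>k. t k * g k)) powr (- \<alpha>))"
proof -
  have mat: "1\<^sub>m n + Matrix.mat n n (\<lambda>(p, q). min_kernel s (i p) (i q) + f (i q)) * mat_diag n t =
      perturbed_min_mat n x t (\<lambda>k. t k * g k)"
    by (subst mat_diag_mult_right[of _ n])
       (auto simp: perturbed_min_mat_def min_kernel_def x g algebra_simps intro!: eq_matI)
  have "(\<integral>\<omega>. exp (- (\<Sum>m<n. t m * Y (i m) \<omega>)) \<partial>M) =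
      Determinant.det (perturbed_min_mat n x t (\<lambda>k. t k * g k)) powr (- \<alpha>)"
    using permanental i t unfolding permanental_sequence_def mat[symmetric] by blast
  moreover have "(\<integral>\<^sup>+\<omega>. ennreal (exp (- (\<Sum>m<n. t m * Y (i m) \<omega>))) \<partial>M) =
     ennreal (\<integral>\<omega>. exp (- (\<Sum>m<n. t m * Y (i m) \<omega>)) \<partial>M)"
  proof (rule nn_integral_eq_integral)
    have [measurable]: "(\<lambda>\<omega>. \<Sum>m<n. t m * Y (i m) \<omega>) \<in> borel_measurable M"
      using i by (intro borel_measurable_sum borel_measurable_times Y_measurable) auto
    have "0 \<le> (\<Sum>m<n. t m * Y (i m) \<omega>)" if "\<omega> \<in> space M" for \<omega>
      using that i t Y_nonneg by (intro sum_nonneg mult_nonneg_nonneg) (auto simp: less_imp_le)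
    then show "integrable M (\<lambda>\<omega>. exp (- (\<Sum>m<n. t m * Y (i m) \<omega>)))"
      by (intro integrable_const_bound[where B = 1] AE_I2) auto
  qed auto
  moreover have "(\<Prod>m<n. ennreal (exp (- t m * Y (i m) \<omega>))) = ennreal (exp (- (\<Sum>m<n. t m * Y (i m) \<omega>)))" for \<omega>
    by (subst prod_ennreal) (auto simp: exp_sum[symmetric] sum_negf)
  ultimately show ?thesis by simp
qed

lemma prob_all_le:
  assumes i: "\<And>k. k < n \<Longrightarrow> i (Suc k) < i k" "1 \<le> i n"
  defines "x \<equiv> \<lambda>k. if k \<le> n then s (i k) else 0"
  shows "prob {\<omega> \<in> space M. \<forall>k\<le>n. Y (i k) \<omega> \<le> a k} \<le> (\<Prod>k\<le>n. gamma_cdf \<alpha> (gap_rate x k * a k))"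
proof -
  define g where "g k = (if k \<le> n then f (i k) else 0)" for k
  have i_dec: "i l < i k" if "k < l" "l \<le> n" for k l
    using that
  proof (induction l rule: less_induct)
    case (less l)
    then obtain l' where l': "l = Suc l'" by (cases l) auto
    have "i (Suc l') < i l'" using i(1)[of l'] less.prems l' by simp
    moreover have "i l' \<le> i k" using less.IH[of l'] less.prems l' by (cases "k = l'") auto
    ultimately show ?case using l' by simp
  qed
  have i1: "1 \<le> i k" if "k \<le> n" for k
    using i_dec[of k n] i(2) that by (cases "k = n") auto
  have inj: "inj_on i {..<Suc n}"
  proof (rule inj_onI)
    fix k l assume "k \<in> {..<Suc n}" "l \<in> {..<Suc n}" "i k = i l"
    then show "k = l" using i_dec[of k l] i_dec[of l k] by (cases k l rule: linorder_cases) auto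
  qed
  have dec: "x (Suc k) < x k" if "k \<le> n" for k
    using that s_mono[of "i (Suc k)" "i k"] i(1)[of k] i1[of "Suc k"] s_pos[OF i1[of k]]
    by (cases "k = n") (auto simp: x_def)
  have x0: "x (Suc n) = 0" "g (Suc n) = 0" by (auto simp: x_def g_def)
  define m where "m k = (g k - g (Suc k)) / (x k - x (Suc k))" for k
  have m0: "0 \<le> m 0"
    using dec[of 0] f_nonneg[OF i1[of 0]] f_mono[of "i 1" "i 0"] i(1)[of 0] i1[of 1]
    by (cases "n = 0") (auto simp: m_def g_def)
  have m_mono: "m k \<le> m (Suc k)" if "k < n" for k
  proof (cases "Suc k = n")
    case True
    then show ?thesis
      using f_concave_0[of "i (Suc k)" "i k"] i(1)[of k] i1[of "Suc k"] by (auto simp: m_def g_def x_def)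
  next
    case False
    then show ?thesis
      using f_concave[of "i (Suc (Suc k))" "i (Suc k)" "i k"] i(1)[of k] i(1)[of "Suc k"] i1[of "Suc (Suc k)"] that
      by (auto simp: m_def g_def x_def)
  qed
  have rate_pos: "gap_rate x k > 0" if "k \<le> n" for k
    using dec[OF that] dec[of "k - 1"] that by (cases k) (auto simp: gap_rate_def intro!: add_pos_pos)
  obtain p K where pK: "\<And>t. (\<forall>i. 0 < t i) \<Longrightarrow>
    ennreal (Determinant.det (perturbed_min_mat (Suc n) x t (\<lambda>k. t k * g k)) powr (- \<alpha>)) =
    (\<Sum>j. p j * (\<Prod>i<Suc n. ennreal ((gap_rate x i + t i) powr (- (\<alpha> + real (K j i :: nat))))))"
    using det_powr_pos_series[of n x g \<alpha>] dec x0 m0 m_mono alpha_pos unfolding m_def by blast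
  define \<gamma> where "\<gamma> j k y = ennreal (indicator {0..} y * (y powr (\<alpha> + real (K j k) - 1) * exp (- gap_rate x k * y) / Gamma (\<alpha> + real (K j k))))"
    for j k y
  have \<gamma>: "(\<integral>\<^sup>+y. \<gamma> j k y * h y \<partial>lborel) = (\<integral>\<^sup>+y. h y \<partial>gamma_measure (\<alpha> + real (K j k)) (gap_rate x k))"
    if "h \<in> borel_measurable borel" for j k h
    unfolding \<gamma>_def by (rule nn_integral_gamma_measure[symmetric, OF that])
  have main: "(\<integral>\<^sup>+\<omega>. (\<Prod>k<Suc n. indicator (A k) (Y (i k) \<omega>)) \<partial>M) =
     (\<Sum>j. p j * (\<Prod>k<Suc n. \<integral>\<^sup>+y. \<gamma> j k y * indicator (A k) y \<partial>lborel))"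
    if A: "\<And>k. A k \<in> sets borel" for A
  proof (rule mixture_of_products)
    show "finite_measure M" by (rule finite_measure_axioms)
    show "Y (i k) \<in> borel_measurable M" if "k < Suc n" for k using i1[of k] that by auto
    show "0 \<le> Y (i k) \<omega>" if "k < Suc n" "\<omega> \<in> space M" for k \<omega> using Y_nonneg i1[of k] that by auto
    show "\<gamma> j k \<in> borel_measurable borel" for j k unfolding \<gamma>_def by measurable
    show "\<gamma> j k y = 0" if "y < 0" for j k y using that by (simp add: \<gamma>_def)
    show "A k \<in> sets borel" for k by (rule A)
    fix t :: "nat \<Rightarrow> real" assume t: "\<And>i. 0 < t i"
    have "(\<integral>\<^sup>+\<omega>. (\<Prod>k<Suc n. ennreal (exp (- t k * Y (i k) \<omega>))) \<partial>M) =
        ennreal (Determinant.det (perturbed_min_mat (Suc n) x t (\<lambda>k. t k * g k)) powr (- \<alpha>))"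
      using inj i1 t by (intro joint_laplace) (auto simp: x_def g_def)
    also have "\<dots> = (\<Sum>j. p j * (\<Prod>i<Suc n. ennreal ((gap_rate x i + t i) powr (- (\<alpha> + real (K j i :: nat))))))"
      using t by (intro pK) auto
    also have "\<dots> = (\<Sum>j. p j * (\<Prod>k<Suc n. \<integral>\<^sup>+y. \<gamma> j k y * ennreal (exp (- t k * y)) \<partial>lborel))"
    proof (intro suminf_cong arg_cong2[where f = times] refl prod.cong)
      fix j k assume "k \<in> {..<Suc n}"
      then have "gap_rate x k + t k > 0" using rate_pos[of k] t[of k] by (auto intro: add_pos_pos)
      then show "ennreal ((gap_rate x k + t k) powr (- (\<alpha> + real (K j k)))) = (\<integral>\<^sup>+y. \<gamma> j k y * ennreal (exp (- t k * y)) \<partial>lborel)"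
        using alpha_pos by (subst \<gamma>, simp, subst gamma_measure_laplace) auto
    qed
    finally show "(\<integral>\<^sup>+\<omega>. (\<Prod>k<Suc n. ennreal (exp (- t k * Y (i k) \<omega>))) \<partial>M) =
       (\<Sum>j. p j * (\<Prod>k<Suc n. \<integral>\<^sup>+y. \<gamma> j k y * ennreal (exp (- t k * y)) \<partial>lborel))" .
  qed
  \<comment> \<open>Weights of the components. Their sum is the mixture formula for the sure event,
    that is, with every set equal to \<open>UNIV\<close>.\<close>
  define w where "w j = p j * (\<Prod>k<Suc n. emeasure (gamma_measure (\<alpha> + real (K j k)) (gap_rate x k)) UNIV)" for j
  have w: "(\<Sum>j. w j) = 1"
  proof -
    have "(\<integral>\<^sup>+y. \<gamma> j k y * indicator UNIV y \<partial>lborel) = emeasure (gamma_measure (\<alpha> + real (K j k)) (gap_rate x k)) UNIV" for j k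
      using \<gamma>[of "indicator UNIV" j k] by simp
    then have "w j = p j * (\<Prod>k<Suc n. \<integral>\<^sup>+y. \<gamma> j k y * indicator UNIV y \<partial>lborel)" for j
      unfolding w_def by (simp only:)
    then have "(\<Sum>j. w j) = (\<Sum>j. p j * (\<Prod>k<Suc n. \<integral>\<^sup>+y. \<gamma> j k y * indicator UNIV y \<partial>lborel))"
      by (simp only:)
    also have "\<dots> = (\<integral>\<^sup>+\<omega>. (\<Prod>k<Suc n. indicator UNIV (Y (i k) \<omega>)) \<partial>M)"
      by (rule main[symmetric]) simp
    finally show ?thesis by (simp add: emeasure_space_1 del: prod.lessThan_Suc)
  qed
  define c where "c k = gamma_cdf \<alpha> (gap_rate x k * a k)" for k
  have c0: "0 \<le> c k" for k using gamma_cdf_bounds[OF alpha_pos] by (simp add: c_def)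
  have ev: "{\<omega> \<in> space M. \<forall>k\<le>n. Y (i k) \<omega> \<le> a k} \<in> events"
  proof -
    have "{\<omega> \<in> space M. \<forall>k\<in>{..n}. Y (i k) \<omega> \<le> a k} \<in> events"
    proof (rule sets.sets_Collect_countable_All')
      fix k assume "k \<in> {..n}"
      then have [measurable]: "Y (i k) \<in> borel_measurable M" using i1[of k] by auto
      show "{\<omega> \<in> space M. Y (i k) \<omega> \<le> a k} \<in> events" by measurable
    qed (rule countable_finite, simp)
    then show ?thesis by (simp only: Ball_def atMost_iff)
  qed
  have "emeasure M {\<omega> \<in> space M. \<forall>k\<le>n. Y (i k) \<omega> \<le> a k} =
      (\<integral>\<^sup>+\<omega>. indicator {\<omega> \<in> space M. \<forall>k\<le>n. Y (i k) \<omega> \<le> a k} \<omega> \<partial>M)"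
    by (rule nn_integral_indicator[symmetric, OF ev])
  also have "\<dots> = (\<integral>\<^sup>+\<omega>. (\<Prod>k<Suc n. indicator {..a k} (Y (i k) \<omega>)) \<partial>M)"
  proof (rule nn_integral_cong)
    fix \<omega> assume \<omega>: "\<omega> \<in> space M"
    show "indicator {\<omega> \<in> space M. \<forall>k\<le>n. Y (i k) \<omega> \<le> a k} \<omega> = (\<Prod>k<Suc n. indicator {..a k} (Y (i k) \<omega>) :: ennreal)"
    proof (cases "\<forall>k\<le>n. Y (i k) \<omega> \<le> a k")
      case True
      then show ?thesis using \<omega> by (auto simp: less_Suc_eq_le intro!: prod.neutral[symmetric])
    next
      case False
      then obtain k where "k < Suc n" "\<not> Y (i k) \<omega> \<le> a k" by (auto simp: less_Suc_eq_le)
      then have "(\<Prod>k<Suc n. indicator {..a k} (Y (i k) \<omega>) :: ennreal) = 0"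
        by (intro prod_zero) (auto intro!: bexI[of _ k])
      then show ?thesis using False by (simp add: indicator_def)
    qed
  qed
  also have "\<dots> = (\<Sum>j. p j * (\<Prod>k<Suc n. emeasure (gamma_measure (\<alpha> + real (K j k)) (gap_rate x k)) {..a k}))"
    by (subst main, simp, subst \<gamma>) (auto simp del: prod.lessThan_Suc)
  also have "\<dots> \<le> (\<Sum>j. ennreal (\<Prod>k<Suc n. c k) * w j)"
  proof (intro suminf_le)
    fix j
    have "(\<Prod>k<Suc n. emeasure (gamma_measure (\<alpha> + real (K j k)) (gap_rate x k)) {..a k}) \<le>
       (\<Prod>k<Suc n. ennreal (c k) * emeasure (gamma_measure (\<alpha> + real (K j k)) (gap_rate x k)) UNIV)"
      unfolding c_def using rate_pos alpha_pos
      by (intro prod_mono_ennreal gamma_measure_add_nat_atMost_le) auto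
    also have "\<dots> = ennreal (\<Prod>k<Suc n. c k) * (\<Prod>k<Suc n. emeasure (gamma_measure (\<alpha> + real (K j k)) (gap_rate x k)) UNIV)"
      using c0 by (simp only: prod.distrib prod_ennreal)
    finally show "p j * (\<Prod>k<Suc n. emeasure (gamma_measure (\<alpha> + real (K j k)) (gap_rate x k)) {..a k}) \<le> ennreal (\<Prod>k<Suc n. c k) * w j"
      unfolding w_def by (subst mult.left_commute) (rule mult_left_mono, auto)
  qed auto
  also have "\<dots> = ennreal (\<Prod>k<Suc n. c k)" by (simp only: ennreal_suminf_cmult w mult_1_right)
  finally show ?thesis
    using c0 by (simp add: emeasure_eq_measure ennreal_le_iff prod_nonneg c_def lessThan_Suc_atMost del: prod.lessThan_Suc)
qed

section \<open>Exponential moments of one variable and of increments\<close>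

lemma laplace1:
  assumes "1 \<le> j" "0 < t"
  shows "(\<integral>\<^sup>+\<omega>. ennreal (exp (- t * Y j \<omega>)) \<partial>M) = ennreal ((1 + t * (s j + f j)) powr (- \<alpha>))"
  using joint_laplace[of "\<lambda>_. j" 1 "\<lambda>_. t" "\<lambda>_. s j" "\<lambda>_. f j"] assms
  by (simp add: perturbed_min_mat_def det_single inj_on_def algebra_simps)

text \<open>The coefficient of t * u is the 2 by 2 determinant of the kernel. Both entries of column
  k contain f k, so f k cancels and only (s j + f j) * (s k - s j) is left.\<close>

lemma laplace2:
  assumes j: "1 \<le> j" "j < k" and t: "0 < t" "0 < u"
  shows "(\<integral>\<^sup>+\<omega>. ennreal (exp (- t * Y j \<omega>)) * ennreal (exp (- u * Y k \<omega>)) \<partial>M) =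
    ennreal ((1 + (s j + f j) * t + (s k + f k) * u + (s j + f j) * (s k - s j) * t * u) powr (- \<alpha>))"
proof -
  let ?i = "\<lambda>m. if m = 0 then k else j" and ?t = "\<lambda>m. if m = 0 then u else t"
  let ?x = "\<lambda>m::nat. if m = 0 then s k else if m = 1 then s j else 0"
  let ?g = "\<lambda>m::nat. if m = 0 then f k else f j"
  have sk: "s j < s k" "0 < s j" using s_mono s_pos j by auto
  have pos: "1 + (s k - s j) * u > 0" using sk t by (intro add_pos_pos) auto
  have "Determinant.det (perturbed_min_mat (Suc (Suc 0)) ?x ?t (\<lambda>m. ?t m * ?g m)) =
    1 + (s j + f j) * t + (s k + f k) * u + (s j + f j) * (s k - s j) * t * u"
  proof -
    define w where "w = 1 + (s k - s j) * u"
    have w: "w * (1 / w) = 1" using pos by (simp add: w_def)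
    have "Determinant.det (perturbed_min_mat (Suc (Suc 0)) ?x ?t (\<lambda>m. ?t m * ?g m)) =
        w * (1 + (t + u * (1 / w)) * s j + (t * f j + u * f k * (1 / w)))"
      using pos sk by (subst det_perturbed_min_mat_Suc)
        (auto simp: perturbed_min_mat_def det_single w_def[symmetric])
    also have "\<dots> = w * (1 + t * s j + t * f j) + (w * (1 / w)) * (u * s j + u * f k)"
      by (simp only: distrib_left distrib_right) (simp only: mult_ac)
    finally show ?thesis unfolding w by (simp add: w_def algebra_simps)
  qed
  moreover have "(\<integral>\<^sup>+\<omega>. (\<Prod>m<Suc (Suc 0). ennreal (exp (- ?t m * Y (?i m) \<omega>))) \<partial>M) =
    ennreal (Determinant.det (perturbed_min_mat (Suc (Suc 0)) ?x ?t (\<lambda>m. ?t m * ?g m)) powr (- \<alpha>))"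
    using j t by (intro joint_laplace) (auto simp: inj_on_def)
  ultimately show ?thesis by (simp add: mult.commute)
qed

lemma exp_moment1:
  assumes j: "1 \<le> j" and l: "l * (s j + f j) < 1"
  shows "(\<integral>\<^sup>+\<omega>. ennreal (exp (l * Y j \<omega>)) \<partial>M) = ennreal ((1 - l * (s j + f j)) powr (- \<alpha>))"
proof -
  define \<kappa> where "\<kappa> = s j + f j"
  have \<kappa>: "\<kappa> > 0" using s_pos[OF j] f_nonneg[OF j] by (simp add: \<kappa>_def)
  have e: "\<kappa> powr (- \<alpha>) * (1 / \<kappa> + t) powr (- \<alpha>) = (1 + t * \<kappa>) powr (- \<alpha>)" if "1 / \<kappa> + t > 0" for t
  proof -
    have "\<kappa> powr (- \<alpha>) * (1 / \<kappa> + t) powr (- \<alpha>) = (\<kappa> * (1 / \<kappa> + t)) powr (- \<alpha>)"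
      by (rule powr_mult[symmetric])
    then show ?thesis using \<kappa> by (simp add: distrib_left mult.commute)
  qed
  have l': "l < 1 / \<kappa>" using l \<kappa> unfolding \<kappa>_def[symmetric] by (simp add: field_simps)
  have "(\<integral>\<^sup>+\<omega>. 1 * ennreal (exp (l * Y j \<omega>)) \<partial>M) = ennreal (\<kappa> powr (- \<alpha>) * (1 / \<kappa> - l) powr (- \<alpha>))"
    using laplace1[OF j] \<kappa> l' alpha_pos Y_nonneg[OF j] Y_measurable[OF j]
    by (intro weighted_exp_moment) (auto simp: e \<kappa>_def[symmetric] add_pos_pos)
  then show ?thesis using e[of "- l"] l' by (simp add: \<kappa>_def)
qed

text \<open>Given the weight \<open>exp (- l * Y k)\<close>, the variable \<open>Y j\<close> is again gamma distributed; this gives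
  the exponential moments of increments in both directions.\<close>

lemma exp_moment_diff:
  assumes jk: "1 \<le> j" "j < k" and l: "0 < l"
  shows "l * (s j + f j) + l\<^sup>2 * (s j + f j) * (s k - s j) < 1 + l * (s k + f k) \<Longrightarrow>
      (\<integral>\<^sup>+\<omega>. ennreal (exp (l * (Y j \<omega> - Y k \<omega>))) \<partial>M) =
      ennreal ((1 + l * (s k + f k) - l * (s j + f j) - l\<^sup>2 * (s j + f j) * (s k - s j)) powr (- \<alpha>))"
    and "l * (s k + f k) + l\<^sup>2 * (s j + f j) * (s k - s j) < 1 + l * (s j + f j) \<Longrightarrow>
      (\<integral>\<^sup>+\<omega>. ennreal (exp (l * (Y k \<omega> - Y j \<omega>))) \<partial>M) =
      ennreal ((1 + l * (s j + f j) - l * (s k + f k) - l\<^sup>2 * (s j + f j) * (s k - s j)) powr (- \<alpha>))"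
proof -
  define a b \<delta> where "a = s j + f j" and "b = s k + f k" and "\<delta> = s k - s j"
  have k: "1 \<le> k" using jk by simp
  have a: "a > 0" using s_pos[OF jk(1)] f_nonneg[OF jk(1)] by (simp add: a_def)
  have b: "b > 0" using s_pos[OF k] f_nonneg[OF k] by (simp add: b_def)
  have \<delta>: "\<delta> > 0" using s_mono jk by (simp add: \<delta>_def)
  note [measurable] = Y_measurable[OF jk(1)] Y_measurable[OF k]
  have lap: "(\<integral>\<^sup>+\<omega>. ennreal (exp (- t * Y j \<omega>)) * ennreal (exp (- u * Y k \<omega>)) \<partial>M) =
     ennreal ((1 + a * t + b * u + a * \<delta> * t * u) powr (- \<alpha>))" if "0 < t" "0 < u" for t u
    using laplace2[OF jk that] by (simp add: a_def b_def \<delta>_def)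
  have e: "P powr (- \<alpha>) * (R / P + t) powr (- \<alpha>) = (R + P * t) powr (- \<alpha>)" if "P > 0" "R / P + t > 0" for P R t :: real
  proof -
    have "P powr (- \<alpha>) * (R / P + t) powr (- \<alpha>) = (P * (R / P + t)) powr (- \<alpha>)"
      by (rule powr_mult[symmetric])
    then show ?thesis using that by (simp add: distrib_left)
  qed
  show "(\<integral>\<^sup>+\<omega>. ennreal (exp (l * (Y j \<omega> - Y k \<omega>))) \<partial>M) =
      ennreal ((1 + l * (s k + f k) - l * (s j + f j) - l\<^sup>2 * (s j + f j) * (s k - s j)) powr (- \<alpha>))"
    if less: "l * (s j + f j) + l\<^sup>2 * (s j + f j) * (s k - s j) < 1 + l * (s k + f k)"
  proof -
    \<comment> \<open>At u = l the polynomial of \<open>laplace2\<close> is R + P * t, affine in t: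
      the Laplace transform of a multiple of a gamma measure of rate R / P. The hypothesis on l says
      l < R / P.\<close>
    define P R where "P = a * (1 + \<delta> * l)" and "R = 1 + b * l"
    have P: "P > 0" "R > 0" using a b \<delta> l by (auto simp: P_def R_def intro!: mult_pos_pos add_pos_pos)
    have lR: "l < R / P" using less P by (simp add: P_def R_def a_def b_def \<delta>_def field_simps power2_eq_square)
    have "(\<integral>\<^sup>+\<omega>. ennreal (exp (- l * Y k \<omega>)) * ennreal (exp (l * Y j \<omega>)) \<partial>M) = ennreal (P powr (- \<alpha>) * (R / P - l) powr (- \<alpha>))"
    proof (rule weighted_exp_moment)
      show "(\<integral>\<^sup>+\<omega>. ennreal (exp (- l * Y k \<omega>)) * ennreal (exp (- t * Y j \<omega>)) \<partial>M) = ennreal (P powr (- \<alpha>) * (R / P + t) powr (- \<alpha>))" if "0 < t" for t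
        using lap[OF that l] e[of P R t] P that by (simp add: mult.commute P_def R_def algebra_simps add_pos_pos)
    qed (use P lR alpha_pos Y_nonneg[OF jk(1)] in auto)
    also have "P powr (- \<alpha>) * (R / P - l) powr (- \<alpha>) = (R - P * l) powr (- \<alpha>)"
      using e[of P R "- l"] P lR by simp
    also have "R - P * l = 1 + l * (s k + f k) - l * (s j + f j) - l\<^sup>2 * (s j + f j) * (s k - s j)"
      unfolding P_def R_def a_def b_def \<delta>_def power2_eq_square by (simp add: algebra_simps)
    finally show ?thesis by (simp add: ennreal_mult'[symmetric] exp_add[symmetric] algebra_simps)
  qed
  show "(\<integral>\<^sup>+\<omega>. ennreal (exp (l * (Y k \<omega> - Y j \<omega>))) \<partial>M) =
      ennreal ((1 + l * (s j + f j) - l * (s k + f k) - l\<^sup>2 * (s j + f j) * (s k - s j)) powr (- \<alpha>))"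
    if less: "l * (s k + f k) + l\<^sup>2 * (s j + f j) * (s k - s j) < 1 + l * (s j + f j)"
  proof -
    define P R where "P = b + a * \<delta> * l" and "R = 1 + a * l"
    have P: "P > 0" "R > 0" using a b \<delta> l by (auto simp: P_def R_def intro!: mult_pos_pos add_pos_pos)
    have lR: "l < R / P" using less P by (simp add: P_def R_def a_def b_def \<delta>_def field_simps power2_eq_square)
    have "(\<integral>\<^sup>+\<omega>. ennreal (exp (- l * Y j \<omega>)) * ennreal (exp (l * Y k \<omega>)) \<partial>M) = ennreal (P powr (- \<alpha>) * (R / P - l) powr (- \<alpha>))"
    proof (rule weighted_exp_moment)
      show "(\<integral>\<^sup>+\<omega>. ennreal (exp (- l * Y j \<omega>)) * ennreal (exp (- t * Y k \<omega>)) \<partial>M) = ennreal (P powr (- \<alpha>) * (R / P + t) powr (- \<alpha>))" if "0 < t" for t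
        using lap[OF l that] e[of P R t] P that by (simp add: P_def R_def algebra_simps add_pos_pos)
    qed (use P lR alpha_pos Y_nonneg[OF k] in auto)
    also have "P powr (- \<alpha>) * (R / P - l) powr (- \<alpha>) = (R - P * l) powr (- \<alpha>)"
      using e[of P R "- l"] P lR by simp
    also have "R - P * l = 1 + l * (s j + f j) - l * (s k + f k) - l\<^sup>2 * (s j + f j) * (s k - s j)"
      unfolding P_def R_def a_def b_def \<delta>_def power2_eq_square by (simp add: algebra_simps)
    finally show ?thesis by (simp add: ennreal_mult'[symmetric] exp_add[symmetric] algebra_simps)
  qed
qed

end

section \<open>Maximal inequality\<close>

lemma (in prob_space) chernoff_exp:
  assumes [measurable]: "X \<in> borel_measurable M" and l: "0 < l"
    and C: "(\<integral>\<^sup>+\<omega>. ennreal (exp (l * X \<omega>)) \<partial>M) \<le> ennreal C" "0 \<le> C"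
  shows "prob {\<omega> \<in> space M. y < X \<omega>} \<le> C * exp (- l * y)"
proof -
  have "emeasure M {\<omega> \<in> space M. y < X \<omega>} = (\<integral>\<^sup>+\<omega>. indicator {\<omega> \<in> space M. y < X \<omega>} \<omega> \<partial>M)"
    by (rule nn_integral_indicator[symmetric]) measurable
  also have "\<dots> \<le> (\<integral>\<^sup>+\<omega>. ennreal (exp (- l * y)) * ennreal (exp (l * X \<omega>)) \<partial>M)"
  proof (rule nn_integral_mono)
    fix \<omega>
    show "indicator {\<omega> \<in> space M. y < X \<omega>} \<omega> \<le> ennreal (exp (- l * y)) * ennreal (exp (l * X \<omega>))"
    proof (cases "y < X \<omega>")
      case True
      then have "0 \<le> - l * y + l * X \<omega>" using l by simp
      then have "1 \<le> exp (- l * y + l * X \<omega>)" by simp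
      then have "1 \<le> ennreal (exp (- l * y) * exp (l * X \<omega>))" by (simp only: exp_add ennreal_ge_1)
      then show ?thesis by (auto simp: indicator_def ennreal_mult'[symmetric])
    qed (simp add: indicator_def)
  qed
  also have "\<dots> = ennreal (exp (- l * y)) * (\<integral>\<^sup>+\<omega>. ennreal (exp (l * X \<omega>)) \<partial>M)"
    by (rule nn_integral_cmult) measurable
  also have "\<dots> \<le> ennreal (exp (- l * y)) * ennreal C" by (intro mult_left_mono C) auto
  also have "\<dots> = ennreal (C * exp (- l * y))" using C by (simp add: ennreal_mult'[symmetric] mult.commute)
  finally show ?thesis using C by (simp add: emeasure_eq_measure ennreal_le_iff)
qed

lemma (in prob_space) borel_cantelli_bound:
  assumes A: "\<And>n. A n \<in> events" and le: "eventually (\<lambda>n. prob (A n) \<le> g n) sequentially" and g: "summable g"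
  shows "AE \<omega> in M. eventually (\<lambda>n. \<omega> \<notin> A n) sequentially"
proof -
  have "summable (\<lambda>n. prob (A n))"
    by (rule summable_comparison_test_ev[OF _ g]) (use le in \<open>auto elim: eventually_mono\<close>)
  then have "AE \<omega> in M. eventually (\<lambda>n. \<omega> \<in> space M - A n) sequentially"
    using A by (intro borel_cantelli_AE1) (auto simp: emeasure_eq_measure)
  then show ?thesis by eventually_elim (auto elim: eventually_mono)
qed

lemma power_le_fact_exp: "(x::real) ^ n \<le> fact n * exp x" if "0 \<le> x"
proof -
  have "(\<Sum>k\<in>{n}. x ^ k /\<^sub>R fact k) \<le> (\<Sum>k. x ^ k /\<^sub>R fact k)"
    using that by (intro sum_le_suminf summable_exp_generic) auto
  then have "x ^ n /\<^sub>R fact n \<le> exp x" by (simp add: exp_def)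
  then show ?thesis by (simp add: field_simps)
qed

text \<open>Convexity at u + v = 1/10 * (10 * u) + 9/10 * (10/9 * v). The unequal weights keep the
  constant at v small; v is the part to which the recursion in \<open>maximal_moment\<close> is
  applied, while the large constant at u is paid for by the increment bound.\<close>

lemma even_power_add_le:
  fixes u v :: real
  shows "(u + v) ^ (2 * q) \<le> 1 / 10 * 100 ^ q * u ^ (2 * q) + 9 / 10 * (100 / 81) ^ q * v ^ (2 * q)"
proof -
  have "convex_on UNIV (\<lambda>x::real. x ^ (2 * q))" by (rule convex_power_even) simp
  then have "((1 - 9/10) *\<^sub>R (10 * u) + (9/10) *\<^sub>R (10 / 9 * v)) ^ (2 * q) \<le>
      (1 - 9/10) * (10 * u) ^ (2 * q) + (9/10) * (10 / 9 * v) ^ (2 * q)"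
    by (rule convex_onD) auto
  then show ?thesis by (simp add: power_mult power_mult_distrib power_divide power2_eq_square)
qed

text \<open>Chaining by bisection of the time interval: the factor \<open>2 * (1/2) ^ q\<close> from the two halves
  beats the constant \<open>9/10 * (100/81) ^ q\<close> lost in recombining them as soon as \<open>q \<ge> 3\<close>.\<close>

lemma maximal_moment:
  fixes X :: "nat \<Rightarrow> 'a \<Rightarrow> real" and T :: "nat \<Rightarrow> real"
  assumes X: "\<And>i. a \<le> i \<Longrightarrow> i \<le> b \<Longrightarrow> X i \<in> borel_measurable M"
    and T: "\<And>i j. a \<le> i \<Longrightarrow> i \<le> j \<Longrightarrow> j \<le> b \<Longrightarrow> T i \<le> T j" and q: "3 \<le> q" and c: "0 \<le> c"
    and incr: "\<And>i j. a \<le> i \<Longrightarrow> i \<le> j \<Longrightarrow> j \<le> b \<Longrightarrow>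
      (\<integral>\<^sup>+\<omega>. ennreal ((X j \<omega> - X i \<omega>) ^ (2 * q)) \<partial>M) \<le> ennreal (c * (T j - T i) ^ q)"
    and mn: "a \<le> m" "m \<le> n" "n \<le> b"
  shows "(\<integral>\<^sup>+\<omega>. (SUP i\<in>{m..n}. ennreal ((X i \<omega> - X m \<omega>) ^ (2 * q))) \<partial>M) \<le>
    ennreal (1 / 5 * 100 ^ q * c * (T n - T m) ^ q)"
  using mn
proof (induction "n - m" arbitrary: m n rule: less_induct)
  case less
  define S where "S m n \<omega> = (SUP i\<in>{m..n}. ennreal ((X i \<omega> - X m \<omega>) ^ (2 * q)))" for m n \<omega>
  have Sm[measurable]: "S m n \<in> borel_measurable M" if "a \<le> m" "n \<le> b" for m n
  proof (cases "m \<le> n")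
    case True
    have "(\<lambda>\<omega>. ennreal ((X i \<omega> - X m \<omega>) ^ (2 * q))) \<in> borel_measurable M" if "i \<in> {m..n}" for i
    proof -
      have [measurable]: "X i \<in> borel_measurable M" "X m \<in> borel_measurable M"
        using that \<open>a \<le> m\<close> \<open>n \<le> b\<close> by (auto intro!: X)
      show ?thesis by measurable
    qed
    then show ?thesis unfolding S_def by (intro borel_measurable_SUP) auto
  qed (simp add: S_def[abs_def])
  show ?case
  proof (cases "m = n")
    case True
    then show ?thesis using q c by (simp add: power_0_left)
  next
    case False
    then have mn: "m < n" using less.prems by simp
    \<comment> \<open>Here k is the first index past m at or beyond the midpoint in T, and l = k -
      1. Both {m..l} and {k..n} then have at most half the length in T, however large the jump from
      l to k is; that jump is contained in X k - X m.\<close>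
    define P where "P k \<longleftrightarrow> m < k \<and> (T m + T n) / 2 \<le> T k" for k
    define k where "k = (LEAST k. P k)"
    have Pn: "P n" using T[of m n] less.prems mn by (auto simp: P_def)
    then have Pk: "P k" unfolding k_def by (rule LeastI)
    have kn: "k \<le> n" unfolding k_def using Pn by (rule Least_le)
    have mk: "m < k" and Tk: "(T m + T n) / 2 \<le> T k" using Pk by (auto simp: P_def)
    define l where "l = k - 1"
    have l: "m \<le> l" "l < k" "k = Suc l" using mk by (auto simp: l_def)
    have Tl: "T l - T m \<le> (T n - T m) / 2"
    proof (cases "l = m")
      case True
      then show ?thesis using T[of m n] less.prems by simp
    next
      case False
      then have "\<not> P l" using not_less_Least[of l P] l unfolding k_def[symmetric] by simp
      then show ?thesis using False l by (simp add: P_def field_simps)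
    qed
    have Tk': "T n - T k \<le> (T n - T m) / 2" using Tk by (simp add: field_simps)
    have T0: "0 \<le> T l - T m" "0 \<le> T n - T k" "0 \<le> T k - T m" "0 \<le> T n - T m" "T k \<le> T n"
      using T[of m l] T[of k n] T[of m k] T[of m n] less.prems l kn mk by auto
    \<comment> \<open>K solves K = \<sigma> * c + K / 2: the increment up to k contributes \<sigma>
      * c, and the two halves together at most K / 2.\<close>
    define K where "K = 1 / 5 * 100 ^ q * c"
    have K0: "0 \<le> K" using c by (simp add: K_def)
    define \<rho> where "\<rho> = 9 / 10 * (100 / 81 :: real) ^ q"
    define \<sigma> where "\<sigma> = 1 / 10 * (100 :: real) ^ q"
    have "(100 / 81 :: real) ^ 3 \<le> (100 / 81) ^ q" using q by (intro power_increasing) auto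
    then have \<rho>1: "1 \<le> \<rho>" by (simp add: \<rho>_def power3_eq_cube)
    have \<sigma>0: "0 \<le> \<sigma>" by (simp add: \<sigma>_def)
    have half: "2 * \<rho> * (1 / 2) ^ q \<le> 1 / 2"
    proof -
      have "(50 / 81 :: real) ^ q \<le> (50 / 81) ^ 3" using q by (intro power_decreasing) auto
      moreover have "(100 / 81 :: real) ^ q * (1 / 2) ^ q = (50 / 81) ^ q" by (simp add: power_mult_distrib[symmetric])
      ultimately show ?thesis by (simp add: \<rho>_def power3_eq_cube mult.assoc)
    qed
    have le: "S m n \<omega> \<le> ennreal \<sigma> * ennreal ((X k \<omega> - X m \<omega>) ^ (2 * q)) + ennreal \<rho> * (S m l \<omega> + S k n \<omega>)" for \<omega>
      unfolding S_def[of m n]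
    proof (rule SUP_least)
      fix i assume i: "i \<in> {m..n}"
      show "ennreal ((X i \<omega> - X m \<omega>) ^ (2 * q)) \<le> ennreal \<sigma> * ennreal ((X k \<omega> - X m \<omega>) ^ (2 * q)) + ennreal \<rho> * (S m l \<omega> + S k n \<omega>)"
      proof (cases "i \<le> l")
        case True
        have "ennreal ((X i \<omega> - X m \<omega>) ^ (2 * q)) \<le> S m l \<omega>"
          unfolding S_def using True i by (intro SUP_upper) auto
        also have "\<dots> \<le> S m l \<omega> + S k n \<omega>" by simp
        also have "\<dots> = 1 * (S m l \<omega> + S k n \<omega>)" by simp
        also have "\<dots> \<le> ennreal \<rho> * (S m l \<omega> + S k n \<omega>)"
          using \<rho>1 by (intro mult_right_mono) auto
        also have "\<dots> \<le> ennreal \<sigma> * ennreal ((X k \<omega> - X m \<omega>) ^ (2 * q)) + \<dots>" by simp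
        finally show ?thesis .
      next
        case False
        then have "i \<in> {k..n}" using i l by auto
        then have "ennreal ((X i \<omega> - X k \<omega>) ^ (2 * q)) \<le> S k n \<omega>"
          unfolding S_def by (intro SUP_upper)
        also have "\<dots> \<le> S m l \<omega> + S k n \<omega>" by simp
        finally have 1: "ennreal ((X i \<omega> - X k \<omega>) ^ (2 * q)) \<le> S m l \<omega> + S k n \<omega>" .
        have "(X i \<omega> - X m \<omega>) ^ (2 * q) \<le> \<sigma> * (X k \<omega> - X m \<omega>) ^ (2 * q) + \<rho> * (X i \<omega> - X k \<omega>) ^ (2 * q)"
          using even_power_add_le[of "X k \<omega> - X m \<omega>" "X i \<omega> - X k \<omega>" q] by (simp add: \<sigma>_def \<rho>_def)
        then have "ennreal ((X i \<omega> - X m \<omega>) ^ (2 * q)) \<le> ennreal (\<sigma> * (X k \<omega> - X m \<omega>) ^ (2 * q) + \<rho> * (X i \<omega> - X k \<omega>) ^ (2 * q))"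
          by (rule ennreal_leI)
        also have "\<dots> = ennreal \<sigma> * ennreal ((X k \<omega> - X m \<omega>) ^ (2 * q)) + ennreal \<rho> * ennreal ((X i \<omega> - X k \<omega>) ^ (2 * q))"
          using \<sigma>0 \<rho>1 by (simp add: ennreal_mult')
        also have "\<dots> \<le> ennreal \<sigma> * ennreal ((X k \<omega> - X m \<omega>) ^ (2 * q)) + ennreal \<rho> * (S m l \<omega> + S k n \<omega>)"
          by (intro add_left_mono mult_left_mono 1) auto
        finally show ?thesis .
      qed
    qed
    have [measurable]: "X k \<in> borel_measurable M" "X m \<in> borel_measurable M"
      "S m l \<in> borel_measurable M" "S k n \<in> borel_measurable M"
      using less.prems l kn mk by (auto intro!: X Sm)
    have IH: "(\<integral>\<^sup>+\<omega>. S m' n' \<omega> \<partial>M) \<le> ennreal (K * ((T n - T m) / 2) ^ q)"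
      if "n' - m' < n - m" "a \<le> m'" "m' \<le> n'" "n' \<le> b" "0 \<le> T n' - T m'" "T n' - T m' \<le> (T n - T m) / 2" for m' n'
    proof -
      have "(\<integral>\<^sup>+\<omega>. S m' n' \<omega> \<partial>M) \<le> ennreal (K * (T n' - T m') ^ q)"
        unfolding S_def K_def using less.hyps[OF that(1-4)] .
      also have "\<dots> \<le> ennreal (K * ((T n - T m) / 2) ^ q)"
        using K0 that(5,6) by (intro ennreal_leI mult_left_mono power_mono) auto
      finally show ?thesis .
    qed
    have "(\<integral>\<^sup>+\<omega>. S m n \<omega> \<partial>M) \<le> (\<integral>\<^sup>+\<omega>. ennreal \<sigma> * ennreal ((X k \<omega> - X m \<omega>) ^ (2 * q)) + ennreal \<rho> * (S m l \<omega> + S k n \<omega>) \<partial>M)"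
      by (intro nn_integral_mono le)
    also have "\<dots> = ennreal \<sigma> * (\<integral>\<^sup>+\<omega>. ennreal ((X k \<omega> - X m \<omega>) ^ (2 * q)) \<partial>M) + ennreal \<rho> * ((\<integral>\<^sup>+\<omega>. S m l \<omega> \<partial>M) + (\<integral>\<^sup>+\<omega>. S k n \<omega> \<partial>M))"
      by (simp add: nn_integral_add nn_integral_cmult)
    also have "\<dots> \<le> ennreal \<sigma> * ennreal (c * (T n - T m) ^ q) + ennreal \<rho> * (ennreal (K * ((T n - T m) / 2) ^ q) + ennreal (K * ((T n - T m) / 2) ^ q))"
    proof (intro add_mono mult_left_mono)
      have "(\<integral>\<^sup>+\<omega>. ennreal ((X k \<omega> - X m \<omega>) ^ (2 * q)) \<partial>M) \<le> ennreal (c * (T k - T m) ^ q)"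
        using less.prems mk kn by (intro incr) auto
      also have "\<dots> \<le> ennreal (c * (T n - T m) ^ q)"
        using c T0 by (intro ennreal_leI mult_left_mono power_mono) auto
      finally show "(\<integral>\<^sup>+\<omega>. ennreal ((X k \<omega> - X m \<omega>) ^ (2 * q)) \<partial>M) \<le> ennreal (c * (T n - T m) ^ q)" .
      show "(\<integral>\<^sup>+\<omega>. S m l \<omega> \<partial>M) \<le> ennreal (K * ((T n - T m) / 2) ^ q)"
        using less.prems l kn Tl T0 by (intro IH) auto
      show "(\<integral>\<^sup>+\<omega>. S k n \<omega> \<partial>M) \<le> ennreal (K * ((T n - T m) / 2) ^ q)"
        using less.prems l kn mk Tk' T0 by (intro IH) auto
    qed auto
    also have "\<dots> = ennreal (\<sigma> * (c * (T n - T m) ^ q) + \<rho> * (K * ((T n - T m) / 2) ^ q + K * ((T n - T m) / 2) ^ q))"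
      using \<sigma>0 \<rho>1 c K0 T0(4) by (simp add: ennreal_mult'[symmetric] ennreal_plus[symmetric] del: ennreal_plus)
    also have "\<dots> \<le> ennreal (K * (T n - T m) ^ q)"
    proof (rule ennreal_leI)
      have pw: "((T n - T m) / 2) ^ q = (1 / 2) ^ q * (T n - T m) ^ q"
        by (simp add: power_divide)
      have "\<sigma> * (c * (T n - T m) ^ q) = K * (T n - T m) ^ q * (1 / 2)"
        by (simp add: \<sigma>_def K_def)
      moreover have "\<rho> * (K * ((T n - T m) / 2) ^ q + K * ((T n - T m) / 2) ^ q) = K * (T n - T m) ^ q * (2 * \<rho> * (1 / 2) ^ q)"
        unfolding pw by (simp only: mult_2 distrib_left distrib_right mult_ac)
      moreover have "K * (T n - T m) ^ q * (2 * \<rho> * (1 / 2) ^ q) \<le> K * (T n - T m) ^ q * (1 / 2)"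
        using K0 T0(4) half by (intro mult_left_mono) auto
      ultimately show "\<sigma> * (c * (T n - T m) ^ q) + \<rho> * (K * ((T n - T m) / 2) ^ q + K * ((T n - T m) / 2) ^ q) \<le> K * (T n - T m) ^ q"
        by linarith
    qed
    finally show ?thesis unfolding S_def K_def .
  qed
qed

section \<open>Tails of the marginals and moments of the increments\<close>

context excessive_permanental
begin

lemma f_ratio_le: "1 \<le> j \<Longrightarrow> f j / s j \<le> f 1 / s 1"
proof (cases "j = 1")
  case False
  assume j: "1 \<le> j"
  with False have "(f j - f 1) / (s j - s 1) \<le> f 1 / s 1" "s 1 < s j" "0 < s 1" "0 < s j"
    using f_concave_0[of 1 j] s_mono[of 1 j] s_pos[of 1] s_pos[of j] by auto
  then have "(f j - f 1) * s 1 \<le> f 1 * (s j - s 1)" by (simp add: field_simps)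
  then have "f j * s 1 \<le> f 1 * s j" by (simp add: algebra_simps)
  then show ?thesis using \<open>0 < s 1\<close> \<open>0 < s j\<close> by (simp add: field_simps)
qed simp

lemma tail1:
  assumes j: "1 \<le> j" and \<eta>: "0 < \<eta>" "\<eta> < 1"
  shows "prob {\<omega> \<in> space M. y < Y j \<omega>} \<le> \<eta> powr (- \<alpha>) * exp (- ((1 - \<eta>) / (s j + f j)) * y)"
proof -
  have K: "s j + f j > 0" using s_pos[OF j] f_nonneg[OF j] by simp
  have "(\<integral>\<^sup>+\<omega>. ennreal (exp ((1 - \<eta>) / (s j + f j) * Y j \<omega>)) \<partial>M) \<le> ennreal (\<eta> powr (- \<alpha>))"
    using exp_moment1[OF j, of "(1 - \<eta>) / (s j + f j)"] K \<eta> by simp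
  then show ?thesis
    using K \<eta> Y_measurable[OF j] by (intro chernoff_exp) auto
qed

text \<open>At height of order B an increment over a gap \<delta> has size about sqrt (B *
  \<delta>): its exponential moments at a rate of order 1 / sqrt (B * \<delta>) are bounded in both
  directions, and x ^ n \<le> n! * exp x turns them into even moments. The constant H controls f: s
  j + f j \<le> H * s j, and s + f increases by at most H * \<delta>.\<close>

lemma increment_moment:
  assumes j: "1 \<le> j" "j \<le> k" and B: "0 < B" "B \<le> s j" "s k \<le> 2 * B"
  defines "H \<equiv> 1 + f 1 / s 1"
  shows "(\<integral>\<^sup>+\<omega>. ennreal ((Y k \<omega> - Y j \<omega>) ^ (2 * q)) \<partial>M) \<le>
    ennreal (2 * 2 powr \<alpha> * fact (2 * q) * (16 * H\<^sup>2 * B) ^ q * (s k - s j) ^ q)"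
proof (cases "j = k")
  case True
  moreover have "1 \<le> 2 powr \<alpha>" using alpha_pos by (simp add: ge_one_powr_ge_zero)
  ultimately show ?thesis by (cases q) (auto simp: H_def emeasure_space_1)
next
  case False
  then have jk: "j < k" using j by simp
  have sjk: "s j < s k" using s_mono j jk by simp
  have sj: "0 < s j" using s_pos j by simp
  define \<delta> where "\<delta> = s k - s j"
  have \<delta>: "0 < \<delta>" "\<delta> \<le> B" using sjk B by (auto simp: \<delta>_def)
  have H1: "1 \<le> H" using f_nonneg[of 1] s_pos[of 1] by (simp add: H_def)
  have fj: "f j \<le> (H - 1) * s j" using f_ratio_le[OF j(1)] sj by (simp add: H_def field_simps)
  have aH: "s j + f j \<le> H * s j" using fj by (simp add: algebra_simps)
  have a0: "0 < s j + f j" using sj f_nonneg[OF j(1)] by simp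
  have "(f k - f j) / \<delta> \<le> H - 1"
    using f_concave_0[of j k] f_ratio_le[OF j(1)] j jk by (simp add: H_def \<delta>_def)
  then have "f k - f j \<le> (H - 1) * \<delta>" using \<delta> by (simp add: field_simps)
  then have ba: "(s k + f k) - (s j + f j) \<le> H * \<delta>" by (simp add: \<delta>_def algebra_simps)
  have ba0: "0 \<le> (s k + f k) - (s j + f j)" using sjk f_mono[of j k] j by simp
  define R where "R = sqrt (B * \<delta>)"
  have R: "0 < R" "R\<^sup>2 = B * \<delta>" "\<delta> \<le> R"
  proof -
    show "0 < R" "R\<^sup>2 = B * \<delta>" using B \<delta> by (auto simp: R_def)
    have "\<delta>\<^sup>2 \<le> B * \<delta>" using \<delta> by (simp add: power2_eq_square)
    then show "\<delta> \<le> R" unfolding R_def by (rule real_le_rsqrt)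
  qed
  \<comment> \<open>With this rate the linear term is at most 1/4 and the quadratic term at most
    1/8, so both expressions in \<open>exp_moment_diff\<close> stay above 1/2.\<close>
  define l where "l = 1 / (4 * H * R)"
  have l0: "0 < l" using H1 R by (simp add: l_def)
  have 1: "l * ((s k + f k) - (s j + f j)) \<le> 1 / 4"
  proof -
    have "l * ((s k + f k) - (s j + f j)) \<le> l * (H * R)"
      using l0 ba R(3) H1 by (intro mult_left_mono order.trans[OF ba] mult_left_mono) auto
    also have "\<dots> = 1 / 4" using H1 R by (simp add: l_def)
    finally show ?thesis .
  qed
  have 2: "l\<^sup>2 * (s j + f j) * \<delta> \<le> 1 / 8"
  proof -
    have "s j + f j \<le> 2 * H\<^sup>2 * B"
    proof -
      have "s j + f j \<le> H * s j" by (rule aH)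
      also have "\<dots> \<le> H * (2 * B)" using sjk B H1 by (intro mult_left_mono) auto
      also have "\<dots> \<le> H\<^sup>2 * (2 * B)" using H1 B by (intro mult_right_mono) (auto simp: power2_eq_square)
      finally show ?thesis by simp
    qed
    then have "l\<^sup>2 * (s j + f j) * \<delta> \<le> l\<^sup>2 * (2 * H\<^sup>2 * B) * \<delta>"
      using \<delta> by (intro mult_right_mono mult_left_mono) auto
    also have "\<dots> = l\<^sup>2 * (2 * H\<^sup>2 * R\<^sup>2)" using R by simp
    also have "\<dots> = 1 / 8" using H1 R(1) by (simp add: l_def power_mult_distrib power_divide)
    finally show ?thesis .
  qed
  have pw: "u powr (- \<alpha>) \<le> 2 powr \<alpha>" if "1 / 2 \<le> u" for u
  proof -
    have "u powr (- \<alpha>) \<le> (1 / 2) powr (- \<alpha>)" using that alpha_pos by (intro powr_mono2') auto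
    then show ?thesis by (simp add: powr_divide powr_minus_divide)
  qed
  note [measurable] = Y_measurable[OF j(1)] Y_measurable[of k]
  have k1: "1 \<le> k" using j by simp
  note [measurable] = Y_measurable[OF k1]
  have dn: "(\<integral>\<^sup>+\<omega>. ennreal (exp (l * (Y j \<omega> - Y k \<omega>))) \<partial>M) \<le> ennreal (2 powr \<alpha>)"
  proof -
    have "0 \<le> l * ((s k + f k) - (s j + f j))" using l0 ba0 by simp
    then have "l * (s j + f j) \<le> l * (s k + f k)" by (simp add: right_diff_distrib)
    then have "1 / 2 \<le> 1 + l * (s k + f k) - l * (s j + f j) - l\<^sup>2 * (s j + f j) * (s k - s j)"
      using 2 by (simp add: \<delta>_def)
    then show ?thesis
      by (subst exp_moment_diff(1)[OF j(1) jk l0]) (auto intro: ennreal_leI pw)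
  qed
  have up: "(\<integral>\<^sup>+\<omega>. ennreal (exp (l * (Y k \<omega> - Y j \<omega>))) \<partial>M) \<le> ennreal (2 powr \<alpha>)"
  proof -
    have "l * (s k + f k) - l * (s j + f j) \<le> 1 / 4" using 1 by (simp add: right_diff_distrib)
    then have "1 / 2 \<le> 1 + l * (s j + f j) - l * (s k + f k) - l\<^sup>2 * (s j + f j) * (s k - s j)"
      using 2 unfolding \<delta>_def by linarith
    then show ?thesis
      by (subst exp_moment_diff(2)[OF j(1) jk l0]) (auto intro: ennreal_leI pw)
  qed
  define A where "A = fact (2 * q) * (1 / l) ^ (2 * q)"
  have A0: "0 \<le> A" using l0 by (simp add: A_def)
  have "(\<integral>\<^sup>+\<omega>. ennreal ((Y k \<omega> - Y j \<omega>) ^ (2 * q)) \<partial>M) \<le>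
     (\<integral>\<^sup>+\<omega>. ennreal A * (ennreal (exp (l * (Y k \<omega> - Y j \<omega>))) + ennreal (exp (l * (Y j \<omega> - Y k \<omega>)))) \<partial>M)"
  proof (rule nn_integral_mono)
    fix \<omega>
    define z where "z = Y k \<omega> - Y j \<omega>"
    have "(l * \<bar>z\<bar>) ^ (2 * q) \<le> fact (2 * q) * exp (l * \<bar>z\<bar>)"
      using l0 by (intro power_le_fact_exp) auto
    moreover have "exp (l * \<bar>z\<bar>) \<le> exp (l * z) + exp (l * (- z))" by (auto simp: abs_if add_increasing add_increasing2)
    ultimately have *: "(l * \<bar>z\<bar>) ^ (2 * q) \<le> fact (2 * q) * (exp (l * z) + exp (l * (- z)))"
      by (meson mult_left_mono order.trans fact_ge_zero)
    have "z ^ (2 * q) = (1 / l) ^ (2 * q) * (l * \<bar>z\<bar>) ^ (2 * q)"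
      using l0 by (simp add: power_mult_distrib[symmetric] power_even_abs)
    also have "\<dots> \<le> (1 / l) ^ (2 * q) * (fact (2 * q) * (exp (l * z) + exp (l * (- z))))"
      using l0 by (intro mult_left_mono *) auto
    also have "\<dots> = A * (exp (l * z) + exp (l * (- z)))" by (simp add: A_def)
    finally have "ennreal (z ^ (2 * q)) \<le> ennreal A * (ennreal (exp (l * z)) + ennreal (exp (l * (- z))))"
      using A0 by (simp add: ennreal_mult'[symmetric] ennreal_plus[symmetric] ennreal_leI del: ennreal_plus)
    then show "ennreal ((Y k \<omega> - Y j \<omega>) ^ (2 * q)) \<le> ennreal A * (ennreal (exp (l * (Y k \<omega> - Y j \<omega>))) + ennreal (exp (l * (Y j \<omega> - Y k \<omega>))))"
      by (simp add: z_def)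
  qed
  also have "\<dots> = ennreal A * ((\<integral>\<^sup>+\<omega>. ennreal (exp (l * (Y k \<omega> - Y j \<omega>))) \<partial>M) + (\<integral>\<^sup>+\<omega>. ennreal (exp (l * (Y j \<omega> - Y k \<omega>))) \<partial>M))"
    by (simp add: nn_integral_cmult nn_integral_add)
  also have "\<dots> \<le> ennreal A * (ennreal (2 powr \<alpha>) + ennreal (2 powr \<alpha>))"
    by (intro mult_left_mono add_mono up dn) auto
  also have "\<dots> = ennreal (A * (2 * 2 powr \<alpha>))"
    using A0 by (simp add: ennreal_mult'[symmetric] ennreal_plus[symmetric] del: ennreal_plus)
  also have "A * (2 * 2 powr \<alpha>) = 2 * 2 powr \<alpha> * fact (2 * q) * (16 * H\<^sup>2 * B) ^ q * (s k - s j) ^ q"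
  proof -
    have "(1 / l) ^ (2 * q) = ((4 * H * R)\<^sup>2) ^ q" by (simp add: l_def power_mult)
    also have "(4 * H * R)\<^sup>2 = 16 * H\<^sup>2 * B * (s k - s j)"
      using R by (simp add: power_mult_distrib \<delta>_def)
    finally show ?thesis by (simp add: A_def power_mult_distrib)
  qed
  finally show ?thesis .
qed

end

section \<open>Lower bound along geometric subsequences\<close>

lemma gamma_cdf_mono: "a > 0 \<Longrightarrow> x \<le> y \<Longrightarrow> gamma_cdf a x \<le> gamma_cdf a y"
  unfolding gamma_cdf_def
  by (rule finite_measure.finite_measure_mono[OF prob_space.finite_measure[OF prob_space_gamma_measure]]) auto

text \<open>The tail bound with c = 1 / \<kappa> gives a probability of at least b / n of exceeding
  \<kappa> * ln n. The bound 1 - b / n is restated through differences of logarithms so that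
  products over n telescope.\<close>

lemma gamma_cdf_ln_le:
  assumes a: "a > 0" and \<kappa>: "0 < \<kappa>" "\<kappa> < 1"
  shows "\<exists>b>0. eventually (\<lambda>n. gamma_cdf a (\<kappa> * ln (real n)) \<le> exp (- b * (ln (real (Suc n)) - ln (real n)))) sequentially"
proof -
  have "1 / \<kappa> > 1" using \<kappa> by simp
  then obtain b where b: "b > 0" and ev: "eventually (\<lambda>x. b * exp (- (1 / \<kappa>) * x) \<le> 1 - gamma_cdf a x) at_top"
    using gamma_tail_lower[OF a] by blast
  have "filterlim (\<lambda>n. \<kappa> * ln (real n)) at_top sequentially"
    using \<kappa>(1) by real_asymp
  then have "eventually (\<lambda>n. b * exp (- (1 / \<kappa>) * (\<kappa> * ln (real n))) \<le> 1 - gamma_cdf a (\<kappa> * ln (real n))) sequentially"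
    by (rule eventually_compose_filterlim[OF ev])
  moreover have "eventually (\<lambda>n::nat. 0 < n) sequentially" by (rule eventually_gt_at_top)
  ultimately have "eventually (\<lambda>n. gamma_cdf a (\<kappa> * ln (real n)) \<le> exp (- b * (ln (real (Suc n)) - ln (real n)))) sequentially"
  proof eventually_elim
    case (elim n)
    have "exp (- (1 / \<kappa>) * (\<kappa> * ln (real n))) = 1 / real n"
      using \<kappa> elim(2) by (simp add: exp_minus inverse_eq_divide)
    then have "gamma_cdf a (\<kappa> * ln (real n)) \<le> 1 + (- (b / real n))" using elim(1) by simp
    also have "\<dots> \<le> exp (- (b / real n))" by (rule exp_ge_add_one_self)
    also have "\<dots> \<le> exp (- b * (ln (real (Suc n)) - ln (real n)))"
    proof -
      have "ln (real (Suc n)) - ln (real n) = ln (1 + 1 / real n)"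
      proof -
        have "1 + 1 / real n = real (Suc n) / real n" using elim(2) by (simp add: field_simps)
        then show ?thesis using elim(2) by (simp add: ln_div)
      qed
      also have "\<dots> \<le> 1 / real n" by (rule ln_add_one_self_le_self) simp
      finally have "b * (ln (real (Suc n)) - ln (real n)) \<le> b * (1 / real n)"
        using b by (intro mult_left_mono) auto
      then show ?thesis by simp
    qed
    finally show ?case .
  qed
  with b show ?thesis by blast
qed

text \<open>The factor 1 - \<eta> is lost in the Chernoff bound and one factor 1 + \<eta> in
  replacing s j + f j by s j; the other one remains as an exponent larger than 1, which makes the
  tails summable.\<close>

lemma chernoff_exponent:
  fixes \<epsilon> :: real assumes "0 < \<epsilon>"
  shows "\<exists>\<eta>>0. \<eta> < 1 \<and> (1 + \<eta>) * (1 + \<eta>) \<le> (1 - \<eta>) * (1 + \<epsilon>)"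
proof -
  have "((\<lambda>\<eta>. (1 - \<eta>) * (1 + \<epsilon>) - (1 + \<eta>) * (1 + \<eta>)) \<longlongrightarrow> (1 - 0) * (1 + \<epsilon>) - (1 + 0) * (1 + 0)) (at_right 0)"
    by (intro tendsto_intros)
  then have "eventually (\<lambda>\<eta>. 0 < (1 - \<eta>) * (1 + \<epsilon>) - (1 + \<eta>) * (1 + \<eta>)) (at_right 0)"
    using assms by (intro order_tendstoD(1)) auto
  moreover have "eventually (\<lambda>\<eta>::real. \<eta> \<in> {0<..<1}) (at_right 0)"
    by (rule eventually_at_right_real) simp
  ultimately have "eventually (\<lambda>\<eta>. 0 < \<eta> \<and> \<eta> < 1 \<and> (1 + \<eta>) * (1 + \<eta>) \<le> (1 - \<eta>) * (1 + \<epsilon>)) (at_right 0)"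
    by eventually_elim auto
  then show ?thesis
    using eventually_happens'[OF trivial_limit_at_right_real[of "0::real"]] by blast
qed

context excessive_permanental
begin

text \<open>Growth by a factor Q bounds both gaps next to s (J n) from below by multiples of s (J
  n), so the rates are at most (Q + 1) / (Q - 1) / s (J n). The probability that all of the indices
  N, ..., N + L stay below their thresholds is then at most the b-th power of N / (N + L + 1), which
  tends to 0 as L grows.\<close>

lemma frequently_large:
  assumes J: "\<And>n. 1 \<le> J n" "\<And>n. Q * s (J n) \<le> s (J (Suc n))" and Q: "1 < Q"
    and \<kappa>: "0 < \<kappa>" "\<kappa> * ((Q + 1) / (Q - 1)) < 1"
  shows "AE \<omega> in M. \<exists>\<^sub>F n in sequentially. \<kappa> * s (J n) * ln (real n) < Y (J n) \<omega>"
proof -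
  have sJ: "0 < s (J n)" for n using s_pos J by simp
  have JSuc: "J n < J (Suc n)" for n
  proof (rule ccontr)
    assume "\<not> J n < J (Suc n)"
    then have "s (J (Suc n)) \<le> s (J n)"
      using s_mono[of "J (Suc n)" "J n"] J(1)[of "Suc n"] by (cases "J (Suc n) = J n") auto
    moreover have "s (J n) < Q * s (J n)" using sJ[of n] Q by simp
    ultimately show False using J(2)[of n] by simp
  qed
  define \<kappa>' where "\<kappa>' = \<kappa> * ((Q + 1) / (Q - 1))"
  have \<kappa>': "0 < \<kappa>'" "\<kappa>' < 1" using \<kappa> Q by (auto simp: \<kappa>'_def)
  obtain b n0 where b: "b > 0" and
    n0: "\<And>n. n0 \<le> n \<Longrightarrow> gamma_cdf \<alpha> (\<kappa>' * ln (real n)) \<le> exp (- b * (ln (real (Suc n)) - ln (real n)))"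
    using gamma_cdf_ln_le[OF alpha_pos \<kappa>'] unfolding eventually_sequentially by blast
  \<comment> \<open>The indices run backwards because \<open>prob_all_le\<close> takes them in
    decreasing order.\<close>
  define C where "C N L = {\<omega> \<in> space M. \<forall>k\<le>L. Y (J (N + L - k)) \<omega> \<le> \<kappa> * s (J (N + L - k)) * ln (real (N + L - k))}" for N L
  have Cle: "prob (C N L) \<le> exp (- b * (ln (real (N + L + 1)) - ln (real N)))" if N: "n0 \<le> N" "1 \<le> N" for N L
  proof -
    define x where "x k = (if k \<le> L then s (J (N + L - k)) else 0)" for k
    have "prob (C N L) \<le> (\<Prod>k\<le>L. gamma_cdf \<alpha> (gap_rate x k * (\<kappa> * s (J (N + L - k)) * ln (real (N + L - k)))))"
      unfolding C_def x_def
    proof (rule prob_all_le)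
      show "J (N + L - Suc k) < J (N + L - k)" if "k < L" for k
        using JSuc[of "N + L - Suc k"] that by (simp add: Suc_diff_Suc)
    qed (use J in simp)
    also have "\<dots> \<le> (\<Prod>k\<le>L. exp (- b * (ln (real (Suc (N + L - k))) - ln (real (N + L - k)))))"
    proof (rule prod_mono, intro conjI)
      fix k assume "k \<in> {..L}"
      then have k: "k \<le> L" by simp
      define m where "m = N + L - k"
      have m: "n0 \<le> m" "1 \<le> m" using k N by (auto simp: m_def)
      let ?S = "s (J m)"
      have r1: "1 / (x k - x (Suc k)) \<le> Q / (Q - 1) / ?S"
      proof -
        \<comment> \<open>At k = L the lower neighbour is the added value 0, which satisfies the
          same bound.\<close>
        have "x (Suc k) \<le> ?S / Q"
        proof (cases "k = L")
          case False
          then have "m = Suc (N + L - Suc k)" using k by (simp add: m_def)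
          then have "Q * x (Suc k) \<le> ?S" using J(2)[of "N + L - Suc k"] False k by (simp add: x_def)
          then show ?thesis using Q by (simp add: field_simps)
        qed (use sJ[of m] Q in \<open>simp add: x_def\<close>)
        moreover have "x k = ?S" using k by (simp add: x_def m_def)
        moreover have "?S - ?S / Q = ?S * ((Q - 1) / Q)" using Q by (simp add: field_simps)
        ultimately have "?S * ((Q - 1) / Q) \<le> x k - x (Suc k)" by linarith
        moreover have "0 < ?S * ((Q - 1) / Q)" using sJ[of m] Q by simp
        ultimately have "1 / (x k - x (Suc k)) \<le> 1 / (?S * ((Q - 1) / Q))"
          by (intro frac_le) auto
        then show ?thesis by (simp add: mult.commute)
      qed
      have r2: "1 / (x (k - 1) - x k) \<le> 1 / (Q - 1) / ?S" if "k \<noteq> 0"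
      proof -
        have "N + L - (k - 1) = Suc m" using that k by (simp add: m_def)
        then have "x (k - 1) = s (J (Suc m))" using k by (simp add: x_def)
        moreover have "x k = ?S" using k by (simp add: x_def m_def)
        ultimately have "(Q - 1) * ?S \<le> x (k - 1) - x k" using J(2)[of m] by (simp add: algebra_simps)
        moreover have "0 < (Q - 1) * ?S" using sJ[of m] Q by simp
        ultimately have "1 / (x (k - 1) - x k) \<le> 1 / ((Q - 1) * ?S)"
          by (intro frac_le) auto
        then show ?thesis by simp
      qed
      have "gap_rate x k \<le> Q / (Q - 1) / ?S + 1 / (Q - 1) / ?S"
        unfolding gap_rate_def using r1 r2 Q sJ[of m] by (intro add_mono) auto
      also have "\<dots> = (Q + 1) / (Q - 1) / ?S" by (simp add: add_divide_distrib)
      finally have "gap_rate x k * (\<kappa> * ?S * ln (real m)) \<le> (Q + 1) / (Q - 1) / ?S * (\<kappa> * ?S * ln (real m))"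
        using \<kappa> sJ[of m] m by (intro mult_right_mono) auto
      also have "\<dots> = \<kappa>' * ln (real m)" using sJ[of m] by (simp add: \<kappa>'_def)
      finally have "gamma_cdf \<alpha> (gap_rate x k * (\<kappa> * ?S * ln (real m))) \<le> gamma_cdf \<alpha> (\<kappa>' * ln (real m))"
        by (intro gamma_cdf_mono alpha_pos)
      also have "\<dots> \<le> exp (- b * (ln (real (Suc m)) - ln (real m)))" by (rule n0) (rule m)
      finally show "gamma_cdf \<alpha> (gap_rate x k * (\<kappa> * s (J (N + L - k)) * ln (real (N + L - k)))) \<le> exp (- b * (ln (real (Suc (N + L - k))) - ln (real (N + L - k))))"
        by (simp add: m_def)
    qed (use gamma_cdf_bounds[OF alpha_pos] in auto)
    also have "\<dots> = exp (\<Sum>k\<le>L. - b * (ln (real (Suc (N + L - k))) - ln (real (N + L - k))))"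
      by (simp add: exp_sum)
    also have "(\<Sum>k\<le>L. - b * (ln (real (Suc (N + L - k))) - ln (real (N + L - k)))) = - b * (ln (real (N + L + 1)) - ln (real N))"
    proof -
      have "(\<Sum>k\<le>L. ln (real (Suc (N + L - k))) - ln (real (N + L - k))) = ln (real (N + L + 1)) - ln (real N)"
      proof (induction L)
        case (Suc L)
        have "(\<Sum>k\<le>Suc L. ln (real (Suc (N + Suc L - k))) - ln (real (N + Suc L - k))) =
           (ln (real (Suc (N + Suc L))) - ln (real (N + Suc L))) + (\<Sum>k\<le>L. ln (real (Suc (N + L - k))) - ln (real (N + L - k)))"
          by (subst sum.atMost_Suc_shift) simp
        then show ?case using Suc by simp
      qed simp
      then show ?thesis by (simp only: sum_distrib_left[symmetric])
    qed
    finally show ?thesis .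
  qed
  have meas: "{\<omega> \<in> space M. Y (J n) \<omega> \<le> c} \<in> events" for n c
    using Y_measurable[OF J(1)[of n]] by measurable
  have "AE \<omega> in M. \<not> (\<forall>n\<ge>N. Y (J n) \<omega> \<le> \<kappa> * s (J n) * ln (real n))" if N: "n0 \<le> N" "1 \<le> N" for N
  proof -
    let ?B = "{\<omega> \<in> space M. \<forall>n\<in>{N..}. Y (J n) \<omega> \<le> \<kappa> * s (J n) * ln (real n)}"
    have B: "?B \<in> events" by (rule sets.sets_Collect_countable_All'[OF meas]) auto
    have CE: "C N L \<in> events" for L
    proof -
      have "C N L = {\<omega> \<in> space M. \<forall>k\<in>{..L}. Y (J (N + L - k)) \<omega> \<le> \<kappa> * s (J (N + L - k)) * ln (real (N + L - k))}"
        by (simp only: C_def Ball_def atMost_iff)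
      moreover have "\<dots> \<in> events" by (rule sets.sets_Collect_countable_All'[OF meas]) auto
      ultimately show ?thesis by simp
    qed
    have "prob ?B \<le> exp (- b * (ln (real (N + L + 1)) - ln (real N)))" for L
    proof -
      have "?B \<subseteq> C N L" by (auto simp: C_def simp del: of_nat_diff)
      then have "prob ?B \<le> prob (C N L)" using CE by (intro finite_measure_mono) auto
      then show ?thesis using Cle[OF N, of L] by simp
    qed
    moreover have "(\<lambda>L. exp (- b * (ln (real (N + L + 1)) - ln (real N)))) \<longlonglongrightarrow> 0"
      using b by real_asymp
    ultimately have "prob ?B \<le> 0" by (intro LIMSEQ_le_const) auto
    then have "prob ?B = 0" by (simp add: measure_le_0_iff)
    then have "AE \<omega> in M. \<omega> \<notin> ?B" using B by (simp add: prob_eq_0)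
    then show ?thesis using AE_space by eventually_elim auto
  qed
  then have "AE \<omega> in M. \<forall>N. n0 \<le> N \<longrightarrow> 1 \<le> N \<longrightarrow> \<not> (\<forall>n\<ge>N. Y (J n) \<omega> \<le> \<kappa> * s (J n) * ln (real n))"
    by (simp add: AE_all_countable)
  then show ?thesis
  proof eventually_elim
    case (elim \<omega>)
    show ?case unfolding frequently_sequentially
    proof
      fix N
      show "\<exists>n\<ge>N. \<kappa> * s (J n) * ln (real n) < Y (J n) \<omega>"
      proof -
        have "n0 \<le> Suc (max N n0)" "1 \<le> Suc (max N n0)" by auto
        then obtain n where "Suc (max N n0) \<le> n" "\<not> Y (J n) \<omega> \<le> \<kappa> * s (J n) * ln (real n)"
          using elim by blast
        then show ?thesis by (intro exI[of _ n]) auto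
      qed
    qed
  qed
qed

end

section \<open>Upper bounds\<close>

text \<open>Here (2 * q)! is at most (4 * L) ^ (2 * q), and 25600 = 100 * 16 * 16 collects the bases
  from the maximal inequality, from the increments and from (4 * L)^2. The choice of \<eta> leaves
  exp (- 2) ^ q, which is at most exp (- 2 * L) since q \<ge> L.\<close>

lemma block_arith:
  fixes L \<xi> \<eta> H B \<Delta> C :: real
  assumes L: "1 \<le> L" and q: "q = nat \<lceil>L\<rceil>" and pos: "0 < \<xi>" "0 < B" "0 \<le> \<eta>" "0 \<le> C"
    and \<Delta>: "0 \<le> \<Delta>" "\<Delta> \<le> \<eta> * B" and \<eta>: "25600 * H\<^sup>2 * \<eta> \<le> \<xi>\<^sup>2 * exp (- 2)"
  shows "1 / 5 * 100 ^ q * (C * fact (2 * q) * (16 * H\<^sup>2 * B) ^ q) * \<Delta> ^ q \<le>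
    1 / 5 * C * exp (- 2 * L) * (\<xi> * B * L) ^ (2 * q)"
proof -
  have qL: "L \<le> real q" "real q \<le> 2 * L" unfolding q using L by linarith+
  have "(fact (2 * q) :: real) \<le> real (2 * q) ^ (2 * q)"
    using fact_le_power[of "2 * q"] by simp
  also have "\<dots> \<le> (4 * L) ^ (2 * q)" using qL by (intro power_mono) auto
  also have "\<dots> = (16 * L\<^sup>2) ^ q" by (simp add: power_mult power_mult_distrib)
  finally have fct: "(fact (2 * q) :: real) \<le> (16 * L\<^sup>2) ^ q" .
  have "1 / 5 * 100 ^ q * (C * fact (2 * q) * (16 * H\<^sup>2 * B) ^ q) * \<Delta> ^ q \<le>
      1 / 5 * 100 ^ q * (C * (16 * L\<^sup>2) ^ q * (16 * H\<^sup>2 * B) ^ q) * (\<eta> * B) ^ q"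
    using fct pos \<Delta> by (intro mult_mono mult_left_mono mult_right_mono power_mono) auto
  also have "\<dots> = 1 / 5 * C * ((25600 * H\<^sup>2 * \<eta>) * (B * L)\<^sup>2) ^ q"
    by (simp add: power_mult_distrib[symmetric] power2_eq_square mult_ac)
  also have "\<dots> \<le> 1 / 5 * C * ((\<xi>\<^sup>2 * exp (- 2)) * (B * L)\<^sup>2) ^ q"
    using pos \<eta> by (intro mult_left_mono power_mono mult_right_mono) auto
  also have "\<dots> = 1 / 5 * C * exp (- 2) ^ q * (\<xi> * B * L) ^ (2 * q)"
  proof -
    have "(\<xi> * B * L) ^ (2 * q) = ((\<xi> * B * L)\<^sup>2) ^ q" by (rule power_mult)
    moreover have "(\<xi>\<^sup>2 * exp (- 2)) * (B * L)\<^sup>2 = exp (- 2) * (\<xi> * B * L)\<^sup>2" by (simp add: power_mult_distrib)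
    ultimately show ?thesis by (simp only: power_mult_distrib[of "exp (- 2)"] mult.assoc)
  qed
  also have "\<dots> \<le> 1 / 5 * C * exp (- 2 * L) * (\<xi> * B * L) ^ (2 * q)"
    using qL pos L by (intro mult_right_mono mult_left_mono) (auto simp: exp_of_nat_mult[symmetric])
  finally show ?thesis .
qed

section \<open>Almost sure upper bounds, block by block and index by index\<close>

context excessive_permanental
begin

lemma s_le_iff: "1 \<le> i \<Longrightarrow> 1 \<le> j \<Longrightarrow> s i \<le> s j \<longleftrightarrow> i \<le> j"
  using s_mono[of i j] s_mono[of j i] by (cases i j rule: linorder_cases) auto

lemma tail1_power:
  assumes j: "1 \<le> j" and \<zeta>: "0 < \<zeta>" "\<zeta> < 1" "(1 + \<zeta>) * (1 + \<zeta>) \<le> (1 - \<zeta>) * (1 + \<xi>)"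
    and K: "s j + f j \<le> (1 + \<zeta>) * B" and n: "1 \<le> n"
  shows "prob {\<omega> \<in> space M. (1 + \<xi>) * B * ln (real n) < Y j \<omega>} \<le> \<zeta> powr (- \<alpha>) * real n powr (- (1 + \<zeta>))"
proof -
  have K0: "0 < s j + f j" using s_pos[OF j] f_nonneg[OF j] by simp
  have "0 < (1 + \<zeta>) * B" using K0 K by linarith
  then have B0: "0 < B" using \<zeta> by (simp add: zero_less_mult_iff)
  have ln0: "0 \<le> ln (real n)" using n by simp
  have "(1 + \<zeta>) * (s j + f j) \<le> (1 + \<zeta>) * ((1 + \<zeta>) * B)" using K \<zeta> by (intro mult_left_mono) auto
  also have "\<dots> \<le> (1 - \<zeta>) * (1 + \<xi>) * B" using \<zeta>(3) B0 by (simp add: mult.assoc[symmetric] mult_right_mono)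
  finally have "(1 + \<zeta>) \<le> (1 - \<zeta>) * (1 + \<xi>) * B / (s j + f j)" using K0 by (simp add: pos_le_divide_eq)
  then have "(1 + \<zeta>) * ln (real n) \<le> (1 - \<zeta>) * (1 + \<xi>) * B / (s j + f j) * ln (real n)"
    using ln0 by (intro mult_right_mono)
  also have "\<dots> = (1 - \<zeta>) / (s j + f j) * ((1 + \<xi>) * B * ln (real n))" by simp
  finally have e: "- ((1 - \<zeta>) / (s j + f j)) * ((1 + \<xi>) * B * ln (real n)) \<le> - (1 + \<zeta>) * ln (real n)"
    by (simp only: mult_minus_left neg_le_iff_le)
  have "prob {\<omega> \<in> space M. (1 + \<xi>) * B * ln (real n) < Y j \<omega>} \<le> \<zeta> powr (- \<alpha>) * exp (- ((1 - \<zeta>) / (s j + f j)) * ((1 + \<xi>) * B * ln (real n)))"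
    by (rule tail1[OF j \<zeta>(1,2)])
  also have "\<dots> \<le> \<zeta> powr (- \<alpha>) * exp (- (1 + \<zeta>) * ln (real n))"
    using e by (intro mult_left_mono) auto
  also have "exp (- (1 + \<zeta>) * ln (real n)) = real n powr (- (1 + \<zeta>))" using n by (simp add: powr_def)
  finally show ?thesis .
qed

text \<open>Markov's inequality for the supremum, with a moment of order 2 * q that grows with the
  level: q is L rounded up. For L = ln n the bound is of order 1 / n^2, hence summable.\<close>

lemma oscillation_tail:
  assumes m: "1 \<le> m" "m \<le> N" and B: "0 < B" "B \<le> s m" "s N \<le> (1 + \<eta>) * B" and \<eta>: "0 \<le> \<eta>" "\<eta> \<le> 1"
    "25600 * (1 + f 1 / s 1)\<^sup>2 * \<eta> \<le> \<xi>\<^sup>2 * exp (- 2)" and \<xi>: "0 < \<xi>" and L: "3 \<le> L"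
  shows "{\<omega> \<in> space M. \<exists>j\<in>{m..N}. \<xi> * B * L < Y j \<omega> - Y m \<omega>} \<in> events"
    and "prob {\<omega> \<in> space M. \<exists>j\<in>{m..N}. \<xi> * B * L < Y j \<omega> - Y m \<omega>} \<le> 1 / 5 * (2 * 2 powr \<alpha>) * exp (- 2 * L)"
proof -
  define H where "H = 1 + f 1 / s 1"
  define q where "q = nat \<lceil>L\<rceil>"
  have q3: "3 \<le> q" using L unfolding q_def by linarith
  let ?F = "{\<omega> \<in> space M. \<exists>j\<in>{m..N}. \<xi> * B * L < Y j \<omega> - Y m \<omega>}"
  show F: "?F \<in> events"
  proof (rule sets.sets_Collect_countable_Ex')
    fix j assume "j \<in> {m..N}"
    then have [measurable]: "Y j \<in> borel_measurable M" "Y m \<in> borel_measurable M"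
      using m by (auto intro!: Y_measurable)
    show "{\<omega> \<in> space M. \<xi> * B * L < Y j \<omega> - Y m \<omega>} \<in> events" by measurable
  qed (rule countable_finite, simp)
  define C where "C = 2 * 2 powr \<alpha>"
  define c where "c = C * fact (2 * q) * (16 * H\<^sup>2 * B) ^ q"
  have c0: "0 \<le> c" using B by (auto simp: c_def C_def)
  define V where "V = (\<xi> * B * L) ^ (2 * q)"
  have V: "0 < V" using \<xi> B L by (simp add: V_def)
  have sub: "s N \<le> 2 * B"
  proof -
    have "(1 + \<eta>) * B \<le> 2 * B" using \<eta> B by (intro mult_right_mono) auto
    then show ?thesis using B(3) by linarith
  qed
  have "ennreal V * emeasure M ?F = (\<integral>\<^sup>+\<omega>. ennreal V * indicator ?F \<omega> \<partial>M)"
    using F by (simp add: nn_integral_cmult_indicator)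
  also have "\<dots> \<le> (\<integral>\<^sup>+\<omega>. (SUP i\<in>{m..N}. ennreal ((Y i \<omega> - Y m \<omega>) ^ (2 * q))) \<partial>M)"
  proof (rule nn_integral_mono)
    fix \<omega>
    show "ennreal V * indicator ?F \<omega> \<le> (SUP i\<in>{m..N}. ennreal ((Y i \<omega> - Y m \<omega>) ^ (2 * q)))"
    proof (cases "\<omega> \<in> ?F")
      case True
      then obtain j where j: "j \<in> {m..N}" "\<xi> * B * L < Y j \<omega> - Y m \<omega>" by auto
      have "V \<le> (Y j \<omega> - Y m \<omega>) ^ (2 * q)" unfolding V_def using j(2) \<xi> B L by (intro power_mono) auto
      then have "ennreal V \<le> ennreal ((Y j \<omega> - Y m \<omega>) ^ (2 * q))" by (rule ennreal_leI)
      also have "\<dots> \<le> (SUP i\<in>{m..N}. ennreal ((Y i \<omega> - Y m \<omega>) ^ (2 * q)))" using j(1) by (rule SUP_upper)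
      finally show ?thesis using True by simp
    qed simp
  qed
  also have "\<dots> \<le> ennreal (1 / 5 * 100 ^ q * c * (s N - s m) ^ q)"
  proof (rule maximal_moment)
    show "Y i \<in> borel_measurable M" if "m \<le> i" for i using m that by (intro Y_measurable) auto
    show "s i \<le> s j" if "m \<le> i" "i \<le> j" for i j using s_le_iff[of i j] m that by auto
    show "(\<integral>\<^sup>+\<omega>. ennreal ((Y j \<omega> - Y i \<omega>) ^ (2 * q)) \<partial>M) \<le> ennreal (c * (s j - s i) ^ q)"
      if "m \<le> i" "i \<le> j" "j \<le> N" for i j
      unfolding c_def C_def H_def
      using that m B sub s_le_iff[of m i] s_le_iff[of j N] by (intro increment_moment) auto
  qed (use q3 c0 m in auto)
  also have "\<dots> \<le> ennreal (1 / 5 * C * exp (- 2 * L) * V)"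
    unfolding c_def V_def
  proof (rule ennreal_leI, rule block_arith[where \<eta> = \<eta>])
    show "0 \<le> s N - s m" using s_le_iff[of m N] m by auto
    show "s N - s m \<le> \<eta> * B" using B by (simp add: algebra_simps)
  qed (use L \<xi> B \<eta> in \<open>auto simp: q_def C_def H_def\<close>)
  finally have "ennreal (V * prob ?F) \<le> ennreal (1 / 5 * C * exp (- 2 * L) * V)"
    using V by (simp add: emeasure_eq_measure ennreal_mult'[symmetric])
  then have "V * prob ?F \<le> V * (1 / 5 * C * exp (- 2 * L))"
    by (subst (asm) ennreal_le_iff) (use V in \<open>auto simp: C_def mult.commute\<close>)
  then show "prob ?F \<le> 1 / 5 * (2 * 2 powr \<alpha>) * exp (- 2 * L)"
    using V by (simp only: C_def mult_le_cancel_left_pos)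
qed

text \<open>A block can contain arbitrarily many indices, so a union bound over it is of no use.
  Only its first index m gets the Chernoff bound; the other variables exceed Y m by at most \<xi> *
  \<theta> ^ n * ln n outside an event of summable probability.\<close>

lemma eventually_block_le:
  assumes s_top: "filterlim s at_top sequentially" and f_ratio: "(\<lambda>j. f j / s j) \<longlonglongrightarrow> 0" and \<xi>: "0 < \<xi>"
  shows "\<exists>\<theta>>1. \<theta> \<le> 1 + \<xi> \<and> (AE \<omega> in M. eventually (\<lambda>n. \<forall>j\<ge>1. \<theta> ^ n \<le> s j \<longrightarrow> s j < \<theta> ^ Suc n \<longrightarrow>
    Y j \<omega> \<le> ((1 + \<xi>) * \<theta> + \<xi>) * \<theta> ^ n * ln (real n)) sequentially)"
proof -
  define H where "H = 1 + f 1 / s 1"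
  have H: "1 \<le> H" using f_nonneg[of 1] s_pos[of 1] by (simp add: H_def)
  define \<eta> where "\<eta> = min (min \<xi> 1) (\<xi>\<^sup>2 * exp (- 2) / (25600 * H\<^sup>2))"
  have \<eta>: "0 < \<eta>" "\<eta> \<le> \<xi>" "\<eta> \<le> 1" using \<xi> H by (auto simp: \<eta>_def)
  have "\<eta> \<le> \<xi>\<^sup>2 * exp (- 2) / (25600 * H\<^sup>2)" by (simp add: \<eta>_def)
  then have \<eta>H: "25600 * H\<^sup>2 * \<eta> \<le> \<xi>\<^sup>2 * exp (- 2)" using H by (simp add: pos_le_divide_eq mult.commute)
  define \<theta> where "\<theta> = 1 + \<eta>"
  have \<theta>: "1 < \<theta>" using \<eta> by (simp add: \<theta>_def)
  obtain \<zeta> where \<zeta>: "0 < \<zeta>" "\<zeta> < 1" "(1 + \<zeta>) * (1 + \<zeta>) \<le> (1 - \<zeta>) * (1 + \<xi>)"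
    using chernoff_exponent[OF \<xi>] by blast
  define blk where "blk n = {j. 1 \<le> j \<and> \<theta> ^ n \<le> s j \<and> s j < \<theta> ^ Suc n}" for n
  define E where "E n = {\<omega> \<in> space M. \<exists>j\<in>blk n. ((1 + \<xi>) * \<theta> + \<xi>) * \<theta> ^ n * ln (real n) < Y j \<omega>}" for n
  have E: "E n \<in> events" for n
    unfolding E_def
  proof (rule sets.sets_Collect_countable_Ex')
    fix j assume "j \<in> blk n"
    then have [measurable]: "Y j \<in> borel_measurable M" by (auto simp: blk_def intro!: Y_measurable)
    show "{\<omega> \<in> space M. ((1 + \<xi>) * \<theta> + \<xi>) * \<theta> ^ n * ln (real n) < Y j \<omega>} \<in> events" by measurable
  qed auto
  have fin: "finite (blk n)" for n
  proof -
    obtain N where "\<And>j. N \<le> j \<Longrightarrow> \<theta> ^ Suc n \<le> s j"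
      using s_top unfolding filterlim_at_top eventually_sequentially by blast
    then have "blk n \<subseteq> {..<N}" by (force simp: blk_def not_le[symmetric])
    then show ?thesis by (rule finite_subset) simp
  qed
  have "eventually (\<lambda>j. f j / s j < \<zeta>) sequentially"
    using f_ratio \<zeta>(1) by (rule order_tendstoD(2))
  then obtain j0 where j0: "\<And>j. j0 \<le> j \<Longrightarrow> f j / s j < \<zeta>" unfolding eventually_sequentially by blast
  define g where "g n = \<zeta> powr (- \<alpha>) * real n powr (- (1 + \<zeta>)) + 1 / 5 * (2 * 2 powr \<alpha>) * real n powr (- 2)" for n
  have "filterlim (\<lambda>n. \<theta> ^ n) at_top sequentially" using \<theta> by real_asymp
  \<comment> \<open>Beyond this n every block lies past j0, where f is at most \<zeta> * s. The next
    condition is L \<ge> 3 in \<open>oscillation_tail\<close>.\<close>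
  then have "eventually (\<lambda>n. s (Suc j0) < \<theta> ^ n) sequentially" by (simp add: filterlim_at_top_dense)
  moreover have "eventually (\<lambda>n. 3 \<le> ln (real n)) sequentially" by real_asymp
  moreover have "eventually (\<lambda>n::nat. 1 \<le> n) sequentially" by (rule eventually_ge_at_top)
  ultimately have le: "eventually (\<lambda>n. prob (E n) \<le> g n) sequentially"
  proof eventually_elim
    case (elim n)
    show ?case
    proof (cases "blk n = {}")
      case True
      then have "E n = {}" by (simp add: E_def)
      then show ?thesis by (simp add: g_def)
    next
      case False
      define m where "m = Min (blk n)"
      define N where "N = Max (blk n)"
      have mN: "m \<in> blk n" "N \<in> blk n" "m \<le> N" using False fin[of n] by (auto simp: m_def N_def)
      have bnd: "m \<le> j" "j \<le> N" if "j \<in> blk n" for j using that fin[of n] by (auto simp: m_def N_def)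
      have m1: "1 \<le> m" "\<theta> ^ n \<le> s m" "s m < \<theta> ^ Suc n" using mN by (auto simp: blk_def)
      have N1: "s N < \<theta> ^ Suc n" using mN by (auto simp: blk_def)
      have B: "0 < \<theta> ^ n" using \<theta> by simp
      have "s (Suc j0) \<le> s m" using elim(1) m1 by simp
      then have "j0 \<le> m" using s_le_iff[of "Suc j0" m] m1 by simp
      then have "f m \<le> \<zeta> * s m" using j0[of m] s_pos[OF m1(1)] by (simp add: field_simps)
      then have "s m + f m \<le> (1 + \<zeta>) * s m" by (simp add: algebra_simps)
      also have "\<dots> \<le> (1 + \<zeta>) * (\<theta> * \<theta> ^ n)" using m1 \<zeta> by (intro mult_left_mono) auto
      finally have K: "s m + f m \<le> (1 + \<zeta>) * (\<theta> * \<theta> ^ n)" .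
      define F1 where "F1 = {\<omega> \<in> space M. (1 + \<xi>) * (\<theta> * \<theta> ^ n) * ln (real n) < Y m \<omega>}"
      define F2 where "F2 = {\<omega> \<in> space M. \<exists>j\<in>{m..N}. \<xi> * \<theta> ^ n * ln (real n) < Y j \<omega> - Y m \<omega>}"
      have F1: "F1 \<in> events" unfolding F1_def using Y_measurable[OF m1(1)] by measurable
      have p1: "prob F1 \<le> \<zeta> powr (- \<alpha>) * real n powr (- (1 + \<zeta>))"
        unfolding F1_def by (rule tail1_power[OF m1(1) \<zeta> K elim(3)])
      have sN: "s N \<le> (1 + \<eta>) * \<theta> ^ n" using N1 by (simp add: \<theta>_def)
      have F2: "F2 \<in> events" and p2: "prob F2 \<le> 1 / 5 * (2 * 2 powr \<alpha>) * exp (- 2 * ln (real n))"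
        unfolding F2_def
        by (rule oscillation_tail[OF m1(1) mN(3) B m1(2) sN less_imp_le[OF \<eta>(1)] \<eta>(3) \<eta>H[unfolded H_def] \<xi> elim(2)])+
      have "E n \<subseteq> F1 \<union> F2"
      proof
        fix \<omega> assume "\<omega> \<in> E n"
        then obtain j where j: "j \<in> blk n" "((1 + \<xi>) * \<theta> + \<xi>) * \<theta> ^ n * ln (real n) < Y j \<omega>" and \<omega>: "\<omega> \<in> space M"
          by (auto simp: E_def)
        have "(1 + \<xi>) * (\<theta> * \<theta> ^ n) * ln (real n) + \<xi> * \<theta> ^ n * ln (real n) < Y m \<omega> + (Y j \<omega> - Y m \<omega>)"
          using j(2) by (simp add: algebra_simps)
        then have "(1 + \<xi>) * (\<theta> * \<theta> ^ n) * ln (real n) < Y m \<omega> \<or> \<xi> * \<theta> ^ n * ln (real n) < Y j \<omega> - Y m \<omega>"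
          by linarith
        then show "\<omega> \<in> F1 \<union> F2" using bnd[OF j(1)] \<omega> by (auto simp: F1_def F2_def)
      qed
      then have "prob (E n) \<le> prob (F1 \<union> F2)" using F1 F2 by (intro finite_measure_mono) auto
      also have "\<dots> \<le> prob F1 + prob F2" using F1 F2 by (rule measure_Un_le)
      also have "\<dots> \<le> g n"
      proof -
        have "exp (- 2 * ln (real n)) = real n powr (- 2)" using elim(3) by (simp add: powr_def)
        then show ?thesis using p1 p2 unfolding g_def by simp
      qed
      finally show ?thesis .
    qed
  qed
  have "summable g"
    unfolding g_def using \<zeta> by (intro summable_add summable_mult) (auto simp: summable_real_powr_iff)
  from borel_cantelli_bound[OF E le this]
  have "AE \<omega> in M. eventually (\<lambda>n. \<forall>j\<ge>1. \<theta> ^ n \<le> s j \<longrightarrow> s j < \<theta> ^ Suc n \<longrightarrow>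
    Y j \<omega> \<le> ((1 + \<xi>) * \<theta> + \<xi>) * \<theta> ^ n * ln (real n)) sequentially"
    using AE_space
  proof eventually_elim
    case (elim \<omega>)
    from elim(1) show ?case
      by eventually_elim (use elim(2) in \<open>auto simp: E_def blk_def not_less\<close>)
  qed
  then show ?thesis using \<theta> \<eta>(2) by (intro exI[of _ \<theta>]) (auto simp: \<theta>_def)
qed

text \<open>If \<theta> ^ n \<le> s j, then n \<le> ln (s j) / ln \<theta>, and division by the
  constant ln \<theta> costs only a factor 1 + \<xi> after taking one more logarithm.\<close>

lemma eventually_le_loglog:
  assumes s_top: "filterlim s at_top sequentially" and f_ratio: "(\<lambda>j. f j / s j) \<longlonglongrightarrow> 0" and \<epsilon>: "0 < \<epsilon>"
  shows "AE \<omega> in M. eventually (\<lambda>j. Y j \<omega> \<le> (1 + \<epsilon>) * (s j * ln (ln (s j)))) sequentially"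
proof -
  \<comment> \<open>The constant of the block bound with \<theta> replaced by 1 + \<xi>, times the
    factor lost between ln n and ln (ln (s j)).\<close>
  have "((\<lambda>\<xi>. ((1 + \<xi>) * (1 + \<xi>) + \<xi>) * (1 + \<xi>)) \<longlongrightarrow> ((1 + 0) * (1 + 0) + 0) * (1 + 0)) (at_right (0::real))"
    by (intro tendsto_intros)
  then have "eventually (\<lambda>\<xi>. ((1 + \<xi>) * (1 + \<xi>) + \<xi>) * (1 + \<xi>) < 1 + \<epsilon>) (at_right (0::real))"
    using \<epsilon> by (intro order_tendstoD(2)) auto
  moreover have "eventually (\<lambda>\<xi>::real. \<xi> \<in> {0<..<1}) (at_right 0)"
    by (rule eventually_at_right_real) simp
  ultimately have "eventually (\<lambda>\<xi>::real. 0 < \<xi> \<and> ((1 + \<xi>) * (1 + \<xi>) + \<xi>) * (1 + \<xi>) < 1 + \<epsilon>) (at_right 0)"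
    by eventually_elim auto
  then obtain \<xi> where \<xi>: "0 < \<xi>" "((1 + \<xi>) * (1 + \<xi>) + \<xi>) * (1 + \<xi>) < 1 + \<epsilon>"
    using eventually_happens'[OF trivial_limit_at_right_real[of "0::real"]] by blast
  obtain \<theta> where \<theta>: "1 < \<theta>" "\<theta> \<le> 1 + \<xi>" and AE: "AE \<omega> in M. eventually (\<lambda>n. \<forall>j\<ge>1. \<theta> ^ n \<le> s j \<longrightarrow> s j < \<theta> ^ Suc n \<longrightarrow>
    Y j \<omega> \<le> ((1 + \<xi>) * \<theta> + \<xi>) * \<theta> ^ n * ln (real n)) sequentially"
    using eventually_block_le[OF s_top f_ratio \<xi>(1)] by blast
  have ln\<theta>: "0 < ln \<theta>" using \<theta> by simp
  define c where "c = ln \<theta>"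
  have c: "0 < c" using ln\<theta> by (simp add: c_def)
  have "eventually (\<lambda>x::real. ln (x / c) \<le> (1 + \<xi>) * ln x) at_top" using c \<xi>(1) by real_asymp
  moreover have "filterlim (\<lambda>j. ln (s j)) at_top sequentially"
    by (rule filterlim_compose[OF ln_at_top s_top])
  ultimately have ev1: "eventually (\<lambda>j. ln (ln (s j) / c) \<le> (1 + \<xi>) * ln (ln (s j))) sequentially"
    by (rule eventually_compose_filterlim)
  from AE show ?thesis
  proof eventually_elim
    case (elim \<omega>)
    then obtain n1 where n1: "\<And>n j. n1 \<le> n \<Longrightarrow> 1 \<le> j \<Longrightarrow> \<theta> ^ n \<le> s j \<Longrightarrow> s j < \<theta> ^ Suc n \<Longrightarrow>
      Y j \<omega> \<le> ((1 + \<xi>) * \<theta> + \<xi>) * \<theta> ^ n * ln (real n)" unfolding eventually_sequentially by blast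
    have "eventually (\<lambda>j. \<theta> ^ Suc n1 \<le> s j) sequentially" using s_top by (simp add: filterlim_at_top)
    moreover have "eventually (\<lambda>j. exp 1 \<le> s j) sequentially" using s_top by (simp add: filterlim_at_top)
    moreover have "eventually (\<lambda>j::nat. 1 \<le> j) sequentially" by (rule eventually_ge_at_top)
    ultimately show ?case using ev1
    proof eventually_elim
      case (elim j)
      define P where "P n \<longleftrightarrow> s j < \<theta> ^ Suc n" for n
      obtain n' where "s j < \<theta> ^ n'" using real_arch_pow[OF \<theta>(1)] by blast
      moreover have "\<theta> ^ n' \<le> \<theta> ^ Suc n'" using \<theta> by (intro power_increasing) auto
      ultimately have "P n'" by (auto simp: P_def)
      \<comment> \<open>The number of the block that contains s j. Minimality gives \<theta> ^ n
        \<le> s j, once n > 0 is known.\<close>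
      define n where "n = (LEAST n. P n)"
      have Pn: "P n" unfolding n_def using \<open>P n'\<close> by (rule LeastI)
      have n1n: "Suc n1 \<le> n"
      proof (rule ccontr)
        assume "\<not> Suc n1 \<le> n"
        then have "\<theta> ^ Suc n \<le> \<theta> ^ Suc n1" using \<theta> by (intro power_increasing) auto
        then show False using Pn elim(1) by (simp add: P_def)
      qed
      then obtain n2 where n2: "n = Suc n2" by (cases n) auto
      have "\<not> P n2" using not_less_Least[of n2 P] n2 unfolding n_def by simp
      then have lo: "\<theta> ^ n \<le> s j" by (simp add: P_def n2)
      have s1: "1 \<le> s j" using elim(2) by (meson exp_ge_zero order.trans one_le_exp_iff zero_le_one)
      have lnln: "0 \<le> ln (ln (s j))"
      proof -
        have "1 \<le> ln (s j)" using elim(2) s1 by (subst ln_ge_iff) auto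
        then show ?thesis by simp
      qed
      have "real n * c \<le> ln (s j)"
      proof -
        have "ln (\<theta> ^ n) \<le> ln (s j)" using lo \<theta> s1 by (subst ln_le_cancel_iff) auto
        then show ?thesis using \<theta> by (simp add: ln_realpow c_def)
      qed
      then have "real n \<le> ln (s j) / c" using c by (simp add: pos_le_divide_eq)
      then have "ln (real n) \<le> ln (ln (s j) / c)" using n2 by (subst ln_le_cancel_iff) (auto intro: less_le_trans[rotated])
      then have lnn: "ln (real n) \<le> (1 + \<xi>) * ln (ln (s j))" using elim(4) by simp
      have "Y j \<omega> \<le> ((1 + \<xi>) * \<theta> + \<xi>) * \<theta> ^ n * ln (real n)"
        using n1n elim(3) lo Pn by (intro n1) (auto simp: P_def)
      also have "\<dots> \<le> ((1 + \<xi>) * (1 + \<xi>) + \<xi>) * s j * ((1 + \<xi>) * ln (ln (s j)))"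
        using \<theta> \<xi> lo lnn n2 s1 by (intro mult_mono add_mono mult_left_mono) auto
      also have "\<dots> = ((1 + \<xi>) * (1 + \<xi>) + \<xi>) * (1 + \<xi>) * (s j * ln (ln (s j)))" by simp
      also have "\<dots> \<le> (1 + \<epsilon>) * (s j * ln (ln (s j)))"
        using \<xi> lnln s1 by (intro mult_right_mono) auto
      finally show ?case .
    qed
  qed
qed

lemma eventually_le_log:
  assumes f_ratio: "(\<lambda>j. f j / s j) \<longlonglongrightarrow> 0" and \<epsilon>: "0 < \<epsilon>"
  shows "AE \<omega> in M. eventually (\<lambda>j. Y j \<omega> \<le> (1 + \<epsilon>) * (s j * ln (real j))) sequentially"
proof -
  obtain \<zeta> where \<zeta>: "0 < \<zeta>" "\<zeta> < 1" "(1 + \<zeta>) * (1 + \<zeta>) \<le> (1 - \<zeta>) * (1 + \<epsilon>)"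
    using chernoff_exponent[OF \<epsilon>] by blast
  \<comment> \<open>Nothing is assumed about Y 0, not even measurability, so index 0 gets the empty
    event.\<close>
  define A where "A j = (if 1 \<le> j then {\<omega> \<in> space M. (1 + \<epsilon>) * s j * ln (real j) < Y j \<omega>} else {})" for j
  have A: "A j \<in> events" for j
    using Y_measurable[of j] by (cases "1 \<le> j") (auto simp: A_def)
  have "eventually (\<lambda>j. f j / s j < \<zeta>) sequentially" using f_ratio \<zeta>(1) by (rule order_tendstoD(2))
  moreover have "eventually (\<lambda>j::nat. 1 \<le> j) sequentially" by (rule eventually_ge_at_top)
  ultimately have le: "eventually (\<lambda>j. prob (A j) \<le> \<zeta> powr (- \<alpha>) * real j powr (- (1 + \<zeta>))) sequentially"
  proof eventually_elim
    case (elim j)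
    have "s j + f j \<le> (1 + \<zeta>) * s j" using elim s_pos[of j] by (simp add: field_simps)
    then show ?case using tail1_power[OF elim(2) \<zeta>, of "s j" j] elim by (simp add: A_def)
  qed
  have "summable (\<lambda>j. \<zeta> powr (- \<alpha>) * real j powr (- (1 + \<zeta>)))"
    using \<zeta> by (intro summable_mult) (auto simp: summable_real_powr_iff)
  from borel_cantelli_bound[OF A le this] show ?thesis
    using AE_space
  proof eventually_elim
    case (elim \<omega>)
    have "eventually (\<lambda>j::nat. 1 \<le> j) sequentially" by (rule eventually_ge_at_top)
    with elim(1) show ?case
      by eventually_elim (use elim(2) in \<open>auto simp: A_def not_less mult.assoc\<close>)
  qed
qed

end

section \<open>The limsup\<close>

lemma limsup_ereal_eq_1:
  fixes X :: "nat \<Rightarrow> real"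
  assumes "\<And>n. eventually (\<lambda>j. X j \<le> 1 + 1 / real (Suc n)) sequentially"
    and "\<And>n. \<exists>\<^sub>F j in sequentially. 1 - 1 / real (Suc (Suc n)) \<le> X j"
  shows "limsup (\<lambda>j. ereal (X j)) = 1"
proof (rule antisym)
  have "limsup (\<lambda>j. ereal (X j)) \<le> ereal (1 + 1 / real (Suc n))" for n
    using assms(1)[of n] by (intro Limsup_bounded) (auto elim: eventually_mono)
  moreover have "(\<lambda>n. ereal (1 + 1 / real (Suc n))) \<longlonglongrightarrow> ereal 1"
    unfolding lim_ereal by real_asymp
  ultimately show "limsup (\<lambda>j. ereal (X j)) \<le> 1"
    by (auto simp: one_ereal_def intro: LIMSEQ_le_const)
next
  have "ereal (1 - 1 / real (Suc (Suc n))) \<le> limsup (\<lambda>j. ereal (X j))" for n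
  proof (rule ccontr)
    assume "\<not> ?thesis"
    then have "limsup (\<lambda>j. ereal (X j)) < ereal (1 - 1 / real (Suc (Suc n)))" by simp
    then have "eventually (\<lambda>j. ereal (X j) < ereal (1 - 1 / real (Suc (Suc n)))) sequentially"
      by (rule Limsup_lessD)
    then show False using assms(2)[of n]
      by (auto simp: frequently_def not_le elim: eventually_mono)
  qed
  moreover have "(\<lambda>n. ereal (1 - 1 / real (Suc (Suc n)))) \<longlonglongrightarrow> ereal 1"
    unfolding lim_ereal by real_asymp
  ultimately show "1 \<le> limsup (\<lambda>j. ereal (X j))"
    by (auto simp: one_ereal_def intro: LIMSEQ_le_const2)
qed

lemma AE_limsup_eq_1:
  fixes X :: "nat \<Rightarrow> 'a \<Rightarrow> real" and g :: "nat \<Rightarrow> real"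
  assumes g: "eventually (\<lambda>j. 0 < g j) sequentially"
    and up: "\<And>\<epsilon>. 0 < \<epsilon> \<Longrightarrow> AE \<omega> in M. eventually (\<lambda>j. X j \<omega> \<le> (1 + \<epsilon>) * g j) sequentially"
    and lo: "\<And>\<epsilon>. 0 < \<epsilon> \<Longrightarrow> \<epsilon> < 1 \<Longrightarrow> AE \<omega> in M. \<exists>\<^sub>F j in sequentially. (1 - \<epsilon>) * g j \<le> X j \<omega>"
  shows "AE \<omega> in M. limsup (\<lambda>j. ereal (X j \<omega> / g j)) = 1"
proof -
  have "AE \<omega> in M. \<forall>n. eventually (\<lambda>j. X j \<omega> \<le> (1 + 1 / real (Suc n)) * g j) sequentially"
    unfolding AE_all_countable by (intro allI up) simp
  \<comment> \<open>Countably many \<epsilon> suffice; the shift by two keeps \<epsilon> below 1, as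
    \<open>lo\<close> demands.\<close>
  moreover have "AE \<omega> in M. \<forall>n. \<exists>\<^sub>F j in sequentially. (1 - 1 / real (Suc (Suc n))) * g j \<le> X j \<omega>"
    unfolding AE_all_countable by (intro allI lo) auto
  ultimately show ?thesis
  proof eventually_elim
    case (elim \<omega>)
    show ?case
    proof (rule limsup_ereal_eq_1)
      show "eventually (\<lambda>j. X j \<omega> / g j \<le> 1 + 1 / real (Suc n)) sequentially" for n
        using elim(1)[rule_format, of n] g by eventually_elim (simp only: pos_divide_le_eq)
      show "\<exists>\<^sub>F j in sequentially. 1 - 1 / real (Suc (Suc n)) \<le> X j \<omega> / g j" for n
        by (rule frequently_rev_mp[OF elim(2)[rule_format, of n]])
           (use g in \<open>eventually_elim, simp only: pos_le_divide_eq, simp\<close>)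
    qed
  qed
qed

section \<open>The potential Vh as a concave function of s\<close>

lemma min_concave:
  fixes a b c l :: real
  assumes "a \<le> b" "b \<le> c"
  shows "min c l * (b - a) + min a l * (c - b) \<le> min b l * (c - a)"
\<comment> \<open>In each case both minima on the left are bounded by the affine branch on which min
  b l lies: the constant l, or the identity.\<close>
proof (cases "l \<le> b")
  case True
  have "min c l * (b - a) + min a l * (c - b) \<le> l * (b - a) + l * (c - b)"
    using assms by (intro add_mono mult_right_mono) auto
  then show ?thesis using True by (simp add: algebra_simps)
next
  case False
  have "min c l * (b - a) + min a l * (c - b) \<le> c * (b - a) + a * (c - b)"
    using assms by (intro add_mono mult_right_mono) auto
  also have "\<dots> = b * (c - a)" by (simp add: algebra_simps)
  finally show ?thesis using False by simp
qed

lemma summable_min_kernel: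
  assumes h: "h \<in> ell1_plus" and s: "\<And>k. 1 \<le> k \<Longrightarrow> 0 \<le> s k" and x: "0 \<le> x"
  shows "(\<lambda>k. min x (s k) * h k) summable_on {1..}"
proof (rule summable_on_comparison_test)
  show "(\<lambda>k. x * h k) summable_on {1..}"
    using h by (intro summable_on_cmult_right) (simp add: ell1_plus_def)
  show "min x (s k) * h k \<le> x * h k" "0 \<le> min x (s k) * h k" if "k \<in> {1..}" for k
    using h s[of k] x that by (auto simp: ell1_plus_def intro!: mult_right_mono mult_nonneg_nonneg)
qed

text \<open>At \<open>x = s j\<close> this is \<open>f j\<close>; the base point \<open>x = 0\<close> gives the slope of \<open>f\<close> at the origin.\<close>

definition min_potential :: "(nat \<Rightarrow> real) \<Rightarrow> (nat \<Rightarrow> real) \<Rightarrow> real \<Rightarrow> real" where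
  "min_potential s h x = (\<Sum>\<^sub>\<infinity>k\<in>{1..}. min x (s k) * h k)"

lemma min_potential_concave:
  assumes h: "h \<in> ell1_plus" and s: "\<And>k. 1 \<le> k \<Longrightarrow> 0 \<le> s k" and abc: "0 \<le> a" "a < b" "b < c"
  shows "(min_potential s h c - min_potential s h b) / (c - b) \<le> (min_potential s h b - min_potential s h a) / (b - a)"
proof -
  have sm: "(\<lambda>k. min x (s k) * h k * y) summable_on {1..}" if "0 \<le> x" for x y
    by (intro summable_on_cmult_left summable_min_kernel h s that)
  have ca: "0 \<le> c" "0 \<le> a" "0 \<le> b" using abc by auto
  have "min_potential s h c * (b - a) + min_potential s h a * (c - b) =
      (\<Sum>\<^sub>\<infinity>k\<in>{1..}. min c (s k) * h k * (b - a) + min a (s k) * h k * (c - b))"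
    unfolding min_potential_def infsum_add[OF sm[OF ca(1)] sm[OF ca(2)]] by (simp only: infsum_cmult_left')
  also have "\<dots> \<le> (\<Sum>\<^sub>\<infinity>k\<in>{1..}. min b (s k) * h k * (c - a))"
  proof (rule infsum_mono)
    fix k :: nat assume "k \<in> {1..}"
    then have "0 \<le> h k" using h by (simp add: ell1_plus_def)
    then have "(min c (s k) * (b - a) + min a (s k) * (c - b)) * h k \<le> min b (s k) * (c - a) * h k"
      using abc by (intro mult_right_mono min_concave) auto
    then show "min c (s k) * h k * (b - a) + min a (s k) * h k * (c - b) \<le> min b (s k) * h k * (c - a)"
      by (simp add: algebra_simps)
  qed (intro summable_on_add sm ca)+
  also have "\<dots> = min_potential s h b * (c - a)"
    unfolding min_potential_def by (simp add: infsum_cmult_left')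
  finally have "(min_potential s h c - min_potential s h b) * (b - a) \<le> (min_potential s h b - min_potential s h a) * (c - b)"
    by (simp add: algebra_simps)
  then show ?thesis using abc by (simp add: divide_le_eq le_divide_eq mult.commute)
qed

lemma min_potential_mono:
  assumes h: "h \<in> ell1_plus" and s: "\<And>k. 1 \<le> k \<Longrightarrow> 0 \<le> s k" and "0 \<le> a" "a \<le> b"
  shows "min_potential s h a \<le> min_potential s h b"
  unfolding min_potential_def
proof (rule infsum_mono)
  show "min a (s k) * h k \<le> min b (s k) * h k" if "k \<in> {1..}" for k
    using h that assms by (intro mult_right_mono) (auto simp: ell1_plus_def)
  have "0 \<le> b" using assms by linarith
  show "(\<lambda>k. min a (s k) * h k) summable_on {1..}"
    by (rule summable_min_kernel[OF h s \<open>0 \<le> a\<close>])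
  show "(\<lambda>k. min b (s k) * h k) summable_on {1..}"
    by (rule summable_min_kernel[OF h s \<open>0 \<le> b\<close>])
qed

lemma min_potential_0:
  assumes "\<And>k. 1 \<le> k \<Longrightarrow> 0 \<le> s k"
  shows "min_potential s h 0 = 0"
  unfolding min_potential_def using assms by (intro infsum_0) auto

text \<open>A finite set F carries all but \<epsilon> / 2 of the mass of h. On F the minimum is at
  most s k, which contributes a constant; off F it is at most x, which contributes at most x *
  \<epsilon> / 2. The result makes f negligible against s in the upper bounds.\<close>

lemma min_potential_ratio_tendsto_0:
  assumes h: "h \<in> ell1_plus" and s: "\<And>k. 1 \<le> k \<Longrightarrow> 0 \<le> s k"
  shows "((\<lambda>x. min_potential s h x / x) \<longlongrightarrow> 0) at_top"
proof (rule tendstoI)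
  fix \<epsilon> :: real assume \<epsilon>: "0 < \<epsilon>"
  have hs: "h summable_on {1..}" and h0: "\<And>k. 1 \<le> k \<Longrightarrow> 0 \<le> h k" using h by (auto simp: ell1_plus_def)
  define S where "S = infsum h {1..}"
  have "(h has_sum S) {1..}" using hs by (simp add: S_def)
  then have "eventually (\<lambda>F. dist (sum h F) S < \<epsilon> / 2) (finite_subsets_at_top {1..})"
    unfolding has_sum_def using \<epsilon> by (intro tendstoD) auto
  then obtain F where F: "finite F" "F \<subseteq> {1..}" "dist (sum h F) S < \<epsilon> / 2"
    unfolding eventually_finite_subsets_at_top by blast
  define c where "c = (\<Sum>k\<in>F. s k * h k)"
  have bound: "0 \<le> min_potential s h x \<and> min_potential s h x \<le> c + x * (\<epsilon> / 2)" if x: "0 < x" for x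
  proof
    have sm: "(\<lambda>k. min x (s k) * h k) summable_on {1..}"
      using x by (intro summable_min_kernel h s) auto
    show "0 \<le> min_potential s h x"
      unfolding min_potential_def using x s h0 by (intro infsum_nonneg) auto
    have "min_potential s h x = infsum (\<lambda>k. min x (s k) * h k) (F \<union> ({1..} - F))"
      unfolding min_potential_def using F(2) by (intro arg_cong[of _ _ "infsum _"]) auto
    also have "\<dots> = infsum (\<lambda>k. min x (s k) * h k) F + infsum (\<lambda>k. min x (s k) * h k) ({1..} - F)"
      by (rule infsum_Un_disjoint[OF summable_on_finite[OF F(1)] summable_on_subset_banach[OF sm]]) auto
    also have "infsum (\<lambda>k. min x (s k) * h k) F \<le> c"
      unfolding c_def using F h0 by (auto intro!: sum_mono mult_right_mono)
    also have "infsum (\<lambda>k. min x (s k) * h k) ({1..} - F) \<le> infsum (\<lambda>k. x * h k) ({1..} - F)"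
    proof (rule infsum_mono)
      show "(\<lambda>k. min x (s k) * h k) summable_on {1..} - F" using x by (intro summable_on_subset_banach[OF sm]) auto
      show "(\<lambda>k. x * h k) summable_on {1..} - F" by (intro summable_on_cmult_right summable_on_subset_banach[OF hs]) auto
      show "min x (s k) * h k \<le> x * h k" if "k \<in> {1..} - F" for k
        using h0[of k] that by (intro mult_right_mono) auto
    qed
    also have "infsum (\<lambda>k. x * h k) ({1..} - F) = x * (S - sum h F)"
      using F hs by (simp add: infsum_cmult_right' infsum_Diff S_def)
    also have "\<dots> \<le> x * (\<epsilon> / 2)"
    proof (rule mult_left_mono)
      show "S - sum h F \<le> \<epsilon> / 2" using F(3) unfolding dist_real_def by linarith
    qed (use x in simp)
    finally show "min_potential s h x \<le> c + x * (\<epsilon> / 2)" by simp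
  qed
  have "((\<lambda>x. c / x) \<longlongrightarrow> 0) at_top" by real_asymp
  then have "eventually (\<lambda>x. c / x < \<epsilon> / 2) at_top" using \<epsilon> by (intro order_tendstoD(2)) auto
  then show "eventually (\<lambda>x. dist (min_potential s h x / x) 0 < \<epsilon>) at_top"
    using eventually_gt_at_top[of "0::real"]
  proof eventually_elim
    case (elim x)
    have "min_potential s h x / x \<le> (c + x * (\<epsilon> / 2)) / x"
      using bound[OF elim(2)] elim(2) by (intro divide_right_mono) auto
    also have "\<dots> = c / x + \<epsilon> / 2" using elim(2) by (simp add: add_divide_distrib)
    finally have "min_potential s h x / x < \<epsilon>" using elim(1) by linarith
    moreover have "0 \<le> min_potential s h x / x" using bound[OF elim(2)] elim(2) by simp
    ultimately show ?case by (simp only: dist_real_def diff_0_right abs_of_nonneg)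
  qed
qed

text \<open>With \<kappa> = 1 - \<epsilon> / 2, half of the slack goes into the rates; the other
  half is left for comparing ln n with the normalisation at J n.\<close>

lemma rate_constant:
  assumes "0 < \<epsilon>" "\<epsilon> < 1"
  shows "\<exists>Q>1. (1 - \<epsilon> / 2) * ((Q + 1) / (Q - 1)) < (1::real)"
proof -
  have T: "((\<lambda>Q. (1 - \<epsilon> / 2) * ((Q + 1) / (Q - 1))) \<longlongrightarrow> 1 - \<epsilon> / 2) (at_top :: real filter)"
    by real_asymp
  have "eventually (\<lambda>Q. (1 - \<epsilon> / 2) * ((Q + 1) / (Q - 1)) < 1) (at_top :: real filter)"
    by (rule order_tendstoD(2)[OF T]) (use assms in simp)
  then have "eventually (\<lambda>Q. 1 < Q \<and> (1 - \<epsilon> / 2) * ((Q + 1) / (Q - 1)) < 1) (at_top :: real filter)"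
    using eventually_gt_at_top[of "1::real"] by eventually_elim auto
  then show ?thesis using eventually_happens'[OF trivial_limit_at_top_linorder] by blast
qed

section \<open>Geometric subsequences in the two growth regimes\<close>

context excessive_permanental
begin

text \<open>Since J is strictly increasing, n \<le> J n, and an event that occurs for infinitely
  many n along J occurs for infinitely many indices j. The condition on g converts the position n in
  the subsequence into the normalisation at J n.\<close>

lemma frequently_ge_along:
  assumes \<epsilon>: "0 < \<epsilon>" "\<epsilon> < 1" and Q: "1 < Q" "(1 - \<epsilon> / 2) * ((Q + 1) / (Q - 1)) < 1"
    and J: "\<And>n. 1 \<le> J n" "\<And>n. Q * s (J n) \<le> s (J (Suc n))"
    and g: "eventually (\<lambda>n. (1 - \<epsilon>) * g (J n) \<le> (1 - \<epsilon> / 2) * ln (real n)) sequentially"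
  shows "AE \<omega> in M. \<exists>\<^sub>F j in sequentially. (1 - \<epsilon>) * (s j * g j) \<le> Y j \<omega>"
proof -
  have JSuc: "J n < J (Suc n)" for n
  proof (rule ccontr)
    assume "\<not> J n < J (Suc n)"
    then have "s (J (Suc n)) \<le> s (J n)" using s_le_iff J(1) by simp
    moreover have "s (J n) < Q * s (J n)" using s_pos J(1)[of n] Q by simp
    ultimately show False using J(2)[of n] by simp
  qed
  then have "strict_mono J" by (rule strict_mono_Suc_iff[THEN iffD2, rule_format])
  then have Jn: "n \<le> J n" for n by (rule strict_mono_imp_increasing)
  have "AE \<omega> in M. \<exists>\<^sub>F n in sequentially. (1 - \<epsilon> / 2) * s (J n) * ln (real n) < Y (J n) \<omega>"
    by (rule frequently_large[where J = J and Q = Q and \<kappa> = "1 - \<epsilon> / 2", OF J Q(1) _ Q(2)]) (use \<epsilon> in simp)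
  then show ?thesis
  proof eventually_elim
    case (elim \<omega>)
    have "\<exists>\<^sub>F n in sequentially. (1 - \<epsilon>) * (s (J n) * g (J n)) \<le> Y (J n) \<omega>"
    proof (rule frequently_rev_mp[OF elim], use g in eventually_elim, rule impI)
      fix n assume "(1 - \<epsilon>) * g (J n) \<le> (1 - \<epsilon> / 2) * ln (real n)" "(1 - \<epsilon> / 2) * s (J n) * ln (real n) < Y (J n) \<omega>"
      moreover have "0 < s (J n)" using s_pos J by simp
      ultimately have "s (J n) * ((1 - \<epsilon>) * g (J n)) \<le> s (J n) * ((1 - \<epsilon> / 2) * ln (real n))"
        by (intro mult_left_mono) auto
      then show "(1 - \<epsilon>) * (s (J n) * g (J n)) \<le> Y (J n) \<omega>"
        using \<open>(1 - \<epsilon> / 2) * s (J n) * ln (real n) < Y (J n) \<omega>\<close> by (simp add: mult_ac)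
    qed
    then show ?case unfolding frequently_sequentially by (meson Jn order.trans)
  qed
qed

text \<open>Consecutive ratios exceed some q > 1 from an index on, so every m-th index gives ratio
  at least Q when q ^ m > Q. Such an arithmetic progression does not change the logarithm of the
  index to first order.\<close>

lemma frequently_ge_log:
  assumes \<epsilon>: "0 < \<epsilon>" "\<epsilon> < 1" and lim: "1 < liminf (\<lambda>j. ereal (s j / s (j - 1)))"
  shows "AE \<omega> in M. \<exists>\<^sub>F j in sequentially. (1 - \<epsilon>) * (s j * ln (real j)) \<le> Y j \<omega>"
proof -
  obtain q where q: "1 < q" "ereal q < liminf (\<lambda>j. ereal (s j / s (j - 1)))"
    using ereal_dense2[OF lim] by (auto simp: one_ereal_def)
  from less_LiminfD[OF q(2)] obtain j0 where j0: "\<And>j. j0 \<le> j \<Longrightarrow> q < s j / s (j - 1)"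
    unfolding eventually_sequentially by auto
  have step: "q * s j \<le> s (Suc j)" if "j0 \<le> j" "1 \<le> j" for j
    using j0[of "Suc j"] s_pos[of j] that by (simp add: field_simps)
  obtain Q where Q: "1 < Q" "(1 - \<epsilon> / 2) * ((Q + 1) / (Q - 1)) < 1" using rate_constant[OF \<epsilon>] by blast
  obtain m where m: "Q < q ^ m" using real_arch_pow[OF q(1)] by blast
  define j1 where "j1 = Suc j0"
  have steps: "q ^ k * s j \<le> s (j + k)" if "j1 \<le> j" for k j
  proof (induction k)
    case (Suc k)
    have "q ^ Suc k * s j = q * (q ^ k * s j)" by simp
    also have "\<dots> \<le> q * s (j + k)" using Suc q by (intro mult_left_mono) auto
    also have "\<dots> \<le> s (Suc (j + k))" using that by (intro step) (auto simp: j1_def)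
    finally show ?case by simp
  qed simp
  show ?thesis
  proof (rule frequently_ge_along[OF \<epsilon> Q, where J = "\<lambda>n. j1 + m * n"])
    show "1 \<le> j1 + m * n" for n by (simp add: j1_def)
    show "Q * s (j1 + m * n) \<le> s (j1 + m * Suc n)" for n
    proof -
      have "Q * s (j1 + m * n) \<le> q ^ m * s (j1 + m * n)"
        using m s_pos[of "j1 + m * n"] by (intro mult_right_mono) (auto simp: j1_def)
      also have "\<dots> \<le> s (j1 + m * n + m)" by (rule steps) simp
      finally show ?thesis by (simp add: add_ac)
    qed
    define a where "a = real j1"
    define b where "b = real m"
    have "m \<noteq> 0" using m Q by (intro notI) simp
    then have ab: "0 < a" "0 < b" by (auto simp: a_def b_def j1_def)
    have "eventually (\<lambda>n. (1 - \<epsilon>) * ln (a + b * real n) \<le> (1 - \<epsilon> / 2) * ln (real n)) sequentially"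
    proof -
      define u v where "u = 1 - \<epsilon>" and "v = \<epsilon> / 2"
      have uv: "0 < u" "0 < v" using \<epsilon> by (auto simp: u_def v_def)
      have ev: "eventually (\<lambda>n. u * ln (a + b * real n) \<le> (u + v) * ln (real n)) sequentially"
        using uv ab by real_asymp
      have eq: "u + v = 1 - \<epsilon> / 2" by (simp add: u_def v_def)
      show ?thesis using ev unfolding eq by (simp only: u_def)
    qed
    then show "eventually (\<lambda>n. (1 - \<epsilon>) * ln (real (j1 + m * n)) \<le> (1 - \<epsilon> / 2) * ln (real n)) sequentially"
      by (simp add: a_def b_def)
  qed
qed

text \<open>J n is the first index at which s reaches A * R ^ n. Ratios bounded by C limit the
  overshoot to a factor C, so R = Q * C forces consecutive ratios of at least Q, while ln (s (J n))
  is at most affine in n; hence ln (ln (s (J n))) is ln n to first order.\<close>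

lemma frequently_ge_loglog:
  assumes \<epsilon>: "0 < \<epsilon>" "\<epsilon> < 1" and s_top: "filterlim s at_top sequentially"
    and lim: "limsup (\<lambda>j. ereal (s j / s (j - 1))) < \<infinity>"
  shows "AE \<omega> in M. \<exists>\<^sub>F j in sequentially. (1 - \<epsilon>) * (s j * ln (ln (s j))) \<le> Y j \<omega>"
proof -
  obtain C' where C': "limsup (\<lambda>j. ereal (s j / s (j - 1))) < ereal C'"
    using ereal_dense2[OF lim] by auto
  from Limsup_lessD[OF C'] obtain j0 where j0: "\<And>j. j0 \<le> j \<Longrightarrow> s j / s (j - 1) < C'"
    unfolding eventually_sequentially by auto
  define C where "C = max C' 1"
  have C1: "1 \<le> C" by (simp add: C_def)
  have step: "s (Suc j) \<le> C * s j" if "j0 \<le> j" "1 \<le> j" for j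
  proof -
    have "s (Suc j) \<le> C' * s j" using j0[of "Suc j"] s_pos[of j] that by (simp add: field_simps)
    also have "\<dots> \<le> C * s j" using s_pos[of j] that by (intro mult_right_mono) (auto simp: C_def)
    finally show ?thesis .
  qed
  obtain Q where Q: "1 < Q" "(1 - \<epsilon> / 2) * ((Q + 1) / (Q - 1)) < 1" using rate_constant[OF \<epsilon>] by blast
  define R where "R = Q * C"
  have "1 * 1 < Q * C" using Q C1 by (intro mult_less_le_imp_less) auto
  then have R: "1 < R" by (simp add: R_def)
  \<comment> \<open>The first summand places J n beyond Suc j0, where the ratio bound holds for the
    step into J n; the second makes ln (s (J n)) larger than 1.\<close>
  define A where "A = s (Suc j0) + exp 1"
  have A: "exp 1 < A" using s_pos[of "Suc j0"] by (simp add: A_def)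
  have A0: "0 < A" using A by (rule less_trans[OF exp_gt_zero])
  define P where "P n j \<longleftrightarrow> 1 \<le> j \<and> A * R ^ n \<le> s j" for n j
  have Pex: "\<exists>j. P n j" for n
  proof -
    have "eventually (\<lambda>j. A * R ^ n \<le> s j) sequentially" using s_top by (simp add: filterlim_at_top)
    then have "eventually (\<lambda>j. P n j) sequentially"
      using eventually_ge_at_top[of "1::nat"] by eventually_elim (simp add: P_def)
    then show ?thesis by (rule eventually_happens'[OF sequentially_bot])
  qed
  define J where "J n = (LEAST j. P n j)" for n
  have J: "1 \<le> J n" "A * R ^ n \<le> s (J n)" for n
    using LeastI_ex[OF Pex[of n]] by (auto simp: J_def P_def)
  have upper: "s (J n) \<le> C * (A * R ^ n)" for n
  proof -
    have "A * 1 \<le> A * R ^ n" using R A0 by (intro mult_left_mono) auto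
    moreover have "s (Suc j0) < A" by (simp add: A_def)
    ultimately have "s (Suc j0) < s (J n)" using J(2)[of n] by linarith
    then have lt: "Suc j0 < J n" using s_le_iff[of "J n" "Suc j0"] J(1)[of n] by simp
    define i where "i = J n - 1"
    have i: "J n = Suc i" "j0 \<le> i" "1 \<le> i" using lt by (auto simp: i_def)
    have "\<not> P n i" using not_less_Least[of i "P n"] i unfolding J_def by simp
    then have "s i < A * R ^ n" using i by (simp add: P_def)
    then have "C * s i \<le> C * (A * R ^ n)" using C1 by (intro mult_left_mono) auto
    then show ?thesis using step[of i] i by simp
  qed
  show ?thesis
  proof (rule frequently_ge_along[OF \<epsilon> Q, where J = J])
    show "1 \<le> J n" for n by (rule J)
    show "Q * s (J n) \<le> s (J (Suc n))" for n
    proof -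
      have "Q * s (J n) \<le> Q * (C * (A * R ^ n))" using Q upper[of n] by (intro mult_left_mono) auto
      also have "\<dots> = A * R ^ Suc n" by (simp add: R_def)
      also have "\<dots> \<le> s (J (Suc n))" by (rule J)
      finally show ?thesis .
    qed
    define u v a b where "u = 1 - \<epsilon>" and "v = \<epsilon> / 2" and "a = ln (C * A)" and "b = ln R"
    have uv: "0 < u" "0 < v" "0 < b" using \<epsilon> R by (auto simp: u_def v_def b_def)
    have "eventually (\<lambda>n. u * ln (a + b * real n) \<le> (u + v) * ln (real n)) sequentially"
      using uv by real_asymp
    then show "eventually (\<lambda>n. (1 - \<epsilon>) * ln (ln (s (J n))) \<le> (1 - \<epsilon> / 2) * ln (real n)) sequentially"
    proof eventually_elim
      case (elim n)
      have "A * 1 \<le> A * R ^ n" using R A0 by (intro mult_left_mono) auto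
      then have sA: "exp 1 < s (J n)" using A J(2)[of n] by simp
      then have s0: "0 < s (J n)" by (rule less_trans[OF exp_gt_zero])
      have "ln (exp 1) < ln (s (J n))" using sA s0 by (subst ln_less_cancel_iff) auto
      then have l1: "1 < ln (s (J n))" by simp
      have "ln (s (J n)) \<le> ln (C * A * R ^ n)"
        using upper[of n] s0 C1 A0 R by (subst ln_le_cancel_iff) (auto simp: mult.assoc)
      also have "\<dots> = a + b * real n"
        using C1 A0 R by (simp add: a_def b_def ln_mult ln_realpow)
      finally have "ln (ln (s (J n))) \<le> ln (a + b * real n)" using l1 by (subst ln_le_cancel_iff) auto
      then have "u * ln (ln (s (J n))) \<le> u * ln (a + b * real n)" using uv by (intro mult_left_mono) auto
      also have "\<dots> \<le> (u + v) * ln (real n)" by (rule elim)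
      finally show ?case by (simp add: u_def v_def)
    qed
  qed
qed

end

theorem corollary1p1:
  fixes s h f :: "nat \<Rightarrow> real" and \<alpha> :: real
    and M :: "'a measure" and Y :: "nat \<Rightarrow> 'a \<Rightarrow> real"
  assumes "strict_mono_on {1..} s"
    and "s 1 > 0"
    and "filterlim s at_top sequentially"
    and "h \<in> ell1_plus"
    and "f = kernel_apply (min_kernel s) h"
    and "\<alpha> > 0"
    and "prob_space M"
    and "permanental_sequence M \<alpha> (\<lambda>j k. min_kernel s j k + f k) Y"
  shows "(limsup (\<lambda>j. ereal (s j / s (j - 1))) < \<infinity> \<longrightarrow>
            (AE \<omega> in M. limsup (\<lambda>j. ereal (Y j \<omega> / (s j * ln (ln (s j))))) = 1)) \<and>
         (liminf (\<lambda>j. ereal (s j / s (j - 1))) > 1 \<longrightarrow>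
            (AE \<omega> in M. limsup (\<lambda>j. ereal (Y j \<omega> / (s j * ln (real j)))) = 1))"
proof -
  have mono: "s i < s j" if "1 \<le> i" "i < j" for i j
    using strict_mono_onD[OF assms(1), of i j] that by auto
  have pos: "0 < s i" if "1 \<le> i" for i
    using mono[of 1 i] assms(2) that by (cases "i = 1") auto
  then have nonneg: "\<And>k. 1 \<le> k \<Longrightarrow> 0 \<le> s k" by (simp add: less_imp_le)
  have f: "f j = min_potential s h (s j)" for j
    by (simp add: assms(5) kernel_apply_def min_kernel_def min_potential_def)
  have F0: "min_potential s h 0 = 0" by (rule min_potential_0[OF nonneg])
  interpret prob_space M by (rule assms(7))
  interpret excessive_permanental M s f \<alpha> Y
  proof
    show "s i < s j" if "1 \<le> i" "i < j" for i j using that by (rule mono)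
    show "0 < s i" if "1 \<le> i" for i using that by (rule pos)
    show "f i \<le> f j" if "1 \<le> i" "i \<le> j" for i j
      unfolding f using that mono[of i j] pos[of i]
      by (intro min_potential_mono[OF assms(4) nonneg]) (auto simp: le_less)
    show "0 \<le> f i" if "1 \<le> i" for i
      using min_potential_mono[where s = s, OF assms(4) nonneg, where a = 0 and b = "s i"] pos[OF that] unfolding f F0 by simp
    show "(f k - f j) / (s k - s j) \<le> (f j - f i) / (s j - s i)" if "1 \<le> i" "i < j" "j < k" for i j k
      unfolding f using that mono[of i j] mono[of j k] pos[of i]
      by (intro min_potential_concave[OF assms(4) nonneg]) auto
    \<comment> \<open>Concavity with base point 0, where the potential vanishes.\<close>
    show "(f j - f i) / (s j - s i) \<le> f i / s i" if "1 \<le> i" "i < j" for i j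
      using min_potential_concave[where s = s, OF assms(4) nonneg, where a = 0 and b = "s i" and c = "s j"] that mono[of i j] pos[of i]
      unfolding f F0 by simp
    show "0 < \<alpha>" by fact
    show "permanental_sequence M \<alpha> (\<lambda>j k. min_kernel s j k + f k) Y" by fact
  qed
  have f_ratio: "(\<lambda>j. f j / s j) \<longlonglongrightarrow> 0"
    unfolding f by (rule filterlim_compose[OF min_potential_ratio_tendsto_0[OF assms(4) nonneg] assms(3)])
  have ev_pos: "eventually (\<lambda>j. 1 \<le> j \<and> exp 1 < s j \<and> 1 < real j) sequentially"
  proof -
    have "eventually (\<lambda>j. exp 1 < s j) sequentially" using assms(3) by (simp add: filterlim_at_top_dense)
    then show ?thesis using eventually_gt_at_top[of "1::nat"] by eventually_elim auto
  qed
  show ?thesis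
  proof (intro conjI impI)
    assume lim: "limsup (\<lambda>j. ereal (s j / s (j - 1))) < \<infinity>"
    show "AE \<omega> in M. limsup (\<lambda>j. ereal (Y j \<omega> / (s j * ln (ln (s j))))) = 1"
    proof (rule AE_limsup_eq_1)
      show "eventually (\<lambda>j. 0 < s j * ln (ln (s j))) sequentially"
        using ev_pos
      proof eventually_elim
        case (elim j)
        then have "ln (exp 1) < ln (s j)" using pos[of j] by (subst ln_less_cancel_iff) auto
        then have "0 < ln (ln (s j))" by (intro ln_gt_zero) simp
        then show ?case using pos[of j] elim by (intro mult_pos_pos) auto
      qed
    qed (use eventually_le_loglog[OF assms(3) f_ratio] frequently_ge_loglog[OF _ _ assms(3) lim] in auto)
  next
    assume lim: "1 < liminf (\<lambda>j. ereal (s j / s (j - 1)))"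
    show "AE \<omega> in M. limsup (\<lambda>j. ereal (Y j \<omega> / (s j * ln (real j)))) = 1"
    proof (rule AE_limsup_eq_1)
      show "eventually (\<lambda>j. 0 < s j * ln (real j)) sequentially"
        using ev_pos by eventually_elim (use pos in auto)
    qed (use eventually_le_log[OF f_ratio] frequently_ge_log[OF _ _ lim] in auto)
  qed
qed

end
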